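(* Let $m,n$ be nonnegative integers with $p=2m+n\geq 2$, and let $\Delta\geq 5$. Let $\mathcal{G}_\Delta$ be the family of simple graphs with maximum degree $\Delta$. Then $p^{\Delta/2}\leq \chi_{(m,n)}(\mathcal{G}_\Delta)\leq 2(\Delta-1)^p p^{\Delta-1}+2$.
   Context: An $(m,n)$-colored mixed graph is a graph whose connections are either arcs, each colored with one of $m$ colors $\alpha_1,\dots,\alpha_m$, or edges, each colored with one of $n$ colors $\beta_1,\dots,\beta_n$, such that the underlying undirected graph (forgetting orientations and colors) is simple. A colored homomorphism of $G$ to $H$ is a vertex map sending each arc (resp. edge) of $G$ to an arc (resp. edge) of $H$ of the same color, preserving arc direction. For an $(m,n)$-colored mixed graph $G$, $\chi_{(m,n)}(G)$ is the minimum number of vertices of an $(m,n)$-colored mixed graph $H$ such that $G$ admits a colored homomorphism to $H$. For a simple undirected graph $G$, $\chi_{(m,n)}(G)$ is the maximum of $\chi_{(m,n)}(G')$ over all $(m,n)$-colored mixed graphs $G'$ with underlying graph $G$; for a family $\mathcal{F}$ of simple graphs, $\chi_{(m,n)}(\mathcal{F})$ is the supremum of $\chi_{(m,n)}(G)$ over $G\in\mathcal{F}$. *)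

theory Defs
  imports "HOL-Library.Extended_Real"
begin

text \<open>All graphs are finite. A simple graph is a pair of a vertex set and a set of
  two-element vertex sets.\<close>

type_synonym 'a sgraph = "'a set \<times> 'a set set"

definition simple_graph :: "'a sgraph \<Rightarrow> bool" where
  "simple_graph G \<longleftrightarrow> finite (fst G) \<and> (\<forall>e\<in>snd G. e \<subseteq> fst G \<and> card e = 2)"

definition degree :: "'a sgraph \<Rightarrow> 'a \<Rightarrow> nat" where
  "degree G v = card {e \<in> snd G. v \<in> e}"

text \<open>Inserting 0 only fixes the value for the graph without vertices.\<close>

definition max_degree :: "'a sgraph \<Rightarrow> nat" where
  "max_degree G = Max (insert 0 (degree G ` fst G))"

text \<open>\<open>Arc u v i\<close> is an arc from \<open>u\<close> to \<open>v\<close>, \<open>Edge e j\<close> an undirected edge with set of end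
  points \<open>e\<close>. The arc colours are the numbers below \<open>m\<close> and the edge colours, a disjoint
  supply, the numbers below \<open>n\<close>.\<close>

datatype 'a connection = Arc 'a 'a nat | Edge "'a set" nat

fun ends :: "'a connection \<Rightarrow> 'a set" where
  "ends (Arc u v i) = {u, v}"
| "ends (Edge e j) = e"

fun admissible_colour :: "nat \<Rightarrow> nat \<Rightarrow> 'a connection \<Rightarrow> bool" where
  "admissible_colour m n (Arc u v i) \<longleftrightarrow> i < m"
| "admissible_colour m n (Edge e j) \<longleftrightarrow> j < n"

type_synonym 'a mixed_graph = "'a set \<times> 'a connection set"

definition underlying :: "'a mixed_graph \<Rightarrow> 'a sgraph" where
  "underlying G = (fst G, ends ` snd G)"

text \<open>Injectivity of \<^const>\<open>ends\<close> excludes parallel connections, which the set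
  \<^term>\<open>ends ` snd G\<close> would merge; loops are excluded by \<^const>\<open>simple_graph\<close>.\<close>

definition mixed_graph :: "nat \<Rightarrow> nat \<Rightarrow> 'a mixed_graph \<Rightarrow> bool" where
  "mixed_graph m n G \<longleftrightarrow>
     (\<forall>c\<in>snd G. admissible_colour m n c) \<and> inj_on ends (snd G) \<and> simple_graph (underlying G)"

definition colored_hom :: "('a \<Rightarrow> 'b) \<Rightarrow> 'a mixed_graph \<Rightarrow> 'b mixed_graph \<Rightarrow> bool" where
  "colored_hom f G H \<longleftrightarrow>
     f ` fst G \<subseteq> fst H \<and>
     (\<forall>u v i. Arc u v i \<in> snd G \<longrightarrow> Arc (f u) (f v) i \<in> snd H) \<and>
     (\<forall>e j. Edge e j \<in> snd G \<longrightarrow> Edge (f ` e) j \<in> snd H)"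

text \<open>Every finite graph is isomorphic to one with vertices in \<^typ>\<open>nat\<close>, so it suffices to
  let the targets range over these.\<close>

definition chi_mixed :: "nat \<Rightarrow> nat \<Rightarrow> 'a mixed_graph \<Rightarrow> nat" where
  "chi_mixed m n G =
     (LEAST k. \<exists>H :: nat mixed_graph. mixed_graph m n H \<and> card (fst H) = k \<and>
        (\<exists>f. colored_hom f G H))"

text \<open>For a simple graph the maximum is over a finite set; it is nonempty if \<open>m + n > 0\<close>.\<close>

definition chi_graph :: "nat \<Rightarrow> nat \<Rightarrow> 'a sgraph \<Rightarrow> nat" where
  "chi_graph m n G = Max {chi_mixed m n G' | G'. mixed_graph m n G' \<and> underlying G' = G}"

definition chi_family :: "nat \<Rightarrow> nat \<Rightarrow> 'a sgraph set \<Rightarrow> enat" where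
  "chi_family m n F = (SUP G\<in>F. enat (chi_graph m n G))"

definition graphs_max_degree :: "nat \<Rightarrow> nat sgraph set" where
  "graphs_max_degree \<Delta> = {G. simple_graph G \<and> max_degree G = \<Delta>}"

end

theory Submission
  imports Defs Complex_Main "HOL-Library.FuncSet" "HOL-Library.Disjoint_Sets"
begin

text \<open>Write \<open>k = \<Delta> - 1\<close>, and give an arc of colour \<open>i\<close> the type \<open>2 * i\<close> seen from its tail and \<open>2 * i + 1\<close>
  seen from its head, and an edge of colour \<open>j\<close> the type \<open>2 * m + j\<close>.

  Upper bound. One random complete target serves all graphs. In it every choice of \<open>k\<close> vertices and
  of types towards them is realised by many vertices, so a graph can be coloured greedily in the order of
  decreasing distance to a root: every vertex but the root then has at most \<open>k\<close> coloured
  neighbours, and those realisations are avoided that would give two neighbours of an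
  uncoloured vertex the same colour with different types. If a component is \<open>\<Delta>\<close>-regular, its root has
  \<open>k + 1\<close> coloured neighbours; then a vertex \<open>w\<close> that is not a cut vertex is mapped to a special vertex of the
  target (the apex), and a neighbour of \<open>w\<close> is coloured last, simultaneously with one of its own
  neighbours. This needs an edge of prescribed type between two sets of realisations.

  For \<open>p = 2\<close> the union bound over the choices of types is too expensive for small \<open>k\<close>. There the
  target consists of pairs of antitwins, which have opposite types towards all other
  vertices. This leaves the expected number of realisations unchanged and halves the number of
  vertices over which the union is taken.

  Lower bound. A graph with \<open>e\<close> edges and \<open>v\<close> vertices has \<open>p ^ e\<close> colourings, and each is determined by a map to
  \<open>K\<close> vertices and the types between these. For \<open>L\<close> copies of the complete bipartite graph on
  \<open>\<Delta> + \<Delta>\<close> vertices this gives \<open>(p ^ \<Delta>) ^ (L * \<Delta>) \<le> (K\<^sup>2) ^ (L * \<Delta>) * p ^ K\<^sup>2\<close> for all \<open>L\<close>, hence \<open>p ^ \<Delta> \<le> K\<^sup>2\<close>.\<close>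

subsection \<open>Averages over independent choices\<close>

text \<open>The bound dictates the size of the target, so the union bounds have to succeed with
  exactly that many vertices. Greedy steps are cheap: with \<open>k - j\<close> coloured neighbours,
  a vertex has at most \<open>j + 1\<close> uncoloured ones, which exclude at most
  \<open>k - 1\<close> vertices each, while the \<open>j\<close> free types leave
  \<open>2 ^ j * k\<close> choices. Hence \<open>k\<close> realisations of every \<open>k\<close>
  types suffice. The costly property is the last edge of a regular component. With a random base in
  place of the apex, the union would range over one more base and grow by a factor of order
  \<open>M\<close>; the types towards the apex are fixed in advance and cost nothing there. For
  \<open>p \<ge> 3\<close> the decisive expectation is then \<open>2 * k ^ p / p\<close>, against
  the logarithm of the number of configurations, about \<open>k\<close> times that of
  \<open>2 * k ^ p * p ^ k\<close>. For \<open>p = 2\<close> this would set \<open>k ^ 2\<close>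
  against \<open>k ^ 2 * ln 2\<close> and lower order terms, which prevail for small
  \<open>k\<close>; there the last edge is sought among all pairs of realisations instead of from
  one fixed end.\<close>

definition avg :: "'i set \<Rightarrow> 'c set \<Rightarrow> (('i \<Rightarrow> 'c) \<Rightarrow> real) \<Rightarrow> real" where
  "avg I S f = (\<Sum>h\<in>PiE I (\<lambda>_. S). f h) / real (card S) ^ card I"

text \<open>All functions are quantified over, not only those in the product set, so that changing a
  coordinate never leaves the scope of the property.\<close>

definition depends_only :: "'i set \<Rightarrow> (('i \<Rightarrow> 'c) \<Rightarrow> 'd) \<Rightarrow> bool" where
  "depends_only J f \<longleftrightarrow> (\<forall>h h'. (\<forall>i\<in>J. h i = h' i) \<longrightarrow> f h = f h')"

lemma depends_onlyI: "(\<And>h h'. (\<And>i. i \<in> J \<Longrightarrow> h i = h' i) \<Longrightarrow> f h = f h') \<Longrightarrow> depends_only J f"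
  unfolding depends_only_def by blast

lemma depends_onlyD: "depends_only J f \<Longrightarrow> (\<And>i. i \<in> J \<Longrightarrow> h i = h' i) \<Longrightarrow> f h = f h'"
  unfolding depends_only_def by blast

lemma depends_only_comp: "depends_only J f \<Longrightarrow> depends_only J (\<lambda>h. F (f h))"
  unfolding depends_only_def by metis

lemma avg_add: "avg I S (\<lambda>h. f h + g h) = avg I S f + avg I S g"
  unfolding avg_def by (simp add: sum.distrib add_divide_distrib)

lemma avg_cmult: "avg I S (\<lambda>h. c * f h) = c * avg I S f"
  unfolding avg_def by (simp add: sum_distrib_left)

lemma avg_diff: "avg I S (\<lambda>h. f h - g h) = avg I S f - avg I S g"
  unfolding avg_def by (simp add: sum_subtractf diff_divide_distrib)

lemma avg_sum: "avg I S (\<lambda>h. \<Sum>x\<in>X. f x h) = (\<Sum>x\<in>X. avg I S (f x))"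
  unfolding avg_def by (subst sum.swap) (simp add: sum_divide_distrib)

lemma avg_mono:
  assumes "\<And>h. h \<in> PiE I (\<lambda>_. S) \<Longrightarrow> f h \<le> g h"
  shows "avg I S f \<le> avg I S g"
  unfolding avg_def by (intro divide_right_mono sum_mono assms) auto

lemma avg_const:
  assumes "finite I" "finite S" "S \<noteq> {}"
  shows "avg I S (\<lambda>h. c) = c"
  using assms by (simp add: avg_def card_PiE)

lemma avg_less_oneE:
  assumes "finite I" "finite S" "S \<noteq> {}" and "avg I S f < 1"
  obtains h where "h \<in> PiE I (\<lambda>_. S)" "f h < 1"
proof -
  have "\<exists>h\<in>PiE I (\<lambda>_. S). f h < 1"
  proof (rule ccontr)
    assume "\<not> (\<exists>h\<in>PiE I (\<lambda>_. S). f h < 1)"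
    then have "avg I S (\<lambda>_. 1) \<le> avg I S f" by (intro avg_mono) (auto simp: not_less)
    with assms show False by (simp add: avg_const)
  qed
  with that show thesis by blast
qed

lemma avg_insert:
  assumes "finite I" "i \<notin> I" "finite S"
  shows "avg (insert i I) S f = (\<Sum>c\<in>S. avg I S (\<lambda>h. f (h(i := c)))) / real (card S)"
proof -
  have "(\<Sum>h\<in>PiE (insert i I) (\<lambda>_. S). f h)
      = (\<Sum>(c, h)\<in>S \<times> PiE I (\<lambda>_. S). f (h(i := c)))"
    unfolding PiE_insert_eq
    by (subst sum.reindex) (use inj_combinator[OF assms(2), of "\<lambda>_. S"] in
      \<open>auto simp: case_prod_unfold\<close>)
  also have "\<dots> = (\<Sum>c\<in>S. \<Sum>h\<in>PiE I (\<lambda>_. S). f (h(i := c)))"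
    by (simp add: sum.cartesian_product)
  finally show ?thesis
    using assms by (simp add: avg_def sum_divide_distrib[symmetric] mult.commute)
qed

text \<open>Independence. Every coordinate is missing from \<open>J\<close> or from
  \<open>J'\<close>, so averaging over it leaves one factor constant and acts on the other alone;
  induction over the coordinates separates the factors.\<close>

lemma avg_mult:
  fixes f g :: "('i \<Rightarrow> 'c) \<Rightarrow> real"
  assumes "finite I" "finite S" "S \<noteq> {}"
    and "depends_only J f" "depends_only J' g" "J \<inter> J' = {}"
  shows "avg I S (\<lambda>h. f h * g h) = avg I S f * avg I S g"
  using assms(1,4,5)
proof (induction I arbitrary: f g rule: finite_induct)
  case empty
  then show ?case by (simp add: avg_def)
next
  case (insert i I)
  have dep: "depends_only K (\<lambda>h. e (h(i := c)))" if "depends_only K e"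
    for K c and e :: "('i \<Rightarrow> 'c) \<Rightarrow> real"
    by (rule depends_onlyI, rule depends_onlyD[OF that]) auto
  have const: "e (h(i := c)) = e h" if "depends_only K e" "i \<notin> K"
    for K c h and e :: "('i \<Rightarrow> 'c) \<Rightarrow> real"
    by (rule depends_onlyD[OF that(1)]) (use that(2) in auto)
  have S: "real (card S) \<noteq> 0" using assms by simp
  have c: "avg (insert i I) S e = avg I S e" if "depends_only K e" "i \<notin> K"
    for K and e :: "('i \<Rightarrow> 'c) \<Rightarrow> real"
    using insert.hyps assms(2) S const[OF that] by (simp add: avg_insert)
  have ih: "avg I S (\<lambda>h. f (h(i := c)) * g (h(i := c)))
      = avg I S (\<lambda>h. f (h(i := c))) * avg I S (\<lambda>h. g (h(i := c)))" for c
    by (rule insert.IH; rule dep; fact insert.prems)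
  show ?case
  proof (cases "i \<in> J")
    case True
    then have "i \<notin> J'" using assms(6) by auto
    with insert.prems ih c[of J' g] const[of J' g] insert.hyps assms(2) show ?thesis
      by (simp add: avg_insert sum_distrib_right)
  next
    case False
    with insert.prems ih c[of J f] const[of J f] insert.hyps assms(2) show ?thesis
      by (simp add: avg_insert sum_distrib_left[symmetric])
  qed
qed

lemma depends_only_prod:
  assumes "\<And>y. y \<in> R \<Longrightarrow> depends_only (B y) (f y)"
  shows "depends_only (\<Union>y\<in>R. B y) (\<lambda>h. \<Prod>y\<in>R. f y h :: real)"
  by (rule depends_onlyI, rule prod.cong[OF refl], rule depends_onlyD[OF assms]) auto

lemma avg_prod:
  fixes f :: "'r \<Rightarrow> ('i \<Rightarrow> 'c) \<Rightarrow> real"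
  assumes "finite I" "finite S" "S \<noteq> {}" "finite R"
    and "\<And>y. y \<in> R \<Longrightarrow> depends_only (B y) (f y)" "disjoint_family_on B R"
  shows "avg I S (\<lambda>h. \<Prod>y\<in>R. f y h) = (\<Prod>y\<in>R. avg I S (f y))"
  using assms(4,5,6)
proof (induction R rule: finite_induct)
  case empty
  then show ?case using assms by (simp add: avg_const)
next
  case (insert y R)
  have "avg I S (\<lambda>h. f y h * (\<Prod>y\<in>R. f y h)) = avg I S (f y) * avg I S (\<lambda>h. \<Prod>y\<in>R. f y h)"
  proof (rule avg_mult[OF assms(1-3)])
    show "depends_only (B y) (f y)" using insert.prems by auto
    show "depends_only (\<Union>y\<in>R. B y) (\<lambda>h. \<Prod>y\<in>R. f y h)"
      by (rule depends_only_prod) (use insert.prems in auto)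
    show "B y \<inter> (\<Union>y\<in>R. B y) = {}"
      using insert.prems(2) insert.hyps by (auto simp: disjoint_family_on_def)
  qed
  moreover have "disjoint_family_on B R"
    using insert.prems(2) by (rule disjoint_family_on_mono[rotated]) auto
  ultimately show ?case using insert by simp
qed

lemma avg_coord:
  assumes "finite I" "finite S" "S \<noteq> {}" "i \<in> I"
  shows "avg I S (\<lambda>h. F (h i)) = (\<Sum>c\<in>S. F c) / real (card S)"
proof -
  have "avg (insert i (I - {i})) S (\<lambda>h. F (h i)) = (\<Sum>c\<in>S. F c) / real (card S)"
    using assms by (subst avg_insert) (simp_all add: avg_const)
  with assms(4) show ?thesis by (simp add: insert_absorb)
qed

lemma of_bool_Ball: "finite D \<Longrightarrow> (of_bool (\<forall>d\<in>D. P d) :: real) = (\<Prod>d\<in>D. of_bool (P d))"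
  by (induction D rule: finite_induct) auto

lemma avg_pattern:
  assumes "finite I" "finite S" "S \<noteq> {}" "D \<subseteq> I" "\<And>d. d \<in> D \<Longrightarrow> v d \<in> S"
  shows "avg I S (\<lambda>h. of_bool (\<forall>d\<in>D. h d = v d)) = (1 / real (card S)) ^ card D"
    and "avg I S (\<lambda>h. of_bool (\<forall>d\<in>D. h d \<noteq> v d)) = (1 - 1 / real (card S)) ^ card D"
proof -
  have D: "finite D" using assms finite_subset by blast
  have S: "real (card S) > 0" using assms by (simp add: card_gt_0_iff)
  have "avg I S (\<lambda>h. of_bool (h d = v d)) = 1 / real (card S)" if "d \<in> D" for d
    using assms that by (subst avg_coord[where F = "\<lambda>c. of_bool (c = v d)"]) auto
  moreover have "disjoint_family_on (\<lambda>d. {d}) D" by (auto simp: disjoint_family_on_def)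
  ultimately show "avg I S (\<lambda>h. of_bool (\<forall>d\<in>D. h d = v d)) = (1 / real (card S)) ^ card D"
    unfolding of_bool_Ball[OF D]
    by (subst avg_prod[where B = "\<lambda>d. {d}"]) (use assms D in \<open>auto intro!: depends_onlyI\<close>)
  have "avg I S (\<lambda>h. of_bool (h d \<noteq> v d)) = 1 - 1 / real (card S)" if "d \<in> D" for d
  proof -
    have "(\<Sum>c\<in>S. of_bool (c \<noteq> v d)) = (\<Sum>c\<in>S. 1 - of_bool (c = v d) :: real)"
      by (rule sum.cong) auto
    also have "\<dots> = real (card S) - 1"
      using assms(2,5) that by (simp add: sum_subtractf)
    finally show ?thesis using assms that S
      by (subst avg_coord[where F = "\<lambda>c. of_bool (c \<noteq> v d)"]) (auto simp: field_simps)
  qed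
  moreover have "disjoint_family_on (\<lambda>d. {d}) D" by (auto simp: disjoint_family_on_def)
  ultimately show "avg I S (\<lambda>h. of_bool (\<forall>d\<in>D. h d \<noteq> v d)) = (1 - 1 / real (card S)) ^ card D"
    unfolding of_bool_Ball[OF D]
    by (subst avg_prod[where B = "\<lambda>d. {d}"]) (use assms D in \<open>auto intro!: depends_onlyI\<close>)
qed

lemma avg_cong:
  assumes "\<And>h. h \<in> PiE I (\<lambda>_. S) \<Longrightarrow> f h = g h"
  shows "avg I S f = avg I S g"
  using assms by (simp add: avg_def)

subsection \<open>Binomial tails\<close>

text \<open>Probability of at most \<open>r\<close> successes in \<open>N\<close> independent
  trials, each of which succeeds with probability \<open>q\<close>.\<close>

definition binomial_tail :: "nat \<Rightarrow> real \<Rightarrow> nat \<Rightarrow> real" where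
  "binomial_tail N q r = (\<Sum>j\<le>r. real (N choose j) * q ^ j * (1 - q) ^ (N - j))"

lemma sum_over_card_le:
  assumes "finite R"
  shows "(\<Sum>J | J \<subseteq> R \<and> card J \<le> r. F (card J)) = (\<Sum>j\<le>r. real (card R choose j) * F j)"
proof -
  have "(\<Sum>J | J \<subseteq> R \<and> card J \<le> r. F (card J))
      = (\<Sum>j\<le>r. \<Sum>J | J \<in> {J. J \<subseteq> R \<and> card J \<le> r} \<and> card J = j. F (card J))"
    by (rule sum.group[symmetric]) (use assms in auto)
  also have "\<dots> = (\<Sum>j\<le>r. real (card R choose j) * F j)"
  proof (rule sum.cong[OF refl])
    fix j assume "j \<in> {..r}"
    then have "{J. J \<in> {J. J \<subseteq> R \<and> card J \<le> r} \<and> card J = j} = {J. J \<subseteq> R \<and> card J = j}" by auto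
    then show "(\<Sum>J | J \<in> {J. J \<subseteq> R \<and> card J \<le> r} \<and> card J = j. F (card J))
        = real (card R choose j) * F j"
      using assms by (simp add: n_subsets)
  qed
  finally show ?thesis .
qed

text \<open>The event is split by the exact set \<open>J\<close> of successes; for each
  \<open>J\<close> the indicator is a product over \<open>R\<close> of functions of disjoint sets of
  coordinates.\<close>

lemma avg_tail:
  fixes P :: "'r \<Rightarrow> ('i \<Rightarrow> 'c) \<Rightarrow> bool"
  assumes "finite I" "finite S" "S \<noteq> {}" and R: "finite R"
    and dep: "\<And>y. y \<in> R \<Longrightarrow> depends_only (B y) (P y)" and "disjoint_family_on B R"
    and q: "\<And>y. y \<in> R \<Longrightarrow> avg I S (\<lambda>h. of_bool (P y h)) = q"
  shows "avg I S (\<lambda>h. of_bool (card {y\<in>R. P y h} \<le> r)) = binomial_tail (card R) q r"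
proof -
  let ?J = "{J. J \<subseteq> R \<and> card J \<le> r}"
  let ?f = "\<lambda>J y h. if y \<in> J then of_bool (P y h) else 1 - of_bool (P y h) :: real"
  have fin: "finite ?J" using R by simp
  have "of_bool (card {y\<in>R. P y h} \<le> r) = (\<Sum>J\<in>?J. \<Prod>y\<in>R. ?f J y h)" for h
  proof -
    have "(\<Prod>y\<in>R. ?f J y h) = of_bool (J = {y\<in>R. P y h})" if "J \<in> ?J" for J
    proof -
      have "(\<Prod>y\<in>R. ?f J y h) = (\<Prod>y\<in>R. of_bool ((y \<in> J) = P y h))"
        by (rule prod.cong) auto
      also have "\<dots> = of_bool (\<forall>y\<in>R. (y \<in> J) = P y h)" using of_bool_Ball[OF R] by metis
      also have "\<dots> = of_bool (J = {y\<in>R. P y h})" using that by (intro arg_cong[of _ _ of_bool]) auto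
      finally show ?thesis .
    qed
    then have "(\<Sum>J\<in>?J. \<Prod>y\<in>R. ?f J y h) = (\<Sum>J\<in>?J. of_bool (J = {y\<in>R. P y h}))"
      by (rule sum.cong[OF refl])
    also have "\<dots> = (\<Sum>J\<in>?J. if J = {y\<in>R. P y h} then 1 else 0)"
      by (rule sum.cong) auto
    also have "\<dots> = of_bool (card {y\<in>R. P y h} \<le> r)" using fin by (subst sum.delta) auto
    finally show ?thesis by simp
  qed
  then have "avg I S (\<lambda>h. of_bool (card {y\<in>R. P y h} \<le> r))
      = avg I S (\<lambda>h. \<Sum>J\<in>?J. \<Prod>y\<in>R. ?f J y h)"
    by (rule avg_cong)
  also have "\<dots> = (\<Sum>J\<in>?J. avg I S (\<lambda>h. \<Prod>y\<in>R. ?f J y h))"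
    by (rule avg_sum)
  also have "\<dots> = (\<Sum>J\<in>?J. q ^ card J * (1 - q) ^ (card R - card J))"
  proof (rule sum.cong[OF refl])
    fix J assume J: "J \<in> ?J"
    have "avg I S (\<lambda>h. \<Prod>y\<in>R. ?f J y h) = (\<Prod>y\<in>R. avg I S (?f J y))"
    proof (rule avg_prod[where B = B])
      fix y assume "y \<in> R"
      show "depends_only (B y) (?f J y)"
        by (rule depends_only_comp[OF dep[OF \<open>y \<in> R\<close>], where F = "\<lambda>b. if y \<in> J then of_bool b else 1 - of_bool b"])
    qed (use assms in auto)
    also have "\<dots> = (\<Prod>y\<in>R. if y \<in> J then q else 1 - q)"
      by (rule prod.cong[OF refl]) (use assms in \<open>auto simp: avg_diff avg_const\<close>)
    also have "\<dots> = (\<Prod>y\<in>J. q) * (\<Prod>y\<in>R - J. 1 - q)"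
      using R J by (subst prod.If_cases) (auto simp: Int_absorb1 Diff_eq)
    finally show "avg I S (\<lambda>h. \<Prod>y\<in>R. ?f J y h) = q ^ card J * (1 - q) ^ (card R - card J)"
      using J R card_Diff_subset[of J R] finite_subset[of J R] by simp
  qed
  also have "\<dots> = binomial_tail (card R) q r"
    using sum_over_card_le[OF R, of "\<lambda>j. q ^ j * (1 - q) ^ (card R - j)" r]
    by (simp add: binomial_tail_def mult.assoc)
  finally show ?thesis .
qed

text \<open>Exponential moment bound: \<open>t ^ r \<le> t ^ j\<close> for \<open>j \<le> r\<close>,
  so weighting the terms by \<open>t ^ j / t ^ r\<close> only increases them, and the completed sum
  is a binomial expansion.\<close>

lemma binomial_tail_le:
  assumes "0 < t" "t \<le> 1" "0 \<le> q" "q \<le> 1"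
  shows "binomial_tail N q r \<le> (1 / t) ^ r * (1 - (1 - t) * q) ^ N"
proof -
  have "binomial_tail N q r \<le> (\<Sum>j\<le>r. (1 / t) ^ r * (real (N choose j) * (t * q) ^ j * (1 - q) ^ (N - j)))"
    unfolding binomial_tail_def
  proof (rule sum_mono)
    fix j assume "j \<in> {..r}"
    then have "t ^ r \<le> t ^ j" using assms by (auto intro: power_decreasing)
    then have "1 \<le> (1 / t) ^ r * t ^ j" using assms by (simp add: power_divide field_simps)
    then have "1 * (real (N choose j) * q ^ j * (1 - q) ^ (N - j))
        \<le> ((1 / t) ^ r * t ^ j) * (real (N choose j) * q ^ j * (1 - q) ^ (N - j))"
      using assms by (intro mult_right_mono) auto
    then show "real (N choose j) * q ^ j * (1 - q) ^ (N - j)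
        \<le> (1 / t) ^ r * (real (N choose j) * (t * q) ^ j * (1 - q) ^ (N - j))"
      by (simp add: power_mult_distrib ac_simps)
  qed
  also have "\<dots> = (1 / t) ^ r * (\<Sum>j\<le>r. real (N choose j) * (t * q) ^ j * (1 - q) ^ (N - j))"
    by (simp add: sum_distrib_left)
  \<comment> \<open>The range is extended to \<open>max r N\<close> because \<open>r\<close> may
    exceed \<open>N\<close>.\<close>
  also have "(\<Sum>j\<le>r. real (N choose j) * (t * q) ^ j * (1 - q) ^ (N - j))
      \<le> (\<Sum>j\<le>max r N. real (N choose j) * (t * q) ^ j * (1 - q) ^ (N - j))"
    by (rule sum_mono2) (use assms in auto)
  also have "\<dots> = (\<Sum>j\<le>N. real (N choose j) * (t * q) ^ j * (1 - q) ^ (N - j))"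
    by (rule sum.mono_neutral_right) auto
  also have "\<dots> = (t * q + (1 - q)) ^ N" by (simp add: binomial_ring)
  also have "t * q + (1 - q) = 1 - (1 - t) * q" by (simp add: algebra_simps)
  finally show ?thesis using assms by (simp add: mult_left_mono)
qed

subsection \<open>Random types\<close>

definition slot :: "nat \<Rightarrow> nat \<Rightarrow> nat \<times> nat" where
  "slot y x = (min y x, max y x)"

lemma slot_eq_iff: "slot a b = slot c d \<longleftrightarrow> a = c \<and> b = d \<or> a = d \<and> b = c"
  unfolding slot_def by (auto simp: min_def max_def split: if_splits)

lemma slot_commute: "slot a b = slot b a"
  by (simp add: slot_eq_iff)

definition cross_slots :: "nat set \<Rightarrow> nat set \<Rightarrow> (nat \<times> nat) set" where
  "cross_slots P Q = {slot y y' | y y'. y \<in> P \<and> y' \<in> Q \<and> y \<noteq> y'}"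

lemma cross_slotsI: "y \<in> P \<Longrightarrow> y' \<in> Q \<Longrightarrow> y \<noteq> y' \<Longrightarrow> slot y y' \<in> cross_slots P Q"
  unfolding cross_slots_def by blast

lemma finite_cross_slots:
  assumes "finite P" "finite Q"
  shows "finite (cross_slots P Q)"
proof (rule finite_subset)
  show "cross_slots P Q \<subseteq> (\<lambda>(y, y'). slot y y') ` (P \<times> Q)" by (auto simp: cross_slots_def)
qed (use assms in auto)

text \<open>The summand 4 is what two disjoint pairs need: they have 4 elements, but only 4 slots
  between them.\<close>

lemma card_cross_slots_pivots:
  assumes "a \<noteq> b" "c \<noteq> d"
  shows "2 * card {a, b, c, d} \<le> card (cross_slots {a, b} {c, d}) + 4"
proof -
  have fin: "finite (cross_slots {a, b} {c, d})" by (simp add: finite_cross_slots)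
  consider "{c, d} = {a, b}" | "c \<in> {a, b}" "d \<notin> {a, b}" | "c \<notin> {a, b}" "d \<in> {a, b}"
    | "c \<notin> {a, b}" "d \<notin> {a, b}"
    using assms by auto
  then show ?thesis
  proof cases
    case 1
    then have "{a, b, c, d} = {a, b}" by auto
    then have "card {a, b, c, d} = 2" using assms by simp
    then show ?thesis by simp
  next
    case 2
    have "{slot a d, slot b d} \<subseteq> cross_slots {a, b} {c, d}" using 2 by (auto intro!: cross_slotsI)
    then have "card {slot a d, slot b d} \<le> card (cross_slots {a, b} {c, d})" by (rule card_mono[OF fin])
    moreover have "{a, b, c, d} = {a, b, d}" using 2 by auto
    ultimately show ?thesis using assms 2 by (simp add: slot_eq_iff)
  next
    case 3
    have "{slot a c, slot b c} \<subseteq> cross_slots {a, b} {c, d}" using 3 by (auto intro!: cross_slotsI)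
    then have "card {slot a c, slot b c} \<le> card (cross_slots {a, b} {c, d})" by (rule card_mono[OF fin])
    moreover have "{a, b, c, d} = {a, b, c}" using 3 by auto
    ultimately show ?thesis using assms 3 by (simp add: slot_eq_iff)
  next
    case 4
    have "{slot a c, slot b c, slot a d, slot b d} \<subseteq> cross_slots {a, b} {c, d}"
      using 4 by (auto intro!: cross_slotsI)
    then have "card {slot a c, slot b c, slot a d, slot b d} \<le> card (cross_slots {a, b} {c, d})"
      by (rule card_mono[OF fin])
    then show ?thesis using assms 4 by (auto simp: slot_eq_iff)
  qed
qed

text \<open>Two pivots are fixed in each set. Every other element has two slots to the pivots on the
  opposite side; these differ for different elements and differ from the slots among the pivots.
  Each further element thus adds one to the union and two to the slots.\<close>

lemma card_cross_slots_ge: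
  assumes "finite P" "finite Q" "2 \<le> card P" "2 \<le> card Q"
  shows "2 * card (P \<union> Q) \<le> card (cross_slots P Q) + 4"
proof -
  obtain P0 where P0: "P0 \<subseteq> P" "card P0 = 2" using assms(3) obtain_subset_with_card_n by metis
  obtain Q0 where Q0: "Q0 \<subseteq> Q" "card Q0 = 2" using assms(4) obtain_subset_with_card_n by metis
  obtain a b where ab: "P0 = {a, b}" "a \<noteq> b" using P0 by (auto simp: card_2_iff)
  obtain c d where cd: "Q0 = {c, d}" "c \<noteq> d" using Q0 by (auto simp: card_2_iff)
  define T where "T = P \<union> Q - (P0 \<union> Q0)"
  define N where "N e = (if e \<in> P then Q0 else P0)" for e
  define E where "E = (\<lambda>(e, n). slot e n) ` Sigma T N"
  have fin: "finite T" "finite P0" "finite Q0" "finite (cross_slots P Q)"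
    using assms P0 Q0 by (auto simp: T_def intro: finite_subset finite_cross_slots)
  have N: "N e \<subseteq> P0 \<union> Q0" "card (N e) = 2" "finite (N e)" for e
    using P0 Q0 fin by (auto simp: N_def)
  have TN: "e \<notin> P0 \<union> Q0" if "e \<in> T" for e using that by (simp add: T_def)
  have inj: "inj_on (\<lambda>(e, n). slot e n) (Sigma T N)"
  proof (rule inj_onI, clarify)
    fix e n e' n' assume "e \<in> T" "n \<in> N e" "e' \<in> T" "n' \<in> N e'" "slot e n = slot e' n'"
    then show "e = e' \<and> n = n'" using TN N(1) unfolding slot_eq_iff by blast
  qed
  have "card E = card (Sigma T N)" unfolding E_def by (rule card_image[OF inj])
  also have "\<dots> = 2 * card T" using fin N by (simp add: card_SigmaI)
  finally have E: "card E = 2 * card T" .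
  have "slot e n \<in> cross_slots P Q" if "e \<in> T" "n \<in> N e" for e n
  proof -
    have ne: "e \<noteq> n" using that TN N(1) by blast
    show ?thesis
    proof (cases "e \<in> P")
      case True
      then show ?thesis using that ne Q0(1) by (intro cross_slotsI) (auto simp: N_def)
    next
      case False
      then have "slot n e \<in> cross_slots P Q"
        using that ne P0(1) by (intro cross_slotsI) (auto simp: N_def T_def)
      then show ?thesis by (simp add: slot_commute)
    qed
  qed
  then have sub: "E \<subseteq> cross_slots P Q" by (auto simp: E_def)
  have sub0: "cross_slots P0 Q0 \<subseteq> cross_slots P Q" using P0 Q0 by (auto simp: cross_slots_def)
  have disj: "E \<inter> cross_slots P0 Q0 = {}"
    using TN by (auto simp: E_def cross_slots_def slot_eq_iff)
  have "card E + card (cross_slots P0 Q0) = card (E \<union> cross_slots P0 Q0)"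
    using disj sub sub0 fin(4) by (intro card_Un_disjoint[symmetric]) (auto intro: finite_subset)
  also have "\<dots> \<le> card (cross_slots P Q)" using sub sub0 fin(4) by (intro card_mono) auto
  finally have 1: "card E + card (cross_slots P0 Q0) \<le> card (cross_slots P Q)" .
  have 2: "2 * card (P0 \<union> Q0) \<le> card (cross_slots P0 Q0) + 4"
    using card_cross_slots_pivots[OF ab(2) cd(2)] ab(1) cd(1) by (simp add: insert_commute)
  have "P \<union> Q = T \<union> (P0 \<union> Q0)" "T \<inter> (P0 \<union> Q0) = {}" using P0 Q0 by (auto simp: T_def)
  then have "card (P \<union> Q) = card T + card (P0 \<union> Q0)" using fin by (simp add: card_Un_disjoint)
  with 1 2 E show ?thesis by linarith
qed

text \<open>The vertices of the target are pairs of a base \<open>x\<close> and a sign \<open>s\<close>; the sign 1, which complements the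
  types, is used for \<open>p = 2\<close> only, and then \<open>(x, 0)\<close> and \<open>(x, 1)\<close> are antitwins.\<close>

definition act :: "nat \<Rightarrow> nat \<Rightarrow> nat" where
  "act s c = (if s = 0 then c else 1 - c)"

section \<open>Probability that a base realises prescribed types\<close>

locale random_types =
  fixes p M :: nat and rv :: "nat \<Rightarrow> nat"
  assumes p: "2 \<le> p" and rv: "c < p \<Longrightarrow> rv c < p" "c < p \<Longrightarrow> rv (rv c) = c"
begin

text \<open>Only the types of the pairs of bases \<open>y < x\<close> are chosen; \<open>val y x c\<close> is the choice that gives \<open>y\<close> the
  type \<open>c\<close> towards \<open>x\<close>.\<close>

definition slots :: "(nat \<times> nat) set" where
  "slots = {(a, b). a < b \<and> b < M}"

abbreviation mean :: "((nat \<times> nat \<Rightarrow> nat) \<Rightarrow> real) \<Rightarrow> real" where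
  "mean \<equiv> avg slots {..<p}"

definition val :: "nat \<Rightarrow> nat \<Rightarrow> nat \<Rightarrow> nat" where
  "val y x c = (if y < x then c else rv c)"

definition exact :: "nat \<Rightarrow> nat set \<Rightarrow> (nat \<Rightarrow> nat) \<Rightarrow> (nat \<times> nat \<Rightarrow> nat) \<Rightarrow> bool" where
  "exact y X c h \<longleftrightarrow> (\<forall>x\<in>X. h (slot y x) = val y x (c x))"

text \<open>Since \<open>act s\<close> is an involution on the types, the vertex
  \<open>(y, s)\<close> has the types \<open>c\<close> exactly if the base \<open>y\<close> has the
  types \<open>act s (c x)\<close>.\<close>

definition matches :: "nat set \<Rightarrow> nat \<Rightarrow> nat set \<Rightarrow> (nat \<Rightarrow> nat) \<Rightarrow> (nat \<times> nat \<Rightarrow> nat) \<Rightarrow> bool" where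
  "matches Sg y X c h \<longleftrightarrow> (\<exists>s\<in>Sg. exact y X (\<lambda>x. act s (c x)) h)"

lemma finite_slots: "finite slots"
  by (rule finite_subset[of _ "{..<M} \<times> {..<M}"]) (auto simp: slots_def)

lemma slot_in_slots: "y < M \<Longrightarrow> x < M \<Longrightarrow> y \<noteq> x \<Longrightarrow> slot y x \<in> slots"
  by (auto simp: slots_def slot_def)

lemma p_fin: "finite {..<p}" "{..<p} \<noteq> {}" using p by (auto simp: lessThan_empty_iff)

lemma val_less: "c < p \<Longrightarrow> val y x c < p"
  using rv by (simp add: val_def)

lemma val_inj: "c < p \<Longrightarrow> c' < p \<Longrightarrow> val y x c = val y x c' \<longleftrightarrow> c = c'"
  using rv by (metis val_def)

lemma act_less: "s = 0 \<or> p = 2 \<Longrightarrow> c < p \<Longrightarrow> act s c < p"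
  by (auto simp: act_def)

lemma depends_exact: "depends_only (slot y ` X) (exact y X c)"
  by (rule depends_onlyI) (auto simp: exact_def)

lemma depends_matches: "depends_only (slot y ` X) (matches Sg y X c)"
  unfolding matches_def
  by (rule depends_onlyI) (metis (no_types, lifting) depends_onlyD[OF depends_exact])

lemma disjoint_stars:
  assumes "R \<inter> Z = {}"
  shows "disjoint_family_on (\<lambda>y. slot y ` Z) R"
  using assms by (auto simp: disjoint_family_on_def slot_eq_iff)

lemma mean_exact:
  assumes "y < M" "X \<subseteq> {..<M}" "y \<notin> X" "\<And>x. x \<in> X \<Longrightarrow> c x < p"
  shows "mean (\<lambda>h. of_bool (exact y X c h)) = (1 / real p) ^ card X"
proof -
  have inj: "inj_on (slot y) X" by (auto simp: inj_on_def slot_eq_iff)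
  define v where "v d = (let x = the_inv_into X (slot y) d in val y x (c x))" for d
  have v: "v (slot y x) = val y x (c x)" if "x \<in> X" for x
    using that inj by (simp add: v_def the_inv_into_f_f)
  have "exact y X c h \<longleftrightarrow> (\<forall>d\<in>slot y ` X. h d = v d)" for h
    by (simp add: exact_def v)
  then have "mean (\<lambda>h. of_bool (exact y X c h)) = mean (\<lambda>h. of_bool (\<forall>d\<in>slot y ` X. h d = v d))"
    by simp
  also have "\<dots> = (1 / real (card {..<p})) ^ card (slot y ` X)"
  proof (rule avg_pattern(1)[OF finite_slots p_fin])
    show "slot y ` X \<subseteq> slots"
      using assms by (intro image_subsetI slot_in_slots) auto
    show "v d \<in> {..<p}" if "d \<in> slot y ` X" for d
      using that assms v val_less by auto
  qed
  finally show ?thesis by (simp add: card_image[OF inj])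
qed

lemma exact_unique:
  assumes "exact y X c h" "exact y X c' h" "x \<in> X" "c x < p" "c' x < p"
  shows "c x = c' x"
  using assms val_inj unfolding exact_def by metis

text \<open>The signs are \<open>{0}\<close> also for \<open>p = 2\<close> if the type towards the apex is prescribed, since this fixes the sign.\<close>

definition signs :: "nat set \<Rightarrow> bool" where
  "signs Sg \<longleftrightarrow> Sg = {0} \<or> p = 2 \<and> Sg = {0, 1}"

text \<open>The two signs demand different types at any \<open>x\<close> in \<open>X\<close>, so at
  most one of them succeeds; a nonempty \<open>X\<close> is needed for this.\<close>

lemma of_bool_matches:
  assumes "signs Sg" "X \<noteq> {}" "\<And>x. x \<in> X \<Longrightarrow> c x < p"
  shows "(of_bool (matches Sg y X c h) :: real) = (\<Sum>s\<in>Sg. of_bool (exact y X (\<lambda>x. act s (c x)) h))"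
proof (cases "Sg = {0}")
  case False
  then have 2: "p = 2" "Sg = {0, 1}" using assms(1) by (auto simp: signs_def)
  obtain x where x: "x \<in> X" using assms(2) by auto
  have "\<not> (exact y X (\<lambda>x. act 0 (c x)) h \<and> exact y X (\<lambda>x. act 1 (c x)) h)"
  proof
    assume "exact y X (\<lambda>x. act 0 (c x)) h \<and> exact y X (\<lambda>x. act 1 (c x)) h"
    then have "act 0 (c x) = act 1 (c x)"
      using x assms(3)[OF x] 2
      by (intro exact_unique[of y X "\<lambda>x. act 0 (c x)" h "\<lambda>x. act 1 (c x)"]) (simp_all add: act_def)
    then show False by (simp add: act_def) presburger
  qed
  then show ?thesis using 2 by (auto simp: matches_def)
qed (simp add: matches_def)

lemma mean_matches:
  assumes "signs Sg" "X \<noteq> {}" "X \<subseteq> {..<M}" "y < M" "y \<notin> X" "\<And>x. x \<in> X \<Longrightarrow> c x < p"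
  shows "mean (\<lambda>h. of_bool (matches Sg y X c h)) = real (card Sg) * (1 / real p) ^ card X"
proof -
  have "mean (\<lambda>h. of_bool (matches Sg y X c h))
      = (\<Sum>s\<in>Sg. mean (\<lambda>h. of_bool (exact y X (\<lambda>x. act s (c x)) h)))"
    using of_bool_matches[OF assms(1,2,6)] by (simp add: avg_sum)
  also have "\<dots> = (\<Sum>s\<in>Sg. (1 / real p) ^ card X)"
  proof (rule sum.cong[OF refl], rule mean_exact)
    fix s x assume "s \<in> Sg" "x \<in> X"
    then have "s = 0 \<or> p = 2" using assms(1) unfolding signs_def by blast
    then show "act s (c x) < p" using assms(6)[OF \<open>x \<in> X\<close>] by (rule act_less)
  qed (use assms in auto)
  finally show ?thesis by simp
qed

lemma mean_few_matches:
  assumes "signs Sg" "X \<noteq> {}" "X \<subseteq> {..<M}" "R \<subseteq> {..<M} - X" "\<And>x. x \<in> X \<Longrightarrow> c x < p"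
  shows "mean (\<lambda>h. of_bool (card {y\<in>R. matches Sg y X c h} \<le> r))
    = binomial_tail (card R) (real (card Sg) * (1 / real p) ^ card X) r"
proof (rule avg_tail[OF finite_slots p_fin])
  show "finite R" using assms(4) by (rule finite_subset) auto
  show "disjoint_family_on (\<lambda>y. slot y ` X) R" using assms(4) by (intro disjoint_stars) auto
  show "depends_only (slot y ` X) (matches Sg y X c)" for y by (rule depends_matches)
  show "mean (\<lambda>h. of_bool (matches Sg y X c h)) = real (card Sg) * (1 / real p) ^ card X"
    if "y \<in> R" for y
    using that assms by (intro mean_matches) auto
qed

text \<open>Each sign yields at most one pattern on \<open>X \<union> X'\<close>. If the sets share
  a base, the two signs demand different types there and at most one agrees with \<open>c'\<close>,
  which removes the factor \<open>card Sg\<close>.\<close>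

lemma mean_both_le:
  assumes "signs Sg" "X \<noteq> {}" "X \<subseteq> {..<M}" "X' \<subseteq> {..<M}" "y < M" "y \<notin> X \<union> X'"
    and c: "\<And>x. x \<in> X \<Longrightarrow> c x < p" "\<And>x. x \<in> X' \<Longrightarrow> c' x < p"
  shows "mean (\<lambda>h. of_bool (matches Sg y X c h \<and> exact y X' c' h))
      \<le> real (if X \<inter> X' = {} then card Sg else 1) * (1 / real p) ^ card (X \<union> X')"
proof -
  let ?q = "(1 / real p) ^ card (X \<union> X')"
  have sg: "s = 0 \<or> p = 2" if "s \<in> Sg" for s using that assms(1) unfolding signs_def by blast
  have one: "mean (\<lambda>h. of_bool (exact y X (\<lambda>x. act s (c x)) h \<and> exact y X' c' h)) \<le> ?q"
    if that': "s \<in> Sg" for s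
  proof -
    define d where "d x = (if x \<in> X then act s (c x) else c' x)" for x
    have "mean (\<lambda>h. of_bool (exact y X (\<lambda>x. act s (c x)) h \<and> exact y X' c' h))
        \<le> mean (\<lambda>h. of_bool (exact y (X \<union> X') d h))"
    proof (rule avg_mono)
      fix h
      have "exact y (X \<union> X') d h" if "exact y X (\<lambda>x. act s (c x)) h" "exact y X' c' h"
        using that unfolding exact_def d_def by (metis UnE)
      then show "of_bool (exact y X (\<lambda>x. act s (c x)) h \<and> exact y X' c' h)
          \<le> (of_bool (exact y (X \<union> X') d h) :: real)" by simp
    qed
    also have "\<dots> = ?q"
    proof (rule mean_exact)
      show "d x < p" if "x \<in> X \<union> X'" for x
      proof (cases "x \<in> X")
        case True
        then show ?thesis using sg[OF that'] c(1) act_less by (simp add: d_def)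
      next
        case False
        then show ?thesis using that c(2) by (simp add: d_def)
      qed
    qed (use assms in auto)
    finally show ?thesis .
  qed
  have zero: "\<not> (exact y X (\<lambda>x. act s (c x)) h \<and> exact y X' c' h)"
    if "s \<in> Sg" "x \<in> X \<inter> X'" "act s (c x) \<noteq> c' x" for s x h
  proof
    assume e: "exact y X (\<lambda>x. act s (c x)) h \<and> exact y X' c' h"
    have "act s (c x) < p" using that c(1) sg act_less by simp
    moreover have "val y x (act s (c x)) = val y x (c' x)"
      using e that(2) unfolding exact_def by (metis IntD1 IntD2)
    ultimately show False using val_inj c(2)[of x] that by auto
  qed
  have eq: "mean (\<lambda>h. of_bool (matches Sg y X c h \<and> exact y X' c' h))
      = (\<Sum>s\<in>Sg. mean (\<lambda>h. of_bool (exact y X (\<lambda>x. act s (c x)) h \<and> exact y X' c' h)))"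
    using of_bool_matches[OF assms(1,2) c(1)]
    by (simp add: of_bool_conj sum_distrib_right flip: avg_sum)
  show ?thesis
  proof (cases "X \<inter> X' = {}")
    case True
    then show ?thesis unfolding eq using sum_mono[OF one] by simp
  next
    case False
    then obtain x where x: "x \<in> X \<inter> X'" by auto
    show ?thesis
    proof (cases "Sg = {0}")
      case True
      then show ?thesis unfolding eq using one[of 0] False by simp
    next
      case False
      then have 2: "p = 2" "Sg = {0, 1}" using assms(1) by (auto simp: signs_def)
      have "1 - c' x \<noteq> c' x" by presburger
      then have "act 0 (c x) \<noteq> c' x \<or> act 1 (c x) \<noteq> c' x" unfolding act_def by force
      then obtain s where s: "s \<in> Sg" "act s (c x) \<noteq> c' x" using 2(2) by blast
      have "mean (\<lambda>h. of_bool (exact y X (\<lambda>x. act s (c x)) h \<and> exact y X' c' h)) = mean (\<lambda>h. 0)"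
        by (rule avg_cong) (use zero[OF s(1) x s(2)] in simp)
      then have "mean (\<lambda>h. of_bool (exact y X (\<lambda>x. act s (c x)) h \<and> exact y X' c' h)) = 0"
        by (simp add: avg_const[OF finite_slots p_fin])
      moreover have "s = 0 \<or> s = 1" using s(1) 2(2) by blast
      moreover have "(0::nat) \<in> Sg" "(1::nat) \<in> Sg" using 2(2) by blast+
      then have "mean (\<lambda>h. of_bool (exact y X (\<lambda>x. act 0 (c x)) h \<and> exact y X' c' h)) \<le> ?q"
        "mean (\<lambda>h. of_bool (exact y X (\<lambda>x. act 1 (c x)) h \<and> exact y X' c' h)) \<le> ?q"
        using one by blast+
      ultimately have "(\<Sum>s\<in>{0, 1}. mean (\<lambda>h. of_bool (exact y X (\<lambda>x. act s (c x)) h \<and> exact y X' c' h))) \<le> ?q"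
        by (elim disjE) simp_all
      then show ?thesis using eq 2(2) \<open>X \<inter> X' \<noteq> {}\<close> by simp
    qed
  qed
qed

text \<open>Two realisations on either side are part of the event because the count of slots needs
  them; having fewer is treated as a separate bad event.\<close>

definition unjoined where
  "unjoined Sg X c X' c' c0 R h \<longleftrightarrow>
     2 \<le> card {y\<in>R. matches Sg y X c h} \<and> 2 \<le> card {y\<in>R. exact y X' c' h} \<and>
     (\<forall>y\<in>R. \<forall>s\<in>Sg. \<forall>y'\<in>R. exact y X (\<lambda>x. act s (c x)) h \<longrightarrow> exact y' X' c' h \<longrightarrow> y \<noteq> y' \<longrightarrow>
        h (slot y' y) \<noteq> val y' y (act s c0))"

text \<open>The information that is conditioned on. It reads only slots between \<open>R\<close> and
  \<open>X \<union> X'\<close>, so the slots inside \<open>R\<close> stay independent of it when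
  \<open>R\<close> avoids these sets.\<close>

definition state where
  "state Sg X c X' c' R h =
     ({(y, s). y \<in> R \<and> s \<in> Sg \<and> exact y X (\<lambda>x. act s (c x)) h}, {y\<in>R. exact y X' c' h})"

lemma depends_state:
  "depends_only (\<Union>y\<in>R. slot y ` (X \<union> X')) (state Sg X c X' c' R)"
proof (rule depends_onlyI)
  fix h h' :: "nat \<times> nat \<Rightarrow> nat"
  assume eq: "\<And>i. i \<in> (\<Union>y\<in>R. slot y ` (X \<union> X')) \<Longrightarrow> h i = h' i"
  have "h (slot y x) = h' (slot y x)" if "y \<in> R" "x \<in> X \<union> X'" for y x
    by (rule eq) (use that in blast)
  then have "exact y X d h = exact y X d h'" "exact y X' d h = exact y X' d h'" if "y \<in> R" for y d
    using that by (auto simp: exact_def)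
  then show "state Sg X c X' c' R h = state Sg X c X' c' R h'"
    unfolding state_def by (intro arg_cong2[of _ _ _ _ Pair] Collect_cong) auto
qed

text \<open>Two sets with union of size \<open>u\<close>, both with at least two elements, are joined by at least
  \<open>2 * u - 4\<close> pairs, each of which has the wrong type with probability \<open>1/2\<close>.
  The factor \<open>(1/4) ^ u\<close> is a product over the independent bases.\<close>

lemma mean_unjoined_le:
  assumes p2: "p = 2" and sg: "signs Sg" and X: "X \<subseteq> {..<M}" "X' \<subseteq> {..<M}" and c0: "c0 < p"
    and R: "R = {..<M} - (X \<union> X')"
    and \<pi>: "\<And>y. y \<in> R \<Longrightarrow> \<pi> \<le> mean (\<lambda>h. of_bool (matches Sg y X c h \<or> exact y X' c' h))"
  shows "mean (\<lambda>h. of_bool (unjoined Sg X c X' c' c0 R h)) \<le> 16 * (1 - 3 / 4 * \<pi>) ^ card R"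
proof -
  define st where "st = state Sg X c X' c' R"
  define bad where "bad = unjoined Sg X c X' c' c0 R"
  define idx where "idx = Pow (R \<times> Sg) \<times> Pow R"
  have finR: "finite R" and finSg: "finite Sg" using R sg by (auto simp: signs_def)
  have fin: "finite idx" using finR finSg by (simp add: idx_def)
  have st_idx: "st h \<in> idx" for h by (auto simp: st_def state_def idx_def)
  have delta: "(\<Sum>u\<in>idx. of_bool (st h = u) * F u) = (F (st h) :: real)" for h F
  proof -
    have "(\<Sum>u\<in>idx. of_bool (st h = u) * F u) = (\<Sum>u\<in>idx. if u = st h then F u else 0)"
      by (rule sum.cong) auto
    then show ?thesis using fin st_idx by simp
  qed
  \<comment> \<open>The factor 16 is \<open>2 ^ 4\<close>, the price of the summand 4 in
    \<open>card_cross_slots_ge\<close>; two slots for each element of the union give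
    \<open>1 / 4\<close>.\<close>
  define w where "w u = 16 * (1 / 4 :: real) ^ card (fst ` fst u \<union> snd u)"
    for u :: "(nat \<times> nat) set \<times> nat set"
  have key: "mean (\<lambda>h. of_bool (st h = u) * of_bool (bad h)) \<le> mean (\<lambda>h. of_bool (st h = u) * w u)"
    if "u \<in> idx" for u
  proof -
    obtain U W where u: "u = (U, W)" by (cases u)
    have UW: "U \<subseteq> R \<times> Sg" "W \<subseteq> R" using that by (auto simp: idx_def u)
    have dom: "{y\<in>R. matches Sg y X c h} = fst ` U" "{y\<in>R. exact y X' c' h} = W"
      if "st h = u" for h
      using that unfolding st_def state_def u matches_def by force+
    show ?thesis
    proof (cases "2 \<le> card (fst ` U) \<and> 2 \<le> card W")
      case False
      then have "of_bool (st h = u) * of_bool (bad h) = (0 :: real)" for h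
        using dom[of h] unfolding bad_def unjoined_def by auto
      then show ?thesis by (intro avg_mono) (simp add: w_def)
    next
      case True
      define D where "D = cross_slots (fst ` U) W"
      have "\<exists>y s y'. (y, s) \<in> U \<and> y' \<in> W \<and> y \<noteq> y' \<and> d = slot y' y" if "d \<in> D" for d
        using that unfolding D_def cross_slots_def by (force simp: slot_commute)
      \<comment> \<open>One slot can arise from several pairs of realisations. One of them is
        selected, and for an upper bound a single forbidden value at each slot is enough.\<close>
      then obtain Y S Y' where Y: "(Y d, S d) \<in> U" "Y' d \<in> W" "Y d \<noteq> Y' d" "d = slot (Y' d) (Y d)"
        if "d \<in> D" for d
        by metis
      define v where "v d = val (Y' d) (Y d) (act (S d) c0)" for d
      have inR: "Y d \<in> R" "S d \<in> Sg" "Y' d \<in> R" if "d \<in> D" for d using Y[OF that] UW by auto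
      have avoid: "\<forall>d\<in>D. h d \<noteq> v d" if "st h = u" "bad h" for h
      proof
        fix d assume d: "d \<in> D"
        have "exact (Y d) X (\<lambda>x. act (S d) (c x)) h" "exact (Y' d) X' c' h"
          using that(1) Y[OF d] unfolding st_def state_def u by auto
        then have "h (slot (Y' d) (Y d)) \<noteq> val (Y' d) (Y d) (act (S d) c0)"
          using that(2) inR[OF d] Y(3)[OF d] unfolding bad_def unjoined_def by blast
        then show "h d \<noteq> v d" using Y(4)[OF d] by (simp add: v_def)
      qed
      have "mean (\<lambda>h. of_bool (st h = u) * of_bool (bad h))
          \<le> mean (\<lambda>h. of_bool (st h = u) * of_bool (\<forall>d\<in>D. h d \<noteq> v d))"
        by (rule avg_mono) (use avoid in auto)
      also have "\<dots> = mean (\<lambda>h. of_bool (st h = u)) * mean (\<lambda>h. of_bool (\<forall>d\<in>D. h d \<noteq> v d))"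
      proof (rule avg_mult[OF finite_slots p_fin])
        show "depends_only (\<Union>y\<in>R. slot y ` (X \<union> X')) (\<lambda>h. of_bool (st h = u))"
          unfolding st_def by (rule depends_only_comp[OF depends_state])
        show "depends_only D (\<lambda>h. of_bool (\<forall>d\<in>D. h d \<noteq> v d))"
          by (rule depends_onlyI) simp
        show "(\<Union>y\<in>R. slot y ` (X \<union> X')) \<inter> D = {}"
        proof -
          have "slot y x \<noteq> d" if "d \<in> D" "x \<in> X \<union> X'" for y x d
          proof -
            have "Y d \<noteq> x" "Y' d \<noteq> x" using inR[OF that(1)] that(2) R by auto
            then show ?thesis using Y(4)[OF that(1)] slot_eq_iff by metis
          qed
          then show ?thesis by blast
        qed
      qed
      also have "\<dots> \<le> mean (\<lambda>h. of_bool (st h = u)) * w u"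
      proof (rule mult_left_mono)
      have "mean (\<lambda>h. of_bool (\<forall>d\<in>D. h d \<noteq> v d)) = (1 - 1 / real (card {..<p})) ^ card D"
      proof (rule avg_pattern(2)[OF finite_slots p_fin])
        show "D \<subseteq> slots"
        proof
          fix d assume d: "d \<in> D"
          have "slot (Y' d) (Y d) \<in> slots"
            using inR[OF d] Y(3)[OF d] R by (intro slot_in_slots) auto
          then show "d \<in> slots" using Y(4)[OF d] by simp
        qed
        show "v d \<in> {..<p}" if "d \<in> D" for d
          using c0 p2 act_less val_less by (simp add: v_def)
      qed
      also have "\<dots> = (1 / 2) ^ card D" using p2 by simp
      also have "\<dots> \<le> w u"
      proof -
        have "2 * card (fst ` U \<union> W) \<le> card D + 4"
          unfolding D_def using True by (intro card_cross_slots_ge) (auto intro: card_ge_0_finite)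
        then have "(1 / 2 :: real) ^ (card D + 4) \<le> (1 / 2) ^ (2 * card (fst ` U \<union> W))"
          by (intro power_decreasing) auto
        moreover have "(1 / 2 :: real) ^ (card D + 4) = (1 / 2) ^ card D / 16"
          by (simp add: power_add power4_eq_xxxx)
        moreover have "(1 / 2 :: real) ^ (2 * n) = (1 / 4) ^ n" for n
          by (simp add: power_mult power2_eq_square)
        ultimately show ?thesis by (simp add: w_def u)
      qed
      finally show "mean (\<lambda>h. of_bool (\<forall>d\<in>D. h d \<noteq> v d)) \<le> w u" .
      qed (simp add: avg_def sum_nonneg)
      also have "mean (\<lambda>h. of_bool (st h = u)) * w u = mean (\<lambda>h. of_bool (st h = u) * w u)"
        by (simp add: avg_cmult mult.commute)
      finally show ?thesis .
    qed
  qed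
  have "mean (\<lambda>h. of_bool (bad h)) = mean (\<lambda>h. \<Sum>u\<in>idx. of_bool (st h = u) * of_bool (bad h))"
    using delta[of _ "\<lambda>_. of_bool (bad _)"] by (intro avg_cong) simp
  also have "\<dots> = (\<Sum>u\<in>idx. mean (\<lambda>h. of_bool (st h = u) * of_bool (bad h)))" by (rule avg_sum)
  also have "\<dots> \<le> (\<Sum>u\<in>idx. mean (\<lambda>h. of_bool (st h = u) * w u))" by (rule sum_mono[OF key])
  also have "\<dots> = mean (\<lambda>h. \<Sum>u\<in>idx. of_bool (st h = u) * w u)" by (rule avg_sum[symmetric])
  also have "\<dots> = mean (\<lambda>h. w (st h))" by (simp only: delta)
  \<comment> \<open>The size of the union is an exponent, so the weight factors over the bases, with
    \<open>1 - 3 / 4 = 1 / 4\<close> at each base that belongs to the union.\<close>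
  also have "\<dots> = mean (\<lambda>h. 16 * (\<Prod>y\<in>R. 1 - 3 / 4 * of_bool (matches Sg y X c h \<or> exact y X' c' h)))"
  proof (rule avg_cong)
    fix h
    have "fst ` fst (st h) \<union> snd (st h) = {y\<in>R. matches Sg y X c h \<or> exact y X' c' h}"
      unfolding st_def state_def matches_def by force
    moreover have "(1 / 4 :: real) ^ card {y\<in>R. Q y} = (\<Prod>y\<in>R. 1 - 3 / 4 * of_bool (Q y))" for Q
    proof -
      have "(\<Prod>y\<in>R. 1 - 3 / 4 * of_bool (Q y)) = (\<Prod>y\<in>R. if Q y then 1 / 4 else 1 :: real)"
        by (rule prod.cong) auto
      also have "\<dots> = (1 / 4) ^ card {y\<in>R. Q y}"
        using finR by (simp add: prod.If_cases Int_def)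
      finally show ?thesis by simp
    qed
    ultimately show "w (st h)
        = 16 * (\<Prod>y\<in>R. 1 - 3 / 4 * of_bool (matches Sg y X c h \<or> exact y X' c' h))"
      by (simp only: w_def)
  qed
  also have "\<dots> = 16 * mean (\<lambda>h. \<Prod>y\<in>R. 1 - 3 / 4 * of_bool (matches Sg y X c h \<or> exact y X' c' h))"
    by (rule avg_cmult)
  also have "mean (\<lambda>h. \<Prod>y\<in>R. 1 - 3 / 4 * of_bool (matches Sg y X c h \<or> exact y X' c' h))
      = (\<Prod>y\<in>R. mean (\<lambda>h. 1 - 3 / 4 * of_bool (matches Sg y X c h \<or> exact y X' c' h)))"
  proof (rule avg_prod[OF finite_slots p_fin finR])
    show "disjoint_family_on (\<lambda>y. slot y ` (X \<union> X')) R" using R by (intro disjoint_stars) auto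
    show "depends_only (slot y ` (X \<union> X'))
        (\<lambda>h. 1 - 3 / 4 * of_bool (matches Sg y X c h \<or> exact y X' c' h) :: real)" for y
    proof (rule depends_onlyI)
      fix h h' :: "nat \<times> nat \<Rightarrow> nat"
      assume eq: "\<And>i. i \<in> slot y ` (X \<union> X') \<Longrightarrow> h i = h' i"
      have "matches Sg y X c h = matches Sg y X c h'"
        by (rule depends_onlyD[OF depends_matches]) (use eq in auto)
      moreover have "exact y X' c' h = exact y X' c' h'"
        by (rule depends_onlyD[OF depends_exact]) (use eq in auto)
      ultimately show "1 - 3 / 4 * of_bool (matches Sg y X c h \<or> exact y X' c' h)
          = (1 - 3 / 4 * of_bool (matches Sg y X c h' \<or> exact y X' c' h') :: real)" by simp
    qed
  qed
  also have "16 * \<dots> \<le> 16 * (\<Prod>y\<in>R. 1 - 3 / 4 * \<pi>)"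
  proof (rule mult_left_mono, rule prod_mono)
    fix y assume "y \<in> R"
    let ?e = "mean (\<lambda>h. of_bool (matches Sg y X c h \<or> exact y X' c' h))"
    have e: "mean (\<lambda>h. 1 - 3 / 4 * of_bool (matches Sg y X c h \<or> exact y X' c' h)) = 1 - 3 / 4 * ?e"
      by (simp only: avg_diff avg_cmult avg_const[OF finite_slots p_fin])
    have "?e \<le> mean (\<lambda>h. 1)" by (rule avg_mono) simp
    then have "?e \<le> 1" by (simp add: avg_const[OF finite_slots p_fin])
    then show "0 \<le> mean (\<lambda>h. 1 - 3 / 4 * of_bool (matches Sg y X c h \<or> exact y X' c' h)) \<and>
        mean (\<lambda>h. 1 - 3 / 4 * of_bool (matches Sg y X c h \<or> exact y X' c' h)) \<le> 1 - 3 / 4 * \<pi>"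
      unfolding e using \<pi>[OF \<open>y \<in> R\<close>] by simp
  qed simp
  finally show ?thesis by (simp add: bad_def)
qed

end

subsection \<open>Targets\<close>

text \<open>A literal \<open>(x, c)\<close> prescribes the type \<open>c\<close> towards the base \<open>x\<close>. The base \<open>M\<close> is the apex.\<close>

definition lits :: "nat \<Rightarrow> nat \<Rightarrow> (nat \<times> nat) set \<Rightarrow> bool" where
  "lits M p K \<longleftrightarrow> K \<subseteq> {..M} \<times> {..<p} \<and> inj_on fst K"

definition matching :: "nat \<Rightarrow> nat \<Rightarrow> (nat \<Rightarrow> nat \<Rightarrow> nat) \<Rightarrow> (nat \<times> nat) set \<Rightarrow> (nat \<times> nat) set" where
  "matching M g \<tau> K = {(y, s). y < M \<and> s < g \<and> (\<forall>(x, c)\<in>K. y \<noteq> x \<and> act s (\<tau> y x) = c)}"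

definition conn :: "(nat \<Rightarrow> nat \<Rightarrow> nat) \<Rightarrow> nat \<times> nat \<Rightarrow> nat \<times> nat \<Rightarrow> nat" where
  "conn \<tau> a b = act (snd a) (act (snd b) (\<tau> (fst a) (fst b)))"

text \<open>What the colouring uses of the random graph. \<open>many\<close> speaks of exactly
  \<open>k\<close> literals, since smaller sets inherit stronger counts from it.
  \<open>joined\<close> asks for an apex literal on one side only: one end of the last edge of a
  regular component is a neighbour of the vertex sent to the apex.\<close>

locale target =
  fixes k p g M :: nat and rv :: "nat \<Rightarrow> nat" and \<tau> :: "nat \<Rightarrow> nat \<Rightarrow> nat"
  assumes k: "4 \<le> k" and k_le_M: "k \<le> M" and p2: "2 \<le> p" and g: "g = 1 \<or> g = 2 \<and> p = 2"
    and rv_less: "c < p \<Longrightarrow> rv c < p" and rv_rv: "c < p \<Longrightarrow> rv (rv c) = c"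
    and \<tau>_less: "\<lbrakk>x \<le> M; y \<le> M; x \<noteq> y\<rbrakk> \<Longrightarrow> \<tau> x y < p"
    and \<tau>_rev: "\<lbrakk>x \<le> M; y \<le> M; x \<noteq> y\<rbrakk> \<Longrightarrow> \<tau> y x = rv (\<tau> x y)"
    and many: "\<lbrakk>lits M p K; card K = k\<rbrakk> \<Longrightarrow> k \<le> card (matching M g \<tau> K)"
    and joined: "\<lbrakk>lits M p K; lits M p K'; card K = k; card K' = k; M \<in> fst ` K'; c < p\<rbrakk>
      \<Longrightarrow> \<exists>a\<in>matching M g \<tau> K. \<exists>b\<in>matching M g \<tau> K'. fst a \<noteq> fst b \<and> conn \<tau> b a = c"

definition lits_of :: "nat set \<Rightarrow> (nat \<Rightarrow> nat) \<Rightarrow> (nat \<times> nat) set" where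
  "lits_of X c = (\<lambda>x. (x, c x)) ` X"

text \<open>The apex literal is split off because the type towards the apex is not random.\<close>

lemma litsE:
  assumes "lits M p K" "card K = k" "0 < k"
  obtains (plain) X c where "K = lits_of X c" "X \<subseteq> {..<M}" "card X = k" "c \<in> PiE X (\<lambda>_. {..<p})"
    | (apex) X c d where "K = insert (M, d) (lits_of X c)" "X \<subseteq> {..<M}" "card X = k - 1"
        "c \<in> PiE X (\<lambda>_. {..<p})" "d < p"
proof -
  define f where "f x = (SOME c. (x, c) \<in> K)" for x
  have inj: "inj_on fst K" and sub: "K \<subseteq> {..M} \<times> {..<p}" using assms by (auto simp: lits_def)
  have fin: "finite K" using sub by (rule finite_subset) auto
  have fK: "f x = c" if "(x, c) \<in> K" for x c
    unfolding f_def
  proof (rule some_equality)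
    show "c' = c" if "(x, c') \<in> K" for c'
      using inj_onD[OF inj, of "(x, c')" "(x, c)"] that \<open>(x, c) \<in> K\<close> by simp
  qed (rule that)
  have K: "K = (\<lambda>x. (x, f x)) ` (fst ` K)" using fK by force
  have fp: "f x < p" if "x \<in> fst ` K" for x using that fK sub by auto
  have card: "card (fst ` K) = k" using card_image[OF inj] assms by simp
  define X where "X = fst ` K - {M}"
  define c where "c = restrict f X"
  have Xsub: "X \<subseteq> {..<M}"
  proof
    fix x assume "x \<in> X"
    then have "x \<le> M" "x \<noteq> M" using sub by (auto simp: X_def)
    then show "x \<in> {..<M}" by simp
  qed
  have c: "c \<in> PiE X (\<lambda>_. {..<p})" using fp by (auto simp: c_def X_def)
  have lits: "lits_of X c = (\<lambda>x. (x, f x)) ` X" by (auto simp: lits_of_def c_def)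
  show thesis
  proof (cases "M \<in> fst ` K")
    case False
    then have "X = fst ` K" by (auto simp: X_def)
    then show thesis using plain[of X c] K lits Xsub c card by simp
  next
    case True
    then have "fst ` K = insert M X" by (auto simp: X_def)
    then have "K = insert (M, f M) (lits_of X c)" using K lits by simp
    moreover have "card X = k - 1" using True card fin by (simp add: X_def)
    ultimately show thesis using apex[of "f M" X c] Xsub c fp[OF True] by simp
  qed
qed

context random_types
begin

text \<open>\<open>\<zeta>\<close> prescribes the types of the bases towards the apex: constantly 0
  for antitwins, where the sign then decides the type, and the residue modulo \<open>p\<close>
  otherwise.\<close>

definition type_of :: "(nat \<Rightarrow> nat) \<Rightarrow> (nat \<times> nat \<Rightarrow> nat) \<Rightarrow> nat \<Rightarrow> nat \<Rightarrow> nat" where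
  "type_of \<zeta> h y x =
     (if y < M \<and> x < M then (if y < x then h (y, x) else rv (h (x, y)))
      else if y < M then \<zeta> y else rv (\<zeta> x))"

lemma type_of_less:
  assumes "h \<in> PiE slots (\<lambda>_. {..<p})" "\<And>y. \<zeta> y < p" "x \<le> M" "y \<le> M" "x \<noteq> y"
  shows "type_of \<zeta> h x y < p"
proof -
  have "h (a, b) < p" if "a < b" "b < M" for a b
    using assms(1) that by (auto simp: slots_def)
  then show ?thesis using assms rv(1) by (auto simp: type_of_def)
qed

lemma type_of_rev:
  assumes "h \<in> PiE slots (\<lambda>_. {..<p})" "\<And>y. \<zeta> y < p" "x \<le> M" "y \<le> M" "x \<noteq> y"
  shows "type_of \<zeta> h y x = rv (type_of \<zeta> h x y)"
proof -
  have "h (a, b) < p" if "a < b" "b < M" for a b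
    using assms(1) that by (auto simp: slots_def)
  then show ?thesis using assms rv(2) by (auto simp: type_of_def)
qed

lemma type_of_iff:
  assumes "h \<in> PiE slots (\<lambda>_. {..<p})" "x < M" "y < M" "x \<noteq> y" "c < p"
  shows "type_of \<zeta> h y x = c \<longleftrightarrow> h (slot y x) = val y x c"
proof -
  have "h (a, b) < p" if "a < b" "b < M" for a b
    using assms(1) that by (auto simp: slots_def)
  then show ?thesis
    using assms rv by (cases "y < x") (auto simp: type_of_def slot_def val_def min_def max_def)
qed

lemma act_eq_iff:
  assumes "s = 0 \<or> p = 2" "c < p" "d < p"
  shows "act s c = d \<longleftrightarrow> c = act s d"
  using assms by (auto simp: act_def)

lemma act_act: "s = 0 \<or> p = 2 \<Longrightarrow> c < p \<Longrightarrow> act s (act s c) = c"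
  by (auto simp: act_def)

lemma matching_plain:
  assumes h: "h \<in> PiE slots (\<lambda>_. {..<p})" "\<And>y. \<zeta> y < p" and g: "g = 1 \<or> p = 2"
    and X: "X \<subseteq> {..<M}" "c \<in> PiE X (\<lambda>_. {..<p})"
  shows "matching M g (type_of \<zeta> h) (lits_of X c)
    = {(y, s). y \<in> {..<M} - X \<and> s < g \<and> exact y X (\<lambda>x. act s (c x)) h}"
proof -
  have "act s (type_of \<zeta> h y x) = c x \<longleftrightarrow> h (slot y x) = val y x (act s (c x))"
    if "y < M" "s < g" "x \<in> X" "y \<noteq> x" for y s x
  proof -
    have s: "s = 0 \<or> p = 2" using g that(2) by auto
    have x: "x < M" "c x < p" using X that(3) by auto
    have "act s (type_of \<zeta> h y x) = c x \<longleftrightarrow> type_of \<zeta> h y x = act s (c x)"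
      using type_of_less[OF h, of y x] that x by (intro act_eq_iff[OF s]) auto
    also have "\<dots> \<longleftrightarrow> h (slot y x) = val y x (act s (c x))"
      using x that act_less[OF s] by (intro type_of_iff[OF h(1)]) auto
    finally show ?thesis .
  qed
  then show ?thesis unfolding matching_def lits_of_def exact_def by auto
qed

lemma matching_apex:
  assumes h: "h \<in> PiE slots (\<lambda>_. {..<p})" "\<And>y. \<zeta> y < p" and g: "g = 1 \<or> p = 2"
    and X: "X \<subseteq> {..<M}" "c \<in> PiE X (\<lambda>_. {..<p})"
  shows "matching M g (type_of \<zeta> h) (insert (M, d) (lits_of X c))
    = {(y, s). y \<in> {..<M} - X \<and> s < g \<and> act s (\<zeta> y) = d \<and> exact y X (\<lambda>x. act s (c x)) h}"
proof -
  have "matching M g (type_of \<zeta> h) (insert (M, d) (lits_of X c))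
      = {(y, s). act s (type_of \<zeta> h y M) = d} \<inter> matching M g (type_of \<zeta> h) (lits_of X c)"
    by (auto simp: matching_def)
  then show ?thesis unfolding matching_plain[OF assms] by (auto simp: type_of_def)
qed

section \<open>Configurations of bases with prescribed types and the union bound over them\<close>

definition configs :: "nat \<Rightarrow> (nat set \<times> (nat \<Rightarrow> nat)) set" where
  "configs j = (SIGMA X:{X. X \<subseteq> {..<M} \<and> card X = j}. PiE X (\<lambda>_. {..<p}))"

lemma configsD:
  assumes "(X, c) \<in> configs j"
  shows "X \<subseteq> {..<M}" "card X = j" "c \<in> PiE X (\<lambda>_. {..<p})" "finite X"
    "\<And>x. x \<in> X \<Longrightarrow> c x < p"
  using assms finite_subset[of X "{..<M}"] by (auto simp: configs_def PiE_iff)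

lemma finite_configs: "finite (configs j)"
  unfolding configs_def
  by (intro finite_SigmaI) (auto intro!: finite_PiE intro: finite_subset[of _ "{..<M}"])

lemma sum_configs:
  "(\<Sum>(X, c)\<in>configs j. F X) = (\<Sum>X | X \<subseteq> {..<M} \<and> card X = j. real p ^ j * F X)"
proof -
  have "(\<Sum>(X, c)\<in>configs j. F X)
      = (\<Sum>X | X \<subseteq> {..<M} \<and> card X = j. \<Sum>c\<in>PiE X (\<lambda>_. {..<p}). F X)"
    unfolding configs_def
    by (rule sum.Sigma[symmetric])
      (auto intro!: finite_PiE intro: finite_subset[of _ "{..<M}"])
  also have "\<dots> = (\<Sum>X | X \<subseteq> {..<M} \<and> card X = j. real p ^ j * F X)"
    by (rule sum.cong[OF refl]) (auto simp: card_PiE finite_subset[of _ "{..<M}"])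
  finally show ?thesis .
qed

lemma card_configs: "real (card (configs j)) = real (M choose j) * real p ^ j"
proof -
  have "real (card (configs j)) = (\<Sum>(X, c)\<in>configs j. 1)" by simp
  also have "\<dots> = (\<Sum>X | X \<subseteq> {..<M} \<and> card X = j. real p ^ j * 1)" by (rule sum_configs)
  finally show ?thesis by (simp add: n_subsets)
qed

lemma mean_Bex_le:
  assumes "finite A"
  shows "mean (\<lambda>h. of_bool (\<exists>a\<in>A. P a h)) \<le> (\<Sum>a\<in>A. mean (\<lambda>h. of_bool (P a h)))"
proof -
  have "(of_bool (\<exists>a\<in>A. P a h) :: real) \<le> (\<Sum>a\<in>A. of_bool (P a h))" for h
  proof (cases "\<exists>a\<in>A. P a h")
    case True
    then obtain a where a: "a \<in> A" "P a h" by auto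
    have "of_bool (P a h) \<le> (\<Sum>a\<in>A. of_bool (P a h) :: real)"
      by (rule member_le_sum) (use a assms in auto)
    then show ?thesis using a True by simp
  qed (simp add: sum_nonneg)
  then have "mean (\<lambda>h. of_bool (\<exists>a\<in>A. P a h)) \<le> mean (\<lambda>h. \<Sum>a\<in>A. of_bool (P a h))"
    by (intro avg_mono)
  then show ?thesis by (simp add: avg_sum)
qed

lemma mean_disj_le:
  "mean (\<lambda>h. of_bool (P h \<or> Q h)) \<le> mean (\<lambda>h. of_bool (P h)) + mean (\<lambda>h. of_bool (Q h))"
  unfolding avg_add[symmetric] by (rule avg_mono) auto

lemma mean_configs_le:
  assumes "\<And>X c. (X, c) \<in> configs j \<Longrightarrow> mean (\<lambda>h. of_bool (P X c h)) \<le> b"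
  shows "mean (\<lambda>h. of_bool (\<exists>(X, c)\<in>configs j. P X c h)) \<le> real (M choose j) * real p ^ j * b"
proof -
  have "mean (\<lambda>h. of_bool (\<exists>(X, c)\<in>configs j. P X c h))
      \<le> (\<Sum>a\<in>configs j. mean (\<lambda>h. of_bool (case a of (X, c) \<Rightarrow> P X c h)))"
    by (rule mean_Bex_le[OF finite_configs])
  also have "\<dots> \<le> (\<Sum>a\<in>configs j. b)" by (rule sum_mono) (use assms in auto)
  finally show ?thesis by (simp add: card_configs)
qed

lemma mean_disj:
  "mean (\<lambda>h. of_bool (P h \<or> Q h))
    = mean (\<lambda>h. of_bool (P h)) + mean (\<lambda>h. of_bool (Q h)) - mean (\<lambda>h. of_bool (P h \<and> Q h))"
  unfolding avg_add[symmetric] avg_diff[symmetric] by (rule avg_cong) auto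

lemma exact_eq_matches: "exact y X c h \<longleftrightarrow> matches {0} y X c h"
  by (simp add: matches_def act_def)

text \<open>Inclusion and exclusion, with both single probabilities equal to \<open>q\<close>: two
  signs make up for the additional literal in \<open>X\<close>. \<open>\<theta>\<close> bounds the
  joint probability divided by \<open>q\<close>. It halves with each new base in the union and is
  not refined below \<open>1 / 4\<close>.\<close>

lemma mean_unjoined_config_le:
  assumes p2: "p = 2" and k: "4 \<le> k" and sg: "signs Sg" and j: "j + 1 = k + card Sg - 1"
    and X: "(X, c) \<in> configs j" and X': "(X', c') \<in> configs (k - 1)" and c0: "c0 < 2"
    and R: "R = {..<M} - (X \<union> X')"
  defines "q \<equiv> (1 / 2 :: real) ^ (k - 1)"
  defines "\<theta> \<equiv> if card (X \<union> X') \<le> k - 1 then 1 else if card (X \<union> X') = k then 1 / 2 else 1 / 4"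
  shows "mean (\<lambda>h. of_bool (unjoined Sg X c X' c' c0 R h))
    \<le> 16 * (1 - 3 / 4 * ((2 - \<theta>) * q)) ^ (M - (2 * k - 1))"
proof -
  have sgc: "card Sg = 1 \<or> card Sg = 2" using sg by (auto simp: signs_def)
  have j': "j = k - 1 \<and> card Sg = 1 \<or> j = k \<and> card Sg = 2" using j sgc k by auto
  note D = configsD[OF X] and D' = configsD[OF X']
  have ne: "X \<noteq> {}" using D(2) j' k by auto
  let ?u = "card (X \<union> X')"
  have u: "?u \<le> j + (k - 1)" using card_Un_le[of X X'] D(2) D'(2) by simp
  have q: "real (card Sg) * (1 / 2) ^ j = q"
  proof (cases "card Sg = 1")
    case False
    then have "j = Suc (k - 1)" "card Sg = 2" using j' k by auto
    then show ?thesis by (simp add: q_def)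
  qed (use j' in \<open>auto simp: q_def\<close>)
  have q8: "0 \<le> q" "q \<le> 1 / 8"
  proof -
    have "q \<le> (1 / 2) ^ 3" unfolding q_def using k by (intro power_decreasing) auto
    then show "q \<le> 1 / 8" by (simp add: power3_eq_cube)
  qed (simp add: q_def)
  have uk: "k - 1 \<le> ?u"
    using card_mono[of "X \<union> X'" X'] D D' by simp
  have half: "(1 / 2 :: real) ^ k = q / 2"
  proof -
    have "k = Suc (k - 1)" using k by simp
    then show ?thesis unfolding q_def by (metis power_Suc times_divide_eq_left mult_1 mult.commute)
  qed
  have both: "real (if X \<inter> X' = {} then card Sg else 1) * (1 / 2) ^ ?u \<le> \<theta> * q"
  proof (cases "?u \<le> k")
    case True
    have "X \<inter> X' \<noteq> {}"
    proof
      assume "X \<inter> X' = {}"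
      then have "?u = j + (k - 1)" using D D' by (simp add: card_Un_disjoint)
      then show False using True j' k by auto
    qed
    moreover have "(1 / 2) ^ ?u \<le> \<theta> * q"
    proof (cases "?u = k")
      case True
      then show ?thesis using half k by (auto simp: \<theta>_def)
    next
      case False
      then have "?u = k - 1" using True uk by simp
      then show ?thesis by (simp add: \<theta>_def q_def)
    qed
    ultimately show ?thesis by simp
  next
    case False
    then have \<theta>: "\<theta> = 1 / 4" by (simp add: \<theta>_def)
    show ?thesis
    proof (cases "X \<inter> X' = {} \<and> card Sg = 2")
      case True
      then have "?u = j + (k - 1)" using D D' by (simp add: card_Un_disjoint)
      \<comment> \<open>Both signs contribute for disjoint sets only, and there the union is so
        large that even the doubled probability is at most \<open>q / 4\<close>.\<close>
      then have "k + 2 \<le> ?u" using True j' k by auto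
      then have "(1 / 2 :: real) ^ ?u \<le> (1 / 2) ^ (k + 2)" by (intro power_decreasing) auto
      then have "(1 / 2 :: real) ^ ?u \<le> q / 8" using half by (simp add: power_add power2_eq_square)
      then show ?thesis unfolding \<theta> using True q8 by simp
    next
      case F: False
      have "(1 / 2 :: real) ^ ?u \<le> (1 / 2) ^ (k + 1)" using False by (intro power_decreasing) auto
      then have "(1 / 2 :: real) ^ ?u \<le> q / 4" using half by (simp add: power_add)
      moreover have "real (if X \<inter> X' = {} then card Sg else 1) = 1" using F sgc by auto
      ultimately show ?thesis unfolding \<theta> by simp
    qed
  qed
  let ?b = "1 - 3 / 4 * ((2 - \<theta>) * q)"
  have \<theta>1: "0 \<le> \<theta>" "\<theta> \<le> 1" by (auto simp: \<theta>_def)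
  have "(2 - \<theta>) * q \<le> 2 * (1 / 8)" using \<theta>1 q8 by (intro mult_mono) auto
  moreover have "0 \<le> (2 - \<theta>) * q" using \<theta>1 q8 by simp
  ultimately have b: "0 \<le> ?b" "?b \<le> 1" by auto
  have "mean (\<lambda>h. of_bool (unjoined Sg X c X' c' c0 R h)) \<le> 16 * ?b ^ card R"
  proof (rule mean_unjoined_le[OF p2 sg D(1) D'(1) _ R])
    fix y assume y: "y \<in> R"
    have "mean (\<lambda>h. of_bool (matches Sg y X c h)) = q"
      using mean_matches[OF sg ne D(1), of y c] D y R p2 q by auto
    moreover have "mean (\<lambda>h. of_bool (exact y X' c' h)) = q"
      using mean_exact[of y X' c'] D' y R p2 by (auto simp: q_def)
    moreover have "mean (\<lambda>h. of_bool (matches Sg y X c h \<and> exact y X' c' h)) \<le> \<theta> * q"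
      using mean_both_le[OF sg ne D(1) D'(1), of y c c'] D D' y R p2 both by auto
    ultimately show "(2 - \<theta>) * q \<le> mean (\<lambda>h. of_bool (matches Sg y X c h \<or> exact y X' c' h))"
      unfolding mean_disj by (simp add: algebra_simps)
  qed (use c0 p2 in simp)
  also have "\<dots> \<le> 16 * ?b ^ (M - (2 * k - 1))"
  proof (intro mult_left_mono power_decreasing b)
    have "card R = M - ?u" unfolding R using D D' by (subst card_Diff_subset) auto
    then show "M - (2 * k - 1) \<le> card R" using u j' k by auto
  qed simp
  finally show ?thesis .
qed

end

section \<open>Counting sets with a large overlap\<close>

lemma card_subsets_near:
  assumes "finite X" "card X = Suc j" "finite Y"
  shows "card {X'. X' \<subseteq> Y \<and> card X' = j \<and> card (X \<union> X') = Suc j} \<le> Suc j"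
proof -
  have "{X'. X' \<subseteq> Y \<and> card X' = j \<and> card (X \<union> X') = Suc j} \<subseteq> {X'. X' \<subseteq> X \<and> card X' = j}"
  proof
    fix X' assume "X' \<in> {X'. X' \<subseteq> Y \<and> card X' = j \<and> card (X \<union> X') = Suc j}"
    then have a: "X' \<subseteq> Y" "card X' = j" "card (X \<union> X') = Suc j" by auto
    have "X = X \<union> X'"
      using a assms finite_subset[of X' Y] by (intro card_subset_eq) auto
    then show "X' \<in> {X'. X' \<subseteq> X \<and> card X' = j}" using a by blast
  qed
  then have "card {X'. X' \<subseteq> Y \<and> card X' = j \<and> card (X \<union> X') = Suc j} \<le> card {X'. X' \<subseteq> X \<and> card X' = j}"
    by (intro card_mono) (use assms in auto)
  also have "\<dots> = Suc j" using assms by (simp add: n_subsets binomial_Suc_n)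
  finally show ?thesis .
qed

text \<open>If the union has only one additional element, \<open>X'\<close> arises from
  \<open>X\<close> by exchanging one element.\<close>

lemma card_swaps_near:
  assumes "finite X" "card X = j" "X \<subseteq> Y" "finite Y"
  shows "card {X'. X' \<subseteq> Y \<and> card X' = j \<and> card (X \<union> X') = Suc j} \<le> j * card Y"
proof -
  have "{X'. X' \<subseteq> Y \<and> card X' = j \<and> card (X \<union> X') = Suc j}
      \<subseteq> (\<lambda>(x, y). insert y (X - {x})) ` (X \<times> Y)"
  proof
    fix X' assume "X' \<in> {X'. X' \<subseteq> Y \<and> card X' = j \<and> card (X \<union> X') = Suc j}"
    then have a: "X' \<subseteq> Y" "card X' = j" "card (X \<union> X') = Suc j" by auto
    have fin: "finite X'" using a assms finite_subset by blast
    have "card (X \<union> X') = card X + card (X' - X)" "card (X \<union> X') = card X' + card (X - X')"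
      using fin assms card_Un_disjoint[of X "X' - X"] card_Un_disjoint[of X' "X - X'"]
      by (auto simp: Un_commute)
    then have "card (X' - X) = 1" "card (X - X') = 1" using a assms by auto
    then obtain x y where xy: "X' - X = {y}" "X - X' = {x}" by (auto simp: card_1_singleton_iff)
    then have "X' = insert y (X - {x})" "x \<in> X" "y \<in> Y" using a by auto
    then show "X' \<in> (\<lambda>(x, y). insert y (X - {x})) ` (X \<times> Y)" by force
  qed
  then have "card {X'. X' \<subseteq> Y \<and> card X' = j \<and> card (X \<union> X') = Suc j}
      \<le> card ((\<lambda>(x, y). insert y (X - {x})) ` (X \<times> Y))"
    by (rule card_mono[rotated]) (use assms in auto)
  also have "\<dots> \<le> card (X \<times> Y)" by (rule card_image_le) (use assms in auto)
  finally show ?thesis using assms by (simp add: card_cartesian_product)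
qed

section \<open>The antitwin target for \<open>p = 2\<close>\<close>

context random_types
begin

text \<open>The weight with \<open>t = 21/16, 9/8, 3/4\<close> bounds the probability of not being joined according to
  whether the two sets of bases have a union of size at least \<open>k + 1\<close>, equal to \<open>k\<close>, or equal
  to \<open>k - 1\<close>: the larger their overlap, the stronger the correlation.\<close>

definition weight :: "nat \<Rightarrow> real \<Rightarrow> real" where
  "weight k t = (1 - t * (1 / 2) ^ (k - 1)) ^ (M - (2 * k - 1))"

text \<open>Strong correlation is affordable because it is rare: unions of size \<open>k\<close> or
  \<open>k - 1\<close> have weaker bounds, but for each \<open>X\<close> only \<open>n2\<close> and
  \<open>n1\<close> sets \<open>X'\<close> lead to them. The factor 32 is 16 times the two values of
  \<open>c0\<close>.\<close>

lemma mean_some_unjoined_le: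
  assumes p2: "p = 2" and k: "4 \<le> k" and sg: "signs Sg" and j: "j + 1 = k + card Sg - 1"
    and n1: "\<And>X. X \<subseteq> {..<M} \<Longrightarrow> card X = j \<Longrightarrow>
      card {X'. X' \<subseteq> {..<M} \<and> card X' = k - 1 \<and> card (X \<union> X') = k - 1} \<le> n1"
    and n2: "\<And>X. X \<subseteq> {..<M} \<Longrightarrow> card X = j \<Longrightarrow>
      card {X'. X' \<subseteq> {..<M} \<and> card X' = k - 1 \<and> card (X \<union> X') = k} \<le> n2"
  shows "mean (\<lambda>h. of_bool (\<exists>(X, c)\<in>configs j. \<exists>(X', c')\<in>configs (k - 1). \<exists>c0\<in>{..<2}.
      unjoined Sg X c X' c' c0 ({..<M} - (X \<union> X')) h))
    \<le> 32 * (real (M choose j) * 2 ^ j * 2 ^ (k - 1) *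
        (real (M choose (k - 1)) * weight k (21 / 16) + real n2 * weight k (9 / 8) + real n1 * weight k (3 / 4)))"
    (is "?lhs \<le> _")
proof -
  have rp: "real p = 2" using p2 by simp
  define w where "w u = (if u \<le> k - 1 then weight k (3 / 4)
    else if u = k then weight k (9 / 8) else weight k (21 / 16))" for u
  have wn: "0 \<le> weight k t" if "t \<le> 2" "0 \<le> t" for t
  proof -
    have "(1 / 2 :: real) ^ (k - 1) \<le> (1 / 2) ^ 3" using k by (intro power_decreasing) auto
    then have "t * (1 / 2 :: real) ^ (k - 1) \<le> 2 * (1 / 8)"
      using that by (intro mult_mono) (auto simp: power3_eq_cube)
    then show ?thesis by (simp add: weight_def)
  qed
  have wnn: "0 \<le> weight k (21 / 16)" "0 \<le> weight k (9 / 8)" "0 \<le> weight k (3 / 4)" by (auto intro: wn)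
  define bd where "bd = real (M choose (k - 1)) * weight k (21 / 16) + real n2 * weight k (9 / 8) + real n1 * weight k (3 / 4)"
  have one: "mean (\<lambda>h. of_bool (\<exists>c0\<in>{..<2}. unjoined Sg X c X' c' c0 ({..<M} - (X \<union> X')) h))
      \<le> 32 * w (card (X \<union> X'))"
    if "(X, c) \<in> configs j" "(X', c') \<in> configs (k - 1)" for X c X' c'
  proof -
    \<comment> \<open>The rates in the weights are \<open>3 / 4 * (2 - \<theta>)\<close> for
      \<open>\<theta> = 1, 1 / 2, 1 / 4\<close>.\<close>
    have e: "3 / 4 * ((2 - 1) * q) = 3 / 4 * q" "3 / 4 * ((2 - 1 / 2) * q) = 9 / 8 * q"
      "3 / 4 * ((2 - 1 / 4) * q) = 21 / 16 * q" for q :: real by auto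
    have "mean (\<lambda>h. of_bool (\<exists>c0\<in>{..<2}. unjoined Sg X c X' c' c0 ({..<M} - (X \<union> X')) h))
      \<le> (\<Sum>c0\<in>{..<2}. mean (\<lambda>h. of_bool (unjoined Sg X c X' c' c0 ({..<M} - (X \<union> X')) h)))"
      by (rule mean_Bex_le) simp
    also have "\<dots> \<le> (\<Sum>c0\<in>{..<2::nat}. 16 * w (card (X \<union> X')))"
    proof (rule sum_mono)
      fix c0 :: nat assume "c0 \<in> {..<2}"
      then have "c0 < 2" by simp
      from mean_unjoined_config_le[OF p2 k sg j that this refl]
      show "mean (\<lambda>h. of_bool (unjoined Sg X c X' c' c0 ({..<M} - (X \<union> X')) h)) \<le> 16 * w (card (X \<union> X'))"
        unfolding w_def weight_def by (simp only: e split: if_splits) simp_all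
    qed
    finally show ?thesis by simp
  qed
  have two: "(\<Sum>(X', c')\<in>configs (k - 1). 32 * w (card (X \<union> X'))) \<le> 2 ^ (k - 1) * (32 * bd)"
    if X: "X \<subseteq> {..<M}" "card X = j" for X
  proof -
    let ?S = "{X'. X' \<subseteq> {..<M} \<and> card X' = k - 1}"
    have finS: "finite ?S" by simp
    \<comment> \<open>The main weight is charged to every \<open>X'\<close>, the exceptional sizes
      included, so that its total is a plain binomial coefficient.\<close>
    have "w (card (X \<union> X')) \<le> weight k (21 / 16)
        + of_bool (card (X \<union> X') = k) * weight k (9 / 8)
        + of_bool (card (X \<union> X') = k - 1) * weight k (3 / 4)" if "X' \<in> ?S" for X'
    proof -
      have "k - 1 \<le> card (X \<union> X')"
        using that X card_mono[of "X \<union> X'" X'] finite_subset[of _ "{..<M}"] by auto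
      then show ?thesis using wnn by (auto simp: w_def)
    qed
    then have "(\<Sum>X'\<in>?S. w (card (X \<union> X'))) \<le> (\<Sum>X'\<in>?S. weight k (21 / 16)
        + of_bool (card (X \<union> X') = k) * weight k (9 / 8)
        + of_bool (card (X \<union> X') = k - 1) * weight k (3 / 4))"
      by (rule sum_mono)
    also have "\<dots> = real (card ?S) * weight k (21 / 16)
        + real (card {X'\<in>?S. card (X \<union> X') = k}) * weight k (9 / 8)
        + real (card {X'\<in>?S. card (X \<union> X') = k - 1}) * weight k (3 / 4)"
      using finS by (simp add: sum.distrib sum_of_bool_eq Int_def flip: sum_distrib_right)
    also have "\<dots> \<le> bd"
      unfolding bd_def
    proof (intro add_mono mult_right_mono wnn)
      show "real (card {X'\<in>?S. card (X \<union> X') = k}) \<le> real n2"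
        using n2[OF X] by (simp add: conj_ac)
      show "real (card {X'\<in>?S. card (X \<union> X') = k - 1}) \<le> real n1"
        using n1[OF X] by (simp add: conj_ac)
      show "real (card ?S) \<le> real (M choose (k - 1))" by (simp add: n_subsets)
    qed
    finally have "(\<Sum>X'\<in>?S. w (card (X \<union> X'))) \<le> bd" .
    moreover have "(\<Sum>(X', c')\<in>configs (k - 1). 32 * w (card (X \<union> X')))
        = 2 ^ (k - 1) * (32 * (\<Sum>X'\<in>?S. w (card (X \<union> X'))))"
      by (subst sum_configs) (simp add: rp sum_distrib_left)
    ultimately show ?thesis by simp
  qed
  have "?lhs \<le> real (M choose j) * real p ^ j * (2 ^ (k - 1) * (32 * bd))"
  proof (rule mean_configs_le)
    fix X c assume X: "(X, c) \<in> configs j"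
    have "mean (\<lambda>h. of_bool (\<exists>(X', c')\<in>configs (k - 1). \<exists>c0\<in>{..<2}.
          unjoined Sg X c X' c' c0 ({..<M} - (X \<union> X')) h))
        \<le> (\<Sum>a\<in>configs (k - 1). mean (\<lambda>h. of_bool (case a of (X', c') \<Rightarrow> \<exists>c0\<in>{..<2}.
          unjoined Sg X c X' c' c0 ({..<M} - (X \<union> X')) h)))"
      by (rule mean_Bex_le[OF finite_configs])
    also have "\<dots> \<le> (\<Sum>(X', c')\<in>configs (k - 1). 32 * w (card (X \<union> X')))"
      by (rule sum_mono) (use one[OF X] in auto)
    also have "\<dots> \<le> 2 ^ (k - 1) * (32 * bd)" using two[OF configsD(1,2)[OF X]] .
    finally show "mean (\<lambda>h. of_bool (\<exists>(X', c')\<in>configs (k - 1). \<exists>c0\<in>{..<2}.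
          unjoined Sg X c X' c' c0 ({..<M} - (X \<union> X')) h)) \<le> 2 ^ (k - 1) * (32 * bd)" .
  qed
  then show ?thesis unfolding rp bd_def[symmetric] by (simp only: mult_ac)
qed

text \<open>A union bound over four events: too few realisations of \<open>k\<close> types with
  either sign, too few of \<open>k - 1\<close> types with a fixed sign, and an unjoined pair whose
  first member is without or with an apex literal.\<close>

definition antitwin_bound :: "nat \<Rightarrow> real" where
  "antitwin_bound k =
     real (M choose k) * 2 ^ k * binomial_tail (M - k) ((1 / 2) ^ (k - 1)) k
   + real (M choose (k - 1)) * 2 ^ (k - 1) * binomial_tail (M - (k - 1)) ((1 / 2) ^ (k - 1)) (k + 1)
   + 32 * (real (M choose k) * 2 ^ k * 2 ^ (k - 1) *
        (real (M choose (k - 1)) * weight k (21 / 16) + real k * weight k (9 / 8)))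
   + 32 * (real (M choose (k - 1)) * 2 ^ (k - 1) * 2 ^ (k - 1) *
        (real (M choose (k - 1)) * weight k (21 / 16) + real ((k - 1) * M) * weight k (9 / 8) + weight k (3 / 4)))"

text \<open>The thresholds leave room for discarding the bases of the other configuration:
  \<open>k + 1\<close> realisations lose at most \<open>k - 1\<close>, and \<open>k + 2\<close> lose
  at most \<open>k\<close>, so that two remain on either side.\<close>

lemma antitwin_typesE:
  assumes p2: "p = 2" and k: "4 \<le> k" and b: "antitwin_bound k < 1"
  obtains h where "h \<in> PiE slots (\<lambda>_. {..<p})"
    and "\<And>X c. (X, c) \<in> configs k \<Longrightarrow> k + 1 \<le> card {y\<in>{..<M} - X. matches {0, 1} y X c h}"
    and "\<And>X c. (X, c) \<in> configs (k - 1) \<Longrightarrow> k + 2 \<le> card {y\<in>{..<M} - X. exact y X c h}"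
    and "\<And>X c X' c' c0. \<lbrakk>(X, c) \<in> configs k; (X', c') \<in> configs (k - 1); c0 < 2\<rbrakk> \<Longrightarrow>
      \<not> unjoined {0, 1} X c X' c' c0 ({..<M} - (X \<union> X')) h"
    and "\<And>X c X' c' c0. \<lbrakk>(X, c) \<in> configs (k - 1); (X', c') \<in> configs (k - 1); c0 < 2\<rbrakk> \<Longrightarrow>
      \<not> unjoined {0} X c X' c' c0 ({..<M} - (X \<union> X')) h"
proof -
  define B1 where "B1 h \<longleftrightarrow> (\<exists>(X, c)\<in>configs k. card {y\<in>{..<M} - X. matches {0, 1} y X c h} \<le> k)" for h
  define B2 where "B2 h \<longleftrightarrow> (\<exists>(X, c)\<in>configs (k - 1). card {y\<in>{..<M} - X. matches {0} y X c h} \<le> k + 1)" for h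
  define B3 where "B3 h \<longleftrightarrow> (\<exists>(X, c)\<in>configs k. \<exists>(X', c')\<in>configs (k - 1). \<exists>c0\<in>{..<2}.
      unjoined {0, 1} X c X' c' c0 ({..<M} - (X \<union> X')) h)" for h
  define B4 where "B4 h \<longleftrightarrow> (\<exists>(X, c)\<in>configs (k - 1). \<exists>(X', c')\<in>configs (k - 1). \<exists>c0\<in>{..<2}.
      unjoined {0} X c X' c' c0 ({..<M} - (X \<union> X')) h)" for h
  have s: "signs {0, 1}" "signs {0}" unfolding signs_def using p2 by blast+
  have rp: "real p = 2" using p2 by simp
  have half: "2 * (1 / 2 :: real) ^ k = (1 / 2) ^ (k - 1)"
    using k by (cases k) auto
  have 1: "mean (\<lambda>h. of_bool (B1 h))
      \<le> real (M choose k) * 2 ^ k * binomial_tail (M - k) ((1 / 2) ^ (k - 1)) k"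
  proof -
    have "mean (\<lambda>h. of_bool (B1 h)) \<le> real (M choose k) * real p ^ k * binomial_tail (M - k) ((1 / 2) ^ (k - 1)) k"
      unfolding B1_def
    proof (rule mean_configs_le)
      fix X c assume X: "(X, c) \<in> configs k"
      note D = configsD[OF X]
      have "card ({..<M} - X) = M - k" using D by (simp add: card_Diff_subset)
      moreover have "X \<noteq> {}" using D k by auto
      ultimately show "mean (\<lambda>h. of_bool (card {y\<in>{..<M} - X. matches {0, 1} y X c h} \<le> k))
          \<le> binomial_tail (M - k) ((1 / 2) ^ (k - 1)) k"
        using mean_few_matches[OF s(1) _ D(1) _ D(5), where R = "{..<M} - X" and r = k] D(2) half rp by simp
    qed
    then show ?thesis by (simp add: rp)
  qed
  have 2: "mean (\<lambda>h. of_bool (B2 h))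
      \<le> real (M choose (k - 1)) * 2 ^ (k - 1) * binomial_tail (M - (k - 1)) ((1 / 2) ^ (k - 1)) (k + 1)"
  proof -
    have "mean (\<lambda>h. of_bool (B2 h)) \<le> real (M choose (k - 1)) * real p ^ (k - 1)
        * binomial_tail (M - (k - 1)) ((1 / 2) ^ (k - 1)) (k + 1)"
      unfolding B2_def
    proof (rule mean_configs_le)
      fix X c assume X: "(X, c) \<in> configs (k - 1)"
      note D = configsD[OF X]
      have "card ({..<M} - X) = M - (k - 1)" using D by (simp add: card_Diff_subset)
      moreover have "X \<noteq> {}" using D k by auto
      ultimately show "mean (\<lambda>h. of_bool (card {y\<in>{..<M} - X. matches {0} y X c h} \<le> k + 1))
          \<le> binomial_tail (M - (k - 1)) ((1 / 2) ^ (k - 1)) (k + 1)"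
        using mean_few_matches[OF s(2) _ D(1) _ D(5), where R = "{..<M} - X" and r = "k + 1"] D(2) rp by simp
    qed
    then show ?thesis by (simp add: rp)
  qed
  have 3: "mean (\<lambda>h. of_bool (B3 h)) \<le> 32 * (real (M choose k) * 2 ^ k * 2 ^ (k - 1) *
        (real (M choose (k - 1)) * weight k (21 / 16) + real k * weight k (9 / 8) + real 0 * weight k (3 / 4)))"
    unfolding B3_def
  proof (rule mean_some_unjoined_le[OF p2 k s(1)])
    fix X assume X: "X \<subseteq> {..<M}" "card X = k"
    have fin: "finite X" using X finite_subset by blast
    have "card (X \<union> X') \<noteq> k - 1" if "X' \<subseteq> {..<M}" for X'
    proof -
      have "finite X'" using that finite_subset by blast
      then have "card X \<le> card (X \<union> X')" using fin by (intro card_mono) simp_all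
      then show ?thesis using X(2) k by linarith
    qed
    then have "{X'. X' \<subseteq> {..<M} \<and> card X' = k - 1 \<and> card (X \<union> X') = k - 1} = {}" by blast
    then show "card {X'. X' \<subseteq> {..<M} \<and> card X' = k - 1 \<and> card (X \<union> X') = k - 1} \<le> 0" by simp
    show "card {X'. X' \<subseteq> {..<M} \<and> card X' = k - 1 \<and> card (X \<union> X') = k} \<le> k"
      using card_subsets_near[OF fin, of "k - 1" "{..<M}"] X k by simp
  qed (use k in simp)
  have 4: "mean (\<lambda>h. of_bool (B4 h)) \<le> 32 * (real (M choose (k - 1)) * 2 ^ (k - 1) * 2 ^ (k - 1) *
        (real (M choose (k - 1)) * weight k (21 / 16) + real ((k - 1) * M) * weight k (9 / 8) + real 1 * weight k (3 / 4)))"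
    unfolding B4_def
  proof (rule mean_some_unjoined_le[OF p2 k s(2)])
    fix X assume X: "X \<subseteq> {..<M}" "card X = k - 1"
    have fin: "finite X" using X finite_subset by blast
    have "X' = X" if "X' \<subseteq> {..<M}" "card X' = k - 1" "card (X \<union> X') = k - 1" for X'
    proof -
      have "finite X'" using that finite_subset by blast
      then have "finite (X \<union> X')" using fin by simp
      have "X = X \<union> X'" by (rule card_subset_eq[OF \<open>finite (X \<union> X')\<close>]) (use X that in auto)
      moreover have "X' = X \<union> X'"
        by (rule card_subset_eq[OF \<open>finite (X \<union> X')\<close>]) (use that in auto)
      ultimately show ?thesis by blast
    qed
    then have "{X'. X' \<subseteq> {..<M} \<and> card X' = k - 1 \<and> card (X \<union> X') = k - 1} \<subseteq> {X}" by blast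
    from card_mono[OF _ this]
    show "card {X'. X' \<subseteq> {..<M} \<and> card X' = k - 1 \<and> card (X \<union> X') = k - 1} \<le> 1" by simp
    show "card {X'. X' \<subseteq> {..<M} \<and> card X' = k - 1 \<and> card (X \<union> X') = k} \<le> (k - 1) * M"
      using card_swaps_near[OF fin X(2) X(1)] k by simp
  qed (use k in simp)
  have "mean (\<lambda>h. of_bool (B1 h \<or> B2 h \<or> B3 h \<or> B4 h))
      \<le> mean (\<lambda>h. of_bool (B1 h)) + (mean (\<lambda>h. of_bool (B2 h)) + (mean (\<lambda>h. of_bool (B3 h)) + mean (\<lambda>h. of_bool (B4 h))))"
    by (intro order.trans[OF mean_disj_le] add_left_mono order.refl)
  also have "\<dots> \<le> antitwin_bound k"
    unfolding antitwin_bound_def using 1 2 3 4 by simp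
  finally have "mean (\<lambda>h. of_bool (B1 h \<or> B2 h \<or> B3 h \<or> B4 h)) \<le> antitwin_bound k" .
  with b have "mean (\<lambda>h. of_bool (B1 h \<or> B2 h \<or> B3 h \<or> B4 h)) < 1" by simp
  then obtain h where h: "h \<in> PiE slots (\<lambda>_. {..<p})" "of_bool (B1 h \<or> B2 h \<or> B3 h \<or> B4 h) < (1 :: real)"
    by (rule avg_less_oneE[OF finite_slots p_fin])
  then have "\<not> B1 h" "\<not> B2 h" "\<not> B3 h" "\<not> B4 h" by (auto split: if_splits)
  show thesis
  proof (rule that[OF h(1)])
    fix X c assume X: "(X, c) \<in> configs k"
    have "B1 h" if "card {y\<in>{..<M} - X. matches {0, 1} y X c h} \<le> k"
      unfolding B1_def by (rule bexI[OF _ X]) (use that in simp)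
    then show "k + 1 \<le> card {y\<in>{..<M} - X. matches {0, 1} y X c h}"
      using \<open>\<not> B1 h\<close> by linarith
  next
    fix X c assume X: "(X, c) \<in> configs (k - 1)"
    have "B2 h" if "card {y\<in>{..<M} - X. matches {0} y X c h} \<le> k + 1"
      unfolding B2_def by (rule bexI[OF _ X]) (use that in simp)
    then show "k + 2 \<le> card {y\<in>{..<M} - X. exact y X c h}"
      using \<open>\<not> B2 h\<close> unfolding exact_eq_matches by linarith
  next
    fix X c X' c' and c0 :: nat
    assume X: "(X, c) \<in> configs k" "(X', c') \<in> configs (k - 1)" and c0: "c0 < 2"
    have "B3 h" if "unjoined {0, 1} X c X' c' c0 ({..<M} - (X \<union> X')) h"
      unfolding B3_def
      by (rule bexI[OF _ X(1)], rule case_prodI, rule bexI[OF _ X(2)], rule case_prodI,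
          rule bexI[of _ c0]) (use that c0 in simp_all)
    then show "\<not> unjoined {0, 1} X c X' c' c0 ({..<M} - (X \<union> X')) h" using \<open>\<not> B3 h\<close> by blast
  next
    fix X c X' c' and c0 :: nat
    assume X: "(X, c) \<in> configs (k - 1)" "(X', c') \<in> configs (k - 1)" and c0: "c0 < 2"
    have "B4 h" if "unjoined {0} X c X' c' c0 ({..<M} - (X \<union> X')) h"
      unfolding B4_def
      by (rule bexI[OF _ X(1)], rule case_prodI, rule bexI[OF _ X(2)], rule case_prodI,
          rule bexI[of _ c0]) (use that c0 in simp_all)
    then show "\<not> unjoined {0} X c X' c' c0 ({..<M} - (X \<union> X')) h" using \<open>\<not> B4 h\<close> by blast
  qed
qed

lemma exact_cong: "(\<And>x. x \<in> X \<Longrightarrow> c x = c' x) \<Longrightarrow> exact y X c h = exact y X c' h"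
  by (simp add: exact_def)

lemma twisted_config:
  assumes "(X, c) \<in> configs j" "d = 0 \<or> p = 2"
  shows "(X, restrict (\<lambda>x. act d (c x)) X) \<in> configs j"
  using configsD[OF assms(1)] act_less[OF assms(2)] by (auto simp: configs_def)

lemma exact_twisted: "exact y X (restrict (\<lambda>x. act d (c x)) X) h = exact y X (\<lambda>x. act d (c x)) h"
  by (rule exact_cong) simp

lemma card_outside_le:
  assumes "finite X'"
  shows "card {y\<in>{..<M} - X. P y} \<le> card {y\<in>{..<M} - (X \<union> X'). P y} + card X'"
proof -
  have "card {y\<in>{..<M} - X. P y} \<le> card ({y\<in>{..<M} - (X \<union> X'). P y} \<union> X')"
    by (rule card_mono) (use assms in auto)
  also have "\<dots> \<le> card {y\<in>{..<M} - (X \<union> X'). P y} + card X'" by (rule card_Un_le)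
  finally show ?thesis .
qed

lemma ex_antitwin_target:
  assumes p2: "p = 2" and k: "4 \<le> k" and kM: "k \<le> M" and b: "antitwin_bound k < 1"
  shows "\<exists>\<tau>. target k p 2 M rv \<tau>"
proof -
  obtain h where h: "h \<in> PiE slots (\<lambda>_. {..<p})"
    and n1: "\<And>X c. (X, c) \<in> configs k \<Longrightarrow> k + 1 \<le> card {y\<in>{..<M} - X. matches {0, 1} y X c h}"
    and n2: "\<And>X c. (X, c) \<in> configs (k - 1) \<Longrightarrow> k + 2 \<le> card {y\<in>{..<M} - X. exact y X c h}"
    and j1: "\<And>X c X' c' c0. \<lbrakk>(X, c) \<in> configs k; (X', c') \<in> configs (k - 1); c0 < 2\<rbrakk> \<Longrightarrow>
      \<not> unjoined {0, 1} X c X' c' c0 ({..<M} - (X \<union> X')) h"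
    and j2: "\<And>X c X' c' c0. \<lbrakk>(X, c) \<in> configs (k - 1); (X', c') \<in> configs (k - 1); c0 < 2\<rbrakk> \<Longrightarrow>
      \<not> unjoined {0} X c X' c' c0 ({..<M} - (X \<union> X')) h"
    by (rule antitwin_typesE[OF p2 k b]) blast
  \<comment> \<open>Towards the apex the vertex \<open>(y, s)\<close> has the type
    \<open>act s 0 = s\<close>, so an apex literal fixes the sign.\<close>
  define \<tau> where "\<tau> = type_of (\<lambda>_. 0) h"
  have \<zeta>: "\<And>y::nat. (0::nat) < p" using p by simp
  have mplain: "matching M 2 \<tau> (lits_of X c)
      = {(y, s). y \<in> {..<M} - X \<and> s < 2 \<and> exact y X (\<lambda>x. act s (c x)) h}"
    if "(X, c) \<in> configs j" for X c j
    unfolding \<tau>_def by (rule matching_plain[OF h \<zeta>]) (use configsD[OF that] p2 in auto)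
  have mapex: "matching M 2 \<tau> (insert (M, d) (lits_of X c))
      = (\<lambda>y. (y, d)) ` {y\<in>{..<M} - X. exact y X (\<lambda>x. act d (c x)) h}"
    if "(X, c) \<in> configs j" "d < 2" for X c j d
  proof -
    have "matching M 2 \<tau> (insert (M, d) (lits_of X c))
      = {(y, s). y \<in> {..<M} - X \<and> s < 2 \<and> act s 0 = d \<and> exact y X (\<lambda>x. act s (c x)) h}"
      unfolding \<tau>_def by (rule matching_apex[OF h \<zeta>]) (use configsD[OF that(1)] p2 in auto)
    moreover have "act s 0 = d \<longleftrightarrow> s = d" if "s < 2" for s
      using that \<open>d < 2\<close> by (auto simp: act_def)
    ultimately show ?thesis using that(2) by auto
  qed
  have fin: "finite (matching M 2 \<tau> K)" for K
    by (rule finite_subset[of _ "{..<M} \<times> {..<2}"]) (auto simp: matching_def)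
  have "target k p 2 M rv \<tau>"
  proof
    show "4 \<le> k" "k \<le> M" "2 \<le> p" "(2::nat) = 1 \<or> (2::nat) = 2 \<and> p = 2" using k kM p p2 by auto
    show "rv c < p" "rv (rv c) = c" if "c < p" for c using rv that by auto
    show "\<tau> x y < p" if "x \<le> M" "y \<le> M" "x \<noteq> y" for x y
      unfolding \<tau>_def by (rule type_of_less[OF h \<zeta> that])
    show "\<tau> y x = rv (\<tau> x y)" if "x \<le> M" "y \<le> M" "x \<noteq> y" for x y
      unfolding \<tau>_def by (rule type_of_rev[OF h \<zeta> that])
    show "k \<le> card (matching M 2 \<tau> K)" if K: "lits M p K" "card K = k" for K
    proof -
      have "0 < k" using k by simp
      from K this show ?thesis
      proof (cases rule: litsE)
        case (plain X c)
        then have cfg: "(X, c) \<in> configs k" by (simp add: configs_def)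
        have "{y\<in>{..<M} - X. matches {0, 1} y X c h} \<subseteq> fst ` matching M 2 \<tau> K"
          unfolding plain(1) mplain[OF cfg] matches_def
          by force
        then have "card {y\<in>{..<M} - X. matches {0, 1} y X c h} \<le> card (fst ` matching M 2 \<tau> K)"
          using fin by (intro card_mono) auto
        also have "\<dots> \<le> card (matching M 2 \<tau> K)" by (rule card_image_le[OF fin])
        finally show ?thesis using n1[OF cfg] by simp
      next
        case (apex X c d)
        then have cfg: "(X, c) \<in> configs (k - 1)" and d: "d < 2" unfolding configs_def using p2 by auto
        have "card (matching M 2 \<tau> K) = card {y\<in>{..<M} - X. exact y X (\<lambda>x. act d (c x)) h}"
          unfolding apex(1) mapex[OF cfg d]
          by (rule card_image) (simp add: inj_on_def)
        then show ?thesis using n2[OF twisted_config[OF cfg disjI2[OF p2], of d]] by (simp add: exact_twisted)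
      qed
    qed
    show "\<exists>a\<in>matching M 2 \<tau> K. \<exists>b\<in>matching M 2 \<tau> K'. fst a \<noteq> fst b \<and> conn \<tau> b a = c0"
      if K: "lits M p K" "lits M p K'" "card K = k" "card K' = k" and M: "M \<in> fst ` K'" and c0: "c0 < p"
      for K K' c0
    proof -
      have k0: "0 < k" using k by simp
      obtain X' c' d' where K': "K' = insert (M, d') (lits_of X' c')" "X' \<subseteq> {..<M}" "card X' = k - 1"
        "c' \<in> PiE X' (\<lambda>_. {..<p})" "d' < p"
      proof (cases rule: litsE[OF K(2) K(4) k0])
        case (1 X c)
        then show thesis using M by (auto simp: lits_of_def)
      next
        case (2 X c d)
        then show thesis using that by blast
      qed
      \<comment> \<open>Once the sign \<open>d'\<close> is known, realising \<open>c'\<close> means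
        that the base realises the twisted types \<open>e'\<close>.\<close>
      define e' where "e' = restrict (\<lambda>x. act d' (c' x)) X'"
      have cfg': "(X', c') \<in> configs (k - 1)" "d' < 2" unfolding configs_def using K' p2 by auto
      have ecfg': "(X', e') \<in> configs (k - 1)"
        unfolding e'_def by (rule twisted_config[OF cfg'(1)]) (use p2 in simp)
      have d2: "d = 0 \<or> p = 2" for d :: nat using p2 by simp
      \<comment> \<open>With the signs \<open>s\<close> and \<open>d'\<close> at the ends, the type
        \<open>c0\<close> between vertices is the type \<open>act s (act d' c0)\<close> between
        their bases.\<close>
      have finish: "\<exists>a\<in>matching M 2 \<tau> K. \<exists>b\<in>matching M 2 \<tau> K'. fst a \<noteq> fst b \<and> conn \<tau> b a = c0"
        if "(y, s) \<in> matching M 2 \<tau> K" "y \<in> {..<M}" "y' \<in> {..<M} - X'" "exact y' X' e' h" "y \<noteq> y'"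
          "h (slot y' y) = val y' y (act s (act d' c0))" for y s y'
      proof -
        have "(y', d') \<in> matching M 2 \<tau> K'"
          unfolding K'(1) mapex[OF cfg'] using that(3,4) by (auto simp: e'_def exact_twisted)
        moreover have "\<tau> y' y = act s (act d' c0)"
          unfolding \<tau>_def using that c0 act_less[OF d2] by (subst type_of_iff[OF h]) auto
        then have "conn \<tau> (y', d') (y, s) = c0"
          using act_act[OF d2] act_less[OF d2] c0 by (simp add: conn_def)
        ultimately show ?thesis using that(1,5) by force
      qed
      show ?thesis
      proof (cases rule: litsE[OF K(1) K(3) k0])
        case (1 X c)
        then have cfg: "(X, c) \<in> configs k" by (simp add: configs_def)
        let ?R = "{..<M} - (X \<union> X')"
        have nu: "\<not> unjoined {0, 1} X c X' e' (act d' c0) ?R h"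
          using j1[OF cfg ecfg']
            act_less[OF d2 c0] p2 by simp
        have "2 \<le> card {y\<in>?R. matches {0, 1} y X c h}"
          using n1[OF cfg]
            card_outside_le[OF configsD(4)[OF ecfg'], of X "\<lambda>y. matches {0, 1} y X c h"] K'(3) k by linarith
        moreover have "2 \<le> card {y\<in>?R. exact y X' e' h}"
          using n2[OF ecfg']
            card_outside_le[OF configsD(4)[OF cfg], of X' "\<lambda>y. exact y X' e' h"] 1(3) k
          by (simp add: Un_commute)
        ultimately obtain y s y' where y: "y \<in> ?R" "s \<in> {0, 1}" "y' \<in> ?R"
          "exact y X (\<lambda>x. act s (c x)) h" "exact y' X' e' h" "y \<noteq> y'"
          "h (slot y' y) = val y' y (act s (act d' c0))"
          using nu unfolding unjoined_def by blast
        have "(y, s) \<in> matching M 2 \<tau> K" unfolding 1(1) mplain[OF cfg] using y by auto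
        then show ?thesis using y by (intro finish[of y s y']) auto
      next
        case (2 X c d)
        then have cfg: "(X, c) \<in> configs (k - 1)" "d < 2" unfolding configs_def using p2 by auto
        define e where "e = restrict (\<lambda>x. act d (c x)) X"
        have ecfg: "(X, e) \<in> configs (k - 1)"
          unfolding e_def by (rule twisted_config[OF cfg(1)]) (use p2 in simp)
        let ?R = "{..<M} - (X \<union> X')"
        \<comment> \<open>The apex literal in \<open>K\<close> fixes the sign \<open>d\<close> on
          this side, too. After twisting both sides only the sign 0 is left, and \<open>d\<close>
          moves into the prescribed type.\<close>
        have nu: "\<not> unjoined {0} X e X' e' (act d (act d' c0)) ?R h"
          using j2[OF ecfg ecfg']
            act_less[OF d2 act_less[OF d2 c0]] p2 by simp
        have "2 \<le> card {y\<in>?R. matches {0} y X e h}"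
          using n2[OF ecfg] K'(3) k
            card_outside_le[OF configsD(4)[OF ecfg'], of X "\<lambda>y. exact y X e h"]
          unfolding exact_eq_matches by linarith
        moreover have "2 \<le> card {y\<in>?R. exact y X' e' h}"
          using n2[OF ecfg']
            card_outside_le[OF configsD(4)[OF cfg(1)], of X' "\<lambda>y. exact y X' e' h"] 2(3) k
          by (simp add: Un_commute)
        ultimately obtain y y' where y: "y \<in> ?R" "y' \<in> ?R"
          "exact y X (\<lambda>x. act 0 (e x)) h" "exact y' X' e' h" "y \<noteq> y'"
          "h (slot y' y) = val y' y (act 0 (act d (act d' c0)))"
          using nu unfolding unjoined_def by blast
        have "exact y X e h" using y(3) by (simp add: act_def)
        then have "(y, d) \<in> matching M 2 \<tau> K"
          unfolding 2(1) mapex[OF cfg] using y(1) by (auto simp: e_def exact_twisted)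
        then show ?thesis using y by (intro finish[of y d y']) (auto simp: act_def)
      qed
    qed
  qed
  then show ?thesis by blast
qed

end

section \<open>The target without signs, for \<open>p \<ge> 3\<close>\<close>

lemma card_residue_class:
  assumes "d < p"
  shows "card {y\<in>{..<p * L}. y mod p = d} = (L :: nat)"
proof -
  have "{y\<in>{..<p * L}. y mod p = d} = (\<lambda>i. p * i + d) ` {..<L}"
  proof (intro set_eqI iffI)
    fix y assume y: "y \<in> {y\<in>{..<p * L}. y mod p = d}"
    then have "y = p * (y div p) + d" by auto
    moreover have "y div p < L" using y assms by (simp add: div_less_iff_less_mult mult.commute)
    ultimately show "y \<in> (\<lambda>i. p * i + d) ` {..<L}" by blast
  next
    fix y assume "y \<in> (\<lambda>i. p * i + d) ` {..<L}"
    then obtain i where i: "y = p * i + d" "i < L" by auto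
    have "p * i + d < p * Suc i" using assms by simp
    also have "\<dots> \<le> p * L" using i by (intro mult_le_mono) auto
    finally show "y \<in> {y\<in>{..<p * L}. y mod p = d}" using i assms by simp
  qed
  moreover have "inj_on (\<lambda>i. p * i + d) {..<L}" using assms by (auto simp: inj_on_def)
  ultimately show ?thesis by (simp add: card_image)
qed

context random_types
begin

text \<open>The bases of type \<open>d\<close> towards the apex. If \<open>M\<close> is a multiple
  of \<open>p\<close>, all classes have the same size.\<close>

definition residues :: "nat \<Rightarrow> nat set" where
  "residues d = {y\<in>{..<M}. y mod p = d}"

text \<open>The terms belong to \<open>k\<close> plain literals, to \<open>k - 1\<close> of them
  with the apex, and to \<open>k\<close> of them with the apex. The last asks for a single
  realisation only and supplies the final edge.\<close>

definition plain_bound :: "nat \<Rightarrow> nat \<Rightarrow> real" where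
  "plain_bound k L =
     real (M choose k) * real p ^ k * (2 ^ (k - 1) * (1 - (1 / real p) ^ k / 2) ^ (M - k))
   + real (M choose (k - 1)) * real p ^ (k - 1) * (real p * (2 ^ (k - 1) * (1 - (1 / real p) ^ (k - 1) / 2) ^ (L - k)))
   + real (M choose k) * real p ^ k * (real p * (1 - (1 / real p) ^ k) ^ (L - k))"

text \<open>The general tail uses the moment bound with \<open>t = 1 / 2\<close>. The tail at 0 is
  kept exact, because it enters the dominant term of \<open>plain_bound\<close>, where half the rate
  would not suffice for small \<open>k\<close>.\<close>

lemma mean_few_exact_le:
  assumes X: "(X, c) \<in> configs j" "0 < j" and R: "R \<subseteq> {..<M} - X" "N \<le> card R"
  shows "mean (\<lambda>h. of_bool (card {y\<in>R. exact y X c h} \<le> r)) \<le> 2 ^ r * (1 - (1 / real p) ^ j / 2) ^ N"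
    and "mean (\<lambda>h. of_bool (card {y\<in>R. exact y X c h} \<le> 0)) \<le> (1 - (1 / real p) ^ j) ^ N"
proof -
  note D = configsD[OF X(1)]
  have ne: "X \<noteq> {}" using D(2) X(2) by auto
  let ?q = "(1 / real p) ^ j"
  have q: "0 \<le> ?q" "?q \<le> 1" using p by (auto intro: power_le_one)
  have e: "mean (\<lambda>h. of_bool (card {y\<in>R. exact y X c h} \<le> r)) = binomial_tail (card R) ?q r" for r
    unfolding exact_eq_matches
    using mean_few_matches[OF _ ne D(1) R(1) D(5), where Sg = "{0}" and r = r] D(2)
    by (simp add: signs_def)
  have "mean (\<lambda>h. of_bool (card {y\<in>R. exact y X c h} \<le> r)) \<le> (1 / (1 / 2)) ^ r * (1 - (1 - 1 / 2) * ?q) ^ card R"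
    unfolding e by (rule binomial_tail_le) (use q in auto)
  also have "\<dots> = 2 ^ r * (1 - ?q / 2) ^ card R" by simp
  also have "\<dots> \<le> 2 ^ r * (1 - ?q / 2) ^ N"
    using q R(2) by (intro mult_left_mono power_decreasing) auto
  finally show "mean (\<lambda>h. of_bool (card {y\<in>R. exact y X c h} \<le> r)) \<le> 2 ^ r * (1 - ?q / 2) ^ N" .
  have "binomial_tail (card R) ?q 0 = (1 - ?q) ^ card R" by (simp add: binomial_tail_def)
  also have "\<dots> \<le> (1 - ?q) ^ N" using q R(2) by (intro power_decreasing) auto
  finally show "mean (\<lambda>h. of_bool (card {y\<in>R. exact y X c h} \<le> 0)) \<le> (1 - ?q) ^ N"
    unfolding e .
qed

lemma plain_typesE:
  assumes k: "4 \<le> k" and M: "M = p * L" and b: "plain_bound k L < 1"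
  obtains h where "h \<in> PiE slots (\<lambda>_. {..<p})"
    and "\<And>X c. (X, c) \<in> configs k \<Longrightarrow> k \<le> card {y\<in>{..<M} - X. exact y X c h}"
    and "\<And>X c d. (X, c) \<in> configs (k - 1) \<Longrightarrow> d < p \<Longrightarrow> k \<le> card {y\<in>residues d - X. exact y X c h}"
    and "\<And>X c d. (X, c) \<in> configs k \<Longrightarrow> d < p \<Longrightarrow> 0 < card {y\<in>residues d - X. exact y X c h}"
proof -
  define B1 where "B1 h \<longleftrightarrow> (\<exists>(X, c)\<in>configs k. card {y\<in>{..<M} - X. exact y X c h} \<le> k - 1)" for h
  define B2 where "B2 h \<longleftrightarrow> (\<exists>(X, c)\<in>configs (k - 1). \<exists>d\<in>{..<p}.
      card {y\<in>residues d - X. exact y X c h} \<le> k - 1)" for h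
  define B3 where "B3 h \<longleftrightarrow> (\<exists>(X, c)\<in>configs k. \<exists>d\<in>{..<p}.
      card {y\<in>residues d - X. exact y X c h} \<le> 0)" for h
  have res: "residues d - X \<subseteq> {..<M} - X" "L - k \<le> card (residues d - X)"
    if "(X, c) \<in> configs j" "j \<le> k" "d < p" for X c d j
  proof -
    note D = configsD[OF that(1)]
    have "card (residues d) - card X \<le> card (residues d - X)" by (rule diff_card_le_card_Diff[OF D(4)])
    moreover have "card (residues d) = L"
      unfolding residues_def using card_residue_class[OF that(3), of L] M by simp
    ultimately show "L - k \<le> card (residues d - X)" using D(2) that(2) by simp
  qed (auto simp: residues_def)
  have 1: "mean (\<lambda>h. of_bool (B1 h))
      \<le> real (M choose k) * real p ^ k * (2 ^ (k - 1) * (1 - (1 / real p) ^ k / 2) ^ (M - k))"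
    unfolding B1_def
  proof (rule mean_configs_le)
    fix X c assume X: "(X, c) \<in> configs k"
    have "card ({..<M} - X) = M - k" using configsD[OF X] by (simp add: card_Diff_subset)
    then show "mean (\<lambda>h. of_bool (card {y\<in>{..<M} - X. exact y X c h} \<le> k - 1))
        \<le> 2 ^ (k - 1) * (1 - (1 / real p) ^ k / 2) ^ (M - k)"
      using k by (intro mean_few_exact_le(1)[OF X]) auto
  qed
  have 2: "mean (\<lambda>h. of_bool (B2 h)) \<le> real (M choose (k - 1)) * real p ^ (k - 1) *
      (real p * (2 ^ (k - 1) * (1 - (1 / real p) ^ (k - 1) / 2) ^ (L - k)))"
    unfolding B2_def
  proof (rule mean_configs_le)
    fix X c assume X: "(X, c) \<in> configs (k - 1)"
    have "mean (\<lambda>h. of_bool (\<exists>d\<in>{..<p}. card {y\<in>residues d - X. exact y X c h} \<le> k - 1))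
        \<le> (\<Sum>d<p. mean (\<lambda>h. of_bool (card {y\<in>residues d - X. exact y X c h} \<le> k - 1)))"
      by (rule mean_Bex_le) simp
    also have "\<dots> \<le> (\<Sum>d<p. 2 ^ (k - 1) * (1 - (1 / real p) ^ (k - 1) / 2) ^ (L - k))"
      by (intro sum_mono mean_few_exact_le(1)[OF X] res(1)[OF X] res(2)[OF X]) (use k in auto)
    finally show "mean (\<lambda>h. of_bool (\<exists>d\<in>{..<p}. card {y\<in>residues d - X. exact y X c h} \<le> k - 1))
        \<le> real p * (2 ^ (k - 1) * (1 - (1 / real p) ^ (k - 1) / 2) ^ (L - k))" by simp
  qed
  have 3: "mean (\<lambda>h. of_bool (B3 h)) \<le> real (M choose k) * real p ^ k *
      (real p * (1 - (1 / real p) ^ k) ^ (L - k))"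
    unfolding B3_def
  proof (rule mean_configs_le)
    fix X c assume X: "(X, c) \<in> configs k"
    have "mean (\<lambda>h. of_bool (\<exists>d\<in>{..<p}. card {y\<in>residues d - X. exact y X c h} \<le> 0))
        \<le> (\<Sum>d<p. mean (\<lambda>h. of_bool (card {y\<in>residues d - X. exact y X c h} \<le> 0)))"
      by (rule mean_Bex_le) simp
    also have "\<dots> \<le> (\<Sum>d<p. (1 - (1 / real p) ^ k) ^ (L - k))"
      by (intro sum_mono mean_few_exact_le(2)[OF X] res(1)[OF X] res(2)[OF X]) (use k in auto)
    finally show "mean (\<lambda>h. of_bool (\<exists>d\<in>{..<p}. card {y\<in>residues d - X. exact y X c h} \<le> 0))
        \<le> real p * (1 - (1 / real p) ^ k) ^ (L - k)" by simp
  qed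
  have "mean (\<lambda>h. of_bool (B1 h \<or> B2 h \<or> B3 h))
      \<le> mean (\<lambda>h. of_bool (B1 h)) + (mean (\<lambda>h. of_bool (B2 h)) + mean (\<lambda>h. of_bool (B3 h)))"
    by (intro order.trans[OF mean_disj_le] add_left_mono order.refl)
  also have "\<dots> \<le> plain_bound k L" unfolding plain_bound_def using 1 2 3 by simp
  finally have "mean (\<lambda>h. of_bool (B1 h \<or> B2 h \<or> B3 h)) < 1" using b by simp
  then obtain h where h: "h \<in> PiE slots (\<lambda>_. {..<p})" "of_bool (B1 h \<or> B2 h \<or> B3 h) < (1 :: real)"
    by (rule avg_less_oneE[OF finite_slots p_fin])
  then have n: "\<not> B1 h" "\<not> B2 h" "\<not> B3 h" by (auto split: if_splits)
  show thesis
  proof (rule that[OF h(1)])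
    fix X c assume X: "(X, c) \<in> configs k"
    have "B1 h" if "card {y\<in>{..<M} - X. exact y X c h} \<le> k - 1"
      unfolding B1_def by (rule bexI[OF _ X]) (use that in simp)
    then show "k \<le> card {y\<in>{..<M} - X. exact y X c h}" using n(1) by linarith
  next
    fix X c and d :: nat assume X: "(X, c) \<in> configs (k - 1)" and d: "d < p"
    have "B2 h" if "card {y\<in>residues d - X. exact y X c h} \<le> k - 1"
      unfolding B2_def by (rule bexI[OF _ X], rule case_prodI, rule bexI[of _ d]) (use that d in simp_all)
    then show "k \<le> card {y\<in>residues d - X. exact y X c h}" using n(2) by linarith
  next
    fix X c and d :: nat assume X: "(X, c) \<in> configs k" and d: "d < p"
    have "B3 h" if "card {y\<in>residues d - X. exact y X c h} \<le> 0"
      unfolding B3_def by (rule bexI[OF _ X], rule case_prodI, rule bexI[of _ d]) (use that d in simp_all)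
    then show "0 < card {y\<in>residues d - X. exact y X c h}" using n(3) by linarith
  qed
qed

text \<open>For the final edge, a realisation \<open>x\<close> of \<open>K\<close> outside
  \<open>X'\<close> is chosen; it exists since \<open>K\<close> has at least \<open>k\<close>
  realisations and \<open>X'\<close> has \<open>k - 1\<close> elements. Adding \<open>x\<close> with
  the type \<open>c0\<close> to the bases of \<open>K'\<close> gives \<open>k\<close> plain literals
  and the apex, and any realisation of these is joined to \<open>x\<close> as desired.\<close>

lemma ex_plain_target:
  assumes k: "4 \<le> k" and kM: "k \<le> M" and M: "M = p * L" and b: "plain_bound k L < 1"
  shows "\<exists>\<tau>. target k p 1 M rv \<tau>"
proof -
  obtain h where h: "h \<in> PiE slots (\<lambda>_. {..<p})"
    and n1: "\<And>X c. (X, c) \<in> configs k \<Longrightarrow> k \<le> card {y\<in>{..<M} - X. exact y X c h}"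
    and n2: "\<And>X c d. (X, c) \<in> configs (k - 1) \<Longrightarrow> d < p \<Longrightarrow> k \<le> card {y\<in>residues d - X. exact y X c h}"
    and n3: "\<And>X c d. (X, c) \<in> configs k \<Longrightarrow> d < p \<Longrightarrow> 0 < card {y\<in>residues d - X. exact y X c h}"
    by (rule plain_typesE[OF k M b]) blast
  define \<tau> where "\<tau> = type_of (\<lambda>y. y mod p) h"
  have \<zeta>: "\<And>y::nat. y mod p < p" using p by simp
  have act0: "act 0 c = c" for c by (simp add: act_def)
  have mplain: "matching M 1 \<tau> (lits_of X c) = (\<lambda>y. (y, 0)) ` {y\<in>{..<M} - X. exact y X c h}"
    if "(X, c) \<in> configs j" for X c j
  proof -
    have "matching M 1 \<tau> (lits_of X c) = {(y, s). y \<in> {..<M} - X \<and> s < 1 \<and> exact y X (\<lambda>x. act s (c x)) h}"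
      unfolding \<tau>_def by (rule matching_plain[OF h \<zeta>]) (use configsD(1,3)[OF that] in simp_all)
    also have "\<dots> = {(y, s). s = 0 \<and> y \<in> {..<M} - X \<and> exact y X c h}" using act0 by auto
    also have "\<dots> = (\<lambda>y. (y, 0)) ` {y\<in>{..<M} - X. exact y X c h}" by blast
    finally show ?thesis .
  qed
  have mapex: "matching M 1 \<tau> (insert (M, d) (lits_of X c))
      = (\<lambda>y. (y, 0)) ` {y\<in>residues d - X. exact y X c h}"
    if "(X, c) \<in> configs j" for X c j d
  proof -
    have "matching M 1 \<tau> (insert (M, d) (lits_of X c))
      = {(y, s). y \<in> {..<M} - X \<and> s < 1 \<and> act s (y mod p) = d \<and> exact y X (\<lambda>x. act s (c x)) h}"
      unfolding \<tau>_def by (rule matching_apex[OF h \<zeta>]) (use configsD(1,3)[OF that] in simp_all)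
    also have "\<dots> = {(y, s). s = 0 \<and> y \<in> residues d - X \<and> exact y X c h}"
      unfolding residues_def using act0 by auto
    also have "\<dots> = (\<lambda>y. (y, 0)) ` {y\<in>residues d - X. exact y X c h}" by blast
    finally show ?thesis .
  qed
  have inj: "inj_on (\<lambda>y. (y, 0::nat)) A" for A :: "nat set" by (simp add: inj_on_def)
  have k0: "0 < k" using k by simp
  have many: "k \<le> card (matching M 1 \<tau> K)" if K: "lits M p K" "card K = k" for K
  proof (cases rule: litsE[OF K k0])
    case (1 X c)
    then have cfg: "(X, c) \<in> configs k" by (simp add: configs_def)
    show ?thesis unfolding 1(1) mplain[OF cfg] card_image[OF inj] by (rule n1[OF cfg])
  next
    case (2 X c d)
    then have cfg: "(X, c) \<in> configs (k - 1)" by (simp add: configs_def)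
    show ?thesis unfolding 2(1) mapex[OF cfg] card_image[OF inj] by (rule n2[OF cfg 2(5)])
  qed
  have "target k p 1 M rv \<tau>"
  proof
    show "4 \<le> k" "k \<le> M" "2 \<le> p" "(1::nat) = 1 \<or> (1::nat) = 2 \<and> p = 2" using k kM p by auto
    show "rv c < p" "rv (rv c) = c" if "c < p" for c using rv that by auto
    show "\<tau> x y < p" if "x \<le> M" "y \<le> M" "x \<noteq> y" for x y
      unfolding \<tau>_def by (rule type_of_less[OF h \<zeta> that])
    show "\<tau> y x = rv (\<tau> x y)" if "x \<le> M" "y \<le> M" "x \<noteq> y" for x y
      unfolding \<tau>_def by (rule type_of_rev[OF h \<zeta> that])
    show "k \<le> card (matching M 1 \<tau> K)" if K: "lits M p K" "card K = k" for K
      by (rule many[OF that])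
    show "\<exists>a\<in>matching M 1 \<tau> K. \<exists>b\<in>matching M 1 \<tau> K'. fst a \<noteq> fst b \<and> conn \<tau> b a = c0"
      if K: "lits M p K" "lits M p K'" "card K = k" "card K' = k" and apex: "M \<in> fst ` K'" and c0: "c0 < p"
      for K K' c0
    proof -
      obtain X' c' d' where K': "K' = insert (M, d') (lits_of X' c')" "X' \<subseteq> {..<M}" "card X' = k - 1"
        "c' \<in> PiE X' (\<lambda>_. {..<p})" "d' < p"
      proof (cases rule: litsE[OF K(2) K(4) k0])
        case (1 X c)
        then show thesis using apex by (auto simp: lits_of_def)
      next
        case (2 X c d)
        then show thesis using that by blast
      qed
      have fin: "finite X'" using K'(2) by (rule finite_subset) simp
      let ?A = "fst ` matching M 1 \<tau> K"
      have "inj_on fst (matching M 1 \<tau> K)" by (auto simp: inj_on_def matching_def)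
      then have "k \<le> card ?A" using many[OF K(1,3)] by (simp add: card_image)
      then have "card X' < card ?A" using K'(3) k by simp
      then have "\<not> ?A \<subseteq> X'" using card_mono[OF fin] by (metis not_less)
      then obtain x where x: "x \<in> ?A" "x \<notin> X'" by blast
      then have xM: "x < M" "(x, 0) \<in> matching M 1 \<tau> K" by (auto simp: matching_def)
      define c where "c = c'(x := c0)"
      have cfg: "(insert x X', c) \<in> configs k"
        using K' x(2) xM(1) c0 k fin by (auto simp: configs_def c_def PiE_iff extensional_def)
      have "{y\<in>residues d' - insert x X'. exact y (insert x X') c h} \<noteq> {}"
        using n3[OF cfg K'(5)] by (metis card.empty less_irrefl)
      then obtain y where y: "y \<in> residues d'" "y \<notin> insert x X'" "exact y (insert x X') c h" by blast
      have "exact y X' c' h" using y(3) x(2) by (auto simp: exact_def c_def)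
      then have "(y, 0) \<in> matching M 1 \<tau> K'"
        unfolding K'(1) using y mapex[of X' c' "k - 1" d'] K' by (auto simp: configs_def)
      moreover have "h (slot y x) = val y x c0" using y(3) by (simp add: exact_def c_def)
      then have "\<tau> y x = c0"
        unfolding \<tau>_def using y xM c0 by (subst type_of_iff[OF h]) (auto simp: residues_def)
      ultimately show ?thesis using xM(2) y(2) by (force simp: conn_def act0)
    qed
  qed
  then show ?thesis by blast
qed

end

subsection \<open>Greedy colouring\<close>

text \<open>The rank is the distance to \<open>W\<close>, which drops along a shortest walk.\<close>

lemma exists_rank:
  assumes "\<And>v. v \<in> U \<Longrightarrow> \<exists>w\<in>W. (v, w) \<in> R\<^sup>*"
  shows "\<exists>\<rho> :: 'a \<Rightarrow> nat. (\<forall>w\<in>W. \<rho> w = 0) \<and> (\<forall>v\<in>U - W. \<exists>u. (v, u) \<in> R \<and> \<rho> u < \<rho> v)"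
proof -
  define \<rho> where "\<rho> v = (LEAST n. \<exists>w\<in>W. (v, w) \<in> R ^^ n)" for v
  have "\<rho> w = 0" if "w \<in> W" for w
    using that unfolding \<rho>_def by (intro Least_eq_0) auto
  moreover have "\<exists>u. (v, u) \<in> R \<and> \<rho> u < \<rho> v" if v: "v \<in> U - W" for v
  proof -
    obtain w n where "w \<in> W" "(v, w) \<in> R ^^ n" using assms[of v] v rtrancl_imp_relpow by fastforce
    then have "\<exists>w\<in>W. (v, w) \<in> R ^^ \<rho> v" unfolding \<rho>_def by (intro LeastI) auto
    then obtain w where w: "w \<in> W" "(v, w) \<in> R ^^ \<rho> v" by blast
    have "\<rho> v \<noteq> 0" using w v by (metis DiffD2 relpow_0_E)
    then obtain m where m: "\<rho> v = Suc m" using not0_implies_Suc by blast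
    then obtain u where u: "(v, u) \<in> R" "(u, w) \<in> R ^^ m" using w(2) relpow_Suc_E2 by metis
    have "\<rho> u \<le> m" unfolding \<rho>_def by (rule Least_le) (use u w in auto)
    then show ?thesis using u m by auto
  qed
  ultimately show ?thesis by blast
qed

section \<open>Realisations of literals in a target\<close>

context target
begin

lemma act_less': "s < g \<Longrightarrow> c < p \<Longrightarrow> act s c < p"
  using g by (auto simp: act_def)

lemma act_act': "s < g \<Longrightarrow> c < p \<Longrightarrow> act s (act s c) = c"
  using g by (auto simp: act_def)

lemma act_commute: "s < g \<Longrightarrow> t < g \<Longrightarrow> c < p \<Longrightarrow> act s (act t c) = act t (act s c)"
  using g by (auto simp: act_def)

text \<open>Two signs occur for two types only; complementation then reaches both types, so just one
  sign misses \<open>d\<close>.\<close>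

lemma act_sign_inj:
  assumes "s < g" "t < g" "c < p" "act s c \<noteq> d" "act t c \<noteq> d" "d < p"
  shows "s = t"
  using g assms by (auto simp: act_def split: if_splits)

text \<open>On two types an involution is the identity or the exchange, and complementation commutes
  with both.\<close>

lemma act_rv:
  assumes "s < g" "c < p"
  shows "act s (rv c) = rv (act s c)"
proof (cases "s = 0")
  case False
  then have 2: "p = 2" using g assms by auto
  have "rv 0 < 2" "rv 1 < 2" "rv (rv 0) = 0" "rv (rv 1) = 1" using rv_less rv_rv 2 by auto
  then have "rv 0 = 0 \<and> rv 1 = 1 \<or> rv 0 = 1 \<and> rv 1 = 0"
    by (metis One_nat_def less_2_cases)
  moreover have "c = 0 \<or> c = 1" using assms 2 by auto
  ultimately show ?thesis using False by (auto simp: act_def)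
qed (simp add: act_def)

lemma matching_insert_subset: "matching M g \<tau> (insert l K) \<subseteq> matching M g \<tau> K"
  by (auto simp: matching_def)

lemma matching_mono: "K \<subseteq> K' \<Longrightarrow> matching M g \<tau> K' \<subseteq> matching M g \<tau> K"
  by (auto simp: matching_def)

lemma finite_matching: "finite (matching M g \<tau> K)"
  by (rule finite_subset[of _ "{..<M} \<times> {..<g}"]) (auto simp: matching_def)

lemma lits_fin: "lits M p K \<Longrightarrow> finite K"
  unfolding lits_def by (rule finite_subset[of _ "{..M} \<times> {..<p}"]) auto

lemma fresh_base:
  assumes "lits M p K" "card K < k"
  obtains x where "x < M" "x \<notin> fst ` K"
proof -
  have "card (fst ` K) < M"
    using assms k_le_M card_image_le[OF lits_fin[OF assms(1)], of fst] by linarith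
  then have "\<not> {..<M} \<subseteq> fst ` K"
    using card_mono[of "fst ` K" "{..<M}"] lits_fin[OF assms(1)] by auto
  then show thesis using that by blast
qed

lemma lits_insert:
  assumes "lits M p K" "x \<le> M" "x \<notin> fst ` K" "c < p"
  shows "lits M p (insert (x, c) K)" "card (insert (x, c) K) = Suc (card K)"
proof -
  have "(x, c) \<notin> K" using assms(3) by force
  then show "card (insert (x, c) K) = Suc (card K)" using lits_fin[OF assms(1)] by simp
  show "lits M p (insert (x, c) K)"
    using assms by (auto simp: lits_def inj_on_insert)
qed

text \<open>Each missing literal at least doubles the count: the types towards a fresh base split
  the realisations, and two of the \<open>p\<close> types are taken into account.\<close>

lemma card_matching_ge:
  assumes "lits M p K" "card K \<le> k"
  shows "2 ^ (k - card K) * k \<le> card (matching M g \<tau> K)"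
  using assms
proof (induction "k - card K" arbitrary: K)
  case 0
  then show ?case using many[OF 0(2)] by simp
next
  case (Suc j)
  then have less: "card K < k" by simp
  obtain x where x: "x < M" "x \<notin> fst ` K" by (rule fresh_base[OF Suc(3) less])
  have ge: "2 ^ j * k \<le> card (matching M g \<tau> (insert (x, c) K))" if "c < 2" for c
  proof -
    have c: "c < p" using that p2 by simp
    note l = lits_insert[OF Suc(3) less_imp_le[OF x(1)] x(2) c]
    have "j = k - card (insert (x, c) K)" using Suc(2) l(2) by simp
    then show ?thesis using Suc(1)[OF _ l(1)] l(2) less by simp
  qed
  let ?A = "\<lambda>c. matching M g \<tau> (insert (x, c) K)"
  have disj: "?A 0 \<inter> ?A 1 = {}" by (auto simp: matching_def)
  have "2 ^ Suc j * k = 2 ^ j * k + 2 ^ j * k" by simp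
  also have "\<dots> \<le> card (?A 0) + card (?A 1)" by (intro add_mono ge) auto
  also have "\<dots> = card (?A 0 \<union> ?A 1)" using disj by (simp add: card_Un_disjoint finite_matching)
  also have "\<dots> \<le> card (matching M g \<tau> K)"
    by (intro card_mono finite_matching Un_least matching_insert_subset)
  finally show ?case using Suc(2) by simp
qed

lemma lits_extend:
  assumes "lits M p K" "card K \<le> k"
  shows "\<exists>K'. K \<subseteq> K' \<and> lits M p K' \<and> card K' = k"
  using assms
proof (induction "k - card K" arbitrary: K)
  case 0
  then show ?case by auto
next
  case (Suc j)
  then have less: "card K < k" by simp
  obtain x where x: "x < M" "x \<notin> fst ` K" by (rule fresh_base[OF Suc(3) less])
  have "0 < p" using p2 by simp
  note l = lits_insert[OF Suc(3) less_imp_le[OF x(1)] x(2) this]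
  have "j = k - card (insert (x, 0) K)" using Suc(2) l(2) by simp
  then show ?case using Suc(1)[OF _ l(1)] l(2) less by (metis Suc_leI insert_subset)
qed

lemma joined_le:
  assumes "lits M p K" "lits M p K'" "card K \<le> k" "card K' \<le> k" "M \<in> fst ` K'" "c < p"
  shows "\<exists>a\<in>matching M g \<tau> K. \<exists>b\<in>matching M g \<tau> K'. fst a \<noteq> fst b \<and> conn \<tau> b a = c"
proof -
  obtain L L' where L: "K \<subseteq> L" "lits M p L" "card L = k" "K' \<subseteq> L'" "lits M p L'" "card L' = k"
    using lits_extend assms by metis
  then have "M \<in> fst ` L'" using assms(5) by blast
  from joined[OF L(2,5,3,6) this assms(6)] show ?thesis
    using matching_mono[OF L(1)] matching_mono[OF L(4)] by blast
qed

lemma conn_matching: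
  assumes "a \<in> matching M g \<tau> K" "(x, act t c) \<in> K" "t < g" "c < p" "x \<le> M"
  shows "fst a \<noteq> x" "conn \<tau> a (x, t) = c" "conn \<tau> (x, t) a = rv c"
proof -
  obtain y s where a: "a = (y, s)" by (cases a)
  have m: "y < M" "s < g" "y \<noteq> x" "act s (\<tau> y x) = act t c"
    using assms(1,2) unfolding matching_def a by auto
  show "fst a \<noteq> x" using m a by simp
  have \<tau>: "\<tau> y x < p" using \<tau>_less m assms(5) by simp
  have "act s (act t (\<tau> y x)) = act t (act s (\<tau> y x))"
    by (rule act_commute[OF m(2) assms(3) \<tau>])
  also have "\<dots> = c" using m(4) act_act'[OF assms(3,4)] by simp
  finally show 1: "conn \<tau> a (x, t) = c" by (simp add: conn_def a)
  have "\<tau> x y = rv (\<tau> y x)" using \<tau>_rev[of y x] m assms(5) by simp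
  then have "conn \<tau> (x, t) a = rv (act t (act s (\<tau> y x)))"
    using act_rv[OF m(2) \<tau>] act_rv[OF assms(3) act_less'[OF m(2) \<tau>]] by (simp add: conn_def a)
  also have "act t (act s (\<tau> y x)) = c" using m(4) act_act'[OF assms(3,4)] by simp
  finally show "conn \<tau> (x, t) a = rv c" .
qed

end

section \<open>Colouring a connected typed graph\<close>

locale colouring = target +
  fixes V :: "'a set" and E :: "'a \<Rightarrow> 'a \<Rightarrow> bool" and r :: "'a \<Rightarrow> 'a \<Rightarrow> nat"
  assumes finite_V: "finite V"
    and E_V: "E u v \<Longrightarrow> u \<in> V \<and> v \<in> V \<and> u \<noteq> v" and E_sym: "E u v \<Longrightarrow> E v u"
    and r_less: "E u v \<Longrightarrow> r u v < p" and r_rev: "E u v \<Longrightarrow> r v u = rv (r u v)"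
    and degree_le: "v \<in> V \<Longrightarrow> card {w. E v w} \<le> Suc k"
begin

text \<open>The colour of \<open>w\<close> is a vertex with a sign; to have the type
  \<open>r v w\<close> towards it is to have the type changed by this sign towards its base.\<close>

definition lit :: "('a \<Rightarrow> nat \<times> nat) \<Rightarrow> 'a \<Rightarrow> 'a \<Rightarrow> nat \<times> nat" where
  "lit f v w = (fst (f w), act (snd (f w)) (r v w))"

definition nbs :: "'a set \<Rightarrow> 'a \<Rightarrow> 'a set" where
  "nbs S v = {w \<in> S. E v w}"

text \<open>Adjacent vertices need different bases because vertices over the same base are not
  joined in the target.\<close>

definition typed_hom :: "'a set \<Rightarrow> ('a \<Rightarrow> nat \<times> nat) \<Rightarrow> bool" where
  "typed_hom S f \<longleftrightarrow> f ` S \<subseteq> {..M} \<times> {..<g} \<and>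
     (\<forall>v\<in>S. \<forall>w\<in>S. E v w \<longrightarrow> fst (f v) \<noteq> fst (f w) \<and> conn \<tau> (f v) (f w) = r v w)"

text \<open>Invariant of the colouring: the coloured neighbours of an uncoloured vertex prescribe
  at most one type towards each base.\<close>

definition extendable :: "'a set \<Rightarrow> ('a \<Rightarrow> nat \<times> nat) \<Rightarrow> bool" where
  "extendable S f \<longleftrightarrow> S \<subseteq> V \<and> typed_hom S f \<and> (\<forall>u\<in>V - S. inj_on fst (lit f u ` nbs S u))"

lemma finite_nbs: "S \<subseteq> V \<Longrightarrow> finite (nbs S v)"
  unfolding nbs_def using finite_V finite_subset by (metis finite_Collect_conjI finite_subset Collect_mem_eq)

lemma card_nbs_add:
  assumes "v \<in> V" "S \<inter> T = {}" "S \<subseteq> V" "T \<subseteq> V"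
  shows "card (nbs S v) + card (nbs T v) \<le> card {w. E v w}"
proof -
  have "card (nbs S v) + card (nbs T v) = card (nbs S v \<union> nbs T v)"
    using assms by (intro card_Un_disjoint[symmetric] finite_nbs) (auto simp: nbs_def)
  also have "\<dots> \<le> card {w. E v w}"
  proof (rule card_mono)
    show "finite {w. E v w}" using finite_V E_V by (auto intro: finite_subset[of _ V])
  qed (auto simp: nbs_def)
  finally show ?thesis .
qed

lemma lits_lit:
  assumes "extendable S f" "v \<in> V - S"
  shows "lits M p (lit f v ` nbs S v)"
proof -
  have "lit f v w \<in> {..M} \<times> {..<p}" if "w \<in> nbs S v" for w
  proof -
    have "f w \<in> {..M} \<times> {..<g}" "E v w"
      using that assms(1) by (auto simp: nbs_def extendable_def typed_hom_def)
    then show ?thesis using act_less'[OF _ r_less] by (auto simp: lit_def)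
  qed
  then have "lit f v ` nbs S v \<subseteq> {..M} \<times> {..<p}" by (rule image_subsetI)
  then show ?thesis using assms unfolding lits_def extendable_def by blast
qed

lemma lit_conn:
  assumes "x \<in> matching M g \<tau> (lit f v ` nbs S v)" "w \<in> nbs S v" "f w \<in> {..M} \<times> {..<g}"
  shows "fst x \<noteq> fst (f w)" "conn \<tau> x (f w) = r v w" "conn \<tau> (f w) x = r w v"
proof -
  have E: "E v w" using assms(2) by (simp add: nbs_def)
  have "lit f v w \<in> lit f v ` nbs S v" using assms(2) by blast
  then have l: "(fst (f w), act (snd (f w)) (r v w)) \<in> lit f v ` nbs S v" by (simp add: lit_def)
  have s: "snd (f w) < g" "fst (f w) \<le> M" using assms(3) by auto
  note c = conn_matching[OF assms(1) l s(1) r_less[OF E] s(2)]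
  show "fst x \<noteq> fst (f w)" "conn \<tau> x (f w) = r v w" "conn \<tau> (f w) x = r w v"
    using c r_rev[OF E] by auto
qed

lemma typed_hom_insert:
  assumes "typed_hom S f" "v \<notin> S" "x \<in> matching M g \<tau> (lit f v ` nbs S v)"
  shows "typed_hom (insert v S) (f(v := x))"
  unfolding typed_hom_def
proof (intro conjI ballI impI)
  have fS: "f w \<in> {..M} \<times> {..<g}" if "w \<in> S" for w using assms(1) that by (auto simp: typed_hom_def)
  have "x \<in> {..M} \<times> {..<g}" using assms(3) by (auto simp: matching_def)
  then show "(f(v := x)) ` insert v S \<subseteq> {..M} \<times> {..<g}"
    using fS by (intro image_subsetI) (metis fun_upd_apply insertE)
  fix a b assume ab: "a \<in> insert v S" "b \<in> insert v S" "E a b"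
  have ne: "a \<noteq> b" using E_V ab by blast
  have h: "fst (f a) \<noteq> fst (f b) \<and> conn \<tau> (f a) (f b) = r a b" if "a \<in> S" "b \<in> S"
    using assms(1) that ab by (auto simp: typed_hom_def)
  consider "a \<in> S" "b \<in> S" | "a = v" "b \<in> S" | "a \<in> S" "b = v" using ab ne by blast
  then have "fst ((f(v := x)) a) \<noteq> fst ((f(v := x)) b) \<and> conn \<tau> ((f(v := x)) a) ((f(v := x)) b) = r a b"
  proof cases
    case 1
    then have "a \<noteq> v" "b \<noteq> v" using assms(2) by blast+
    then show ?thesis using h[OF 1] by simp
  next
    case 2
    then have "b \<in> nbs S v" using ab by (simp add: nbs_def)
    then show ?thesis using lit_conn(1,2)[OF assms(3) _ fS] 2 ne by simp
  next
    case 3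
    then have "a \<in> nbs S v" using ab E_sym by (simp add: nbs_def)
    then show ?thesis using lit_conn(1,3)[OF assms(3) _ fS] 3 ne by (metis fun_upd_apply)
  qed
  then show "fst ((f(v := x)) a) \<noteq> fst ((f(v := x)) b)"
    "conn \<tau> ((f(v := x)) a) ((f(v := x)) b) = r a b" by blast+
qed

lemma power_ge_linear: "(j + 1) * (k - 1) < 2 ^ j * k"
proof -
  have "j + 1 \<le> 2 ^ j" by (induction j) auto
  then have "(j + 1) * (k - 1) \<le> 2 ^ j * (k - 1)" by (rule mult_right_mono) simp
  also have "\<dots> < 2 ^ j * k" using k by simp
  finally show ?thesis .
qed

text \<open>Let \<open>j\<close> be \<open>k\<close> minus the number of coloured neighbours of
  \<open>v\<close>. At most \<open>j + 1\<close> neighbours are uncoloured, each of these has at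
  most \<open>k - 1\<close> coloured neighbours, and each of those spoils at most one vertex; the
  \<open>2 ^ j * k\<close> candidates outnumber the spoilt ones.\<close>

lemma extend_one:
  assumes ext: "extendable S f" and v: "v \<in> V - S" and few: "card (nbs S v) \<le> k"
    and later: "\<And>u. u \<in> V - insert v S \<Longrightarrow> E v u \<Longrightarrow> card (nbs S u) \<le> k - 1"
  shows "\<exists>x. extendable (insert v S) (f(v := x))"
proof -
  define K where "K = lit f v ` nbs S v"
  define U where "U = nbs (V - insert v S) v"
  \<comment> \<open>The vertices over the base of \<open>w\<close> that would give \<open>u\<close>
    a second type towards this base; only one sign does so.\<close>
  define clash where "clash u w = {(y, s). s < g \<and> y = fst (f w) \<and> act s (r u v) \<noteq> snd (lit f u w)}" for u w
  define F where "F = (\<Union>u\<in>U. \<Union>w\<in>nbs S u. clash u w)"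
  have SV: "S \<subseteq> V" using ext by (simp add: extendable_def)
  have K: "lits M p K" unfolding K_def by (rule lits_lit[OF ext v])
  have cK: "card K \<le> card (nbs S v)" unfolding K_def by (rule card_image_le[OF finite_nbs[OF SV]])
  have finU: "finite U" unfolding U_def by (rule finite_nbs) auto
  have clash: "finite (clash u w)" "card (clash u w) \<le> 1" if "u \<in> U" "w \<in> nbs S u" for u w
  proof -
    have E: "E u v" "E u w" "w \<in> S" using that E_sym by (auto simp: U_def nbs_def)
    have "f w \<in> {..M} \<times> {..<g}" using ext E(3) by (auto simp: extendable_def typed_hom_def)
    then have l: "snd (lit f u w) < p" using act_less'[OF _ r_less[OF E(2)]] by (auto simp: lit_def)
    have "a = b" if "a \<in> clash u w" "b \<in> clash u w" for a b
      using that act_sign_inj[OF _ _ r_less[OF E(1)] _ _ l] by (auto simp: clash_def)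
    then have "clash u w = {} \<or> (\<exists>a. clash u w = {a})" by (metis is_singletonI' is_singleton_def)
    then show "finite (clash u w)" "card (clash u w) \<le> 1" by auto
  qed
  have "card F \<le> (\<Sum>u\<in>U. card (\<Union>w\<in>nbs S u. clash u w))"
    unfolding F_def by (rule card_UN_le[OF finU])
  also have "\<dots> \<le> (\<Sum>u\<in>U. k - 1)"
  proof (rule sum_mono)
    fix u assume u: "u \<in> U"
    have "card (\<Union>w\<in>nbs S u. clash u w) \<le> (\<Sum>w\<in>nbs S u. card (clash u w))"
      by (rule card_UN_le[OF finite_nbs[OF SV]])
    also have "\<dots> \<le> (\<Sum>w\<in>nbs S u. 1)" by (rule sum_mono) (use clash u in auto)
    also have "\<dots> \<le> k - 1" using later[of u] u by (simp add: U_def nbs_def)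
    finally show "card (\<Union>w\<in>nbs S u. clash u w) \<le> k - 1" .
  qed
  also have "\<dots> = card U * (k - 1)" by simp
  also have "\<dots> \<le> (k - card (nbs S v) + 1) * (k - 1)"
  proof (rule mult_right_mono)
    have "card (nbs S v) + card U \<le> Suc k"
    proof -
      have "S \<inter> (V - insert v S) = {}" by blast
      then show ?thesis
        using card_nbs_add[of v S "V - insert v S"] degree_le[of v] v SV unfolding U_def by simp
    qed
    then show "card U \<le> k - card (nbs S v) + 1" using few by simp
  qed simp
  also have "\<dots> < 2 ^ (k - card (nbs S v)) * k" by (rule power_ge_linear)
  also have "\<dots> \<le> 2 ^ (k - card K) * k" using cK by (intro mult_right_mono power_increasing) auto
  also have "\<dots> \<le> card (matching M g \<tau> K)" using cK few by (intro card_matching_ge K) simp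
  finally have "\<not> matching M g \<tau> K \<subseteq> F"
    using card_mono[of F "matching M g \<tau> K"] clash(1) finU finite_nbs[OF SV] by (auto simp: F_def)
  then obtain x where x: "x \<in> matching M g \<tau> K" "x \<notin> F" by blast
  have "extendable (insert v S) (f(v := x))"
    unfolding extendable_def
  proof (intro conjI ballI)
    show "insert v S \<subseteq> V" using v SV by simp
    show "typed_hom (insert v S) (f(v := x))"
      by (rule typed_hom_insert) (use ext v x in \<open>auto simp: extendable_def K_def\<close>)
    fix u assume u: "u \<in> V - insert v S"
    have old: "lit (f(v := x)) u w = lit f u w" if "w \<in> S" for w
      using that v by (auto simp: lit_def)
    have inj: "inj_on fst (lit f u ` nbs S u)" using ext u by (auto simp: extendable_def)
    show "inj_on fst (lit (f(v := x)) u ` nbs (insert v S) u)"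
    proof (cases "E u v")
      case False
      then have "nbs (insert v S) u = nbs S u" by (auto simp: nbs_def)
      moreover have "lit (f(v := x)) u ` nbs S u = lit f u ` nbs S u"
        by (rule image_cong) (auto simp: old nbs_def)
      ultimately show ?thesis using inj by simp
    next
      case True
      then have uU: "u \<in> U" using u E_sym by (auto simp: U_def nbs_def)
      have "nbs (insert v S) u = insert v (nbs S u)" using True by (auto simp: nbs_def)
      moreover have "lit (f(v := x)) u ` nbs S u = lit f u ` nbs S u"
        by (rule image_cong) (auto simp: old nbs_def)
      ultimately have im: "lit (f(v := x)) u ` nbs (insert v S) u
          = insert (fst x, act (snd x) (r u v)) (lit f u ` nbs S u)"
        by (simp add: lit_def)
      have "act (snd x) (r u v) = snd (lit f u w)" if w: "w \<in> nbs S u" "fst x = fst (lit f u w)" for w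
      proof (rule ccontr)
        assume "act (snd x) (r u v) \<noteq> snd (lit f u w)"
        moreover have "snd x < g" using x(1) by (auto simp: matching_def)
        ultimately have "x \<in> clash u w" using w(2) by (auto simp: clash_def lit_def case_prod_unfold)
        then show False using x(2) uU w(1) by (auto simp: F_def)
      qed
      then have uq: "(fst x, act (snd x) (r u v)) = l" if "l \<in> lit f u ` nbs S u" "fst x = fst l" for l
        using that by (auto simp: prod_eq_iff)
      have "fst (fst x, act (snd x) (r u v)) \<notin> fst ` (lit f u ` nbs S u - {(fst x, act (snd x) (r u v))})"
      proof (rule notI, erule imageE)
        fix l
        assume l: "fst (fst x, act (snd x) (r u v)) = fst l"
          "l \<in> lit f u ` nbs S u - {(fst x, act (snd x) (r u v))}"
        have "fst x = fst l" using l(1) by (simp only: fst_conv)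
        from uq[OF DiffD1[OF l(2)] this] show False using DiffD2[OF l(2)] by blast
      qed
      then show ?thesis unfolding im inj_on_insert using inj by blast
    qed
  qed
  then show ?thesis by blast
qed

text \<open>A vertex of maximal rank is coloured next. An uncoloured neighbour \<open>u\<close> of
  it outside \<open>W\<close> has an uncoloured neighbour of smaller rank than its own, hence
  different from the chosen vertex; so two neighbours of \<open>u\<close> are uncoloured and at most
  \<open>k - 1\<close> are coloured. Vertices of \<open>W\<close> are left over and need a small
  degree or a neighbour in \<open>W\<close> instead.\<close>

lemma extend_by_rank:
  fixes \<rho> :: "'a \<Rightarrow> nat"
  assumes "extendable S f" and W: "W \<subseteq> V - S"
    and "\<And>v. v \<in> V - S - W \<Longrightarrow> \<exists>u\<in>V - S. E v u \<and> \<rho> u < \<rho> v"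
    and Wfew: "\<And>u. u \<in> W \<Longrightarrow> card {w. E u w} \<le> k \<or> (\<exists>w\<in>W. E u w)"
  shows "\<exists>f'. extendable (V - W) f' \<and> (\<forall>a\<in>S. f' a = f a)"
  using assms(1-3)
proof (induction "card (V - S - W)" arbitrary: S f)
  case 0
  then have "V - S - W = {}" using finite_V by simp
  then have "S = V - W" using 0 by (auto simp: extendable_def)
  then show ?case using 0 by auto
next
  case (Suc n)
  have fin: "finite (V - S - W)" using finite_V by simp
  have SV: "S \<subseteq> V" using Suc(3) by (simp add: extendable_def)
  have ne: "V - S - W \<noteq> {}" using Suc(2) by (metis card.empty nat.distinct(1))
  obtain v where v: "v \<in> V - S - W" and vmax: "\<And>b. b \<in> V - S - W \<Longrightarrow> \<rho> b \<le> \<rho> v"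
  proof -
    have "Max (\<rho> ` (V - S - W)) \<in> \<rho> ` (V - S - W)" using fin ne by (intro Max_in) auto
    then obtain v where "v \<in> V - S - W" "\<rho> v = Max (\<rho> ` (V - S - W))" by auto
    then show thesis using that[of v] fin by simp
  qed
  have two: "card (nbs S u) \<le> k - 1" if "u \<in> V" "a \<in> V - S" "b \<in> V - S" "a \<noteq> b" "E u a" "E u b" for u a b
  proof -
    have "card {a, b} \<le> card (nbs (V - S) u)"
      by (rule card_mono) (use that in \<open>auto simp: nbs_def finite_V\<close>)
    then show ?thesis
      using card_nbs_add[of u S "V - S"] degree_le[OF that(1)] SV that(1,4) by auto
  qed
  have one: "card (nbs S u) + 1 \<le> card {w. E u w}" if "u \<in> V" "a \<in> V - S" "E u a" for u a
  proof -
    have "card {a} \<le> card (nbs (V - S) u)"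
      by (rule card_mono) (use that in \<open>auto simp: nbs_def finite_V\<close>)
    then show ?thesis using card_nbs_add[of u S "V - S"] SV that(1) by auto
  qed
  obtain u0 where u0: "u0 \<in> V - S" "E v u0" using Suc(5)[OF v] by blast
  have few: "card (nbs S v) \<le> k"
    using one[OF _ u0] degree_le[of v] v by auto
  have later: "card (nbs S u) \<le> k - 1" if u: "u \<in> V - insert v S" "E v u" for u
  proof (cases "u \<in> W")
    case True
    have Euv: "E u v" using u E_sym by blast
    from Wfew[OF True] show ?thesis
    proof
      assume "card {w. E u w} \<le> k"
      then show ?thesis using one[of u v] u v Euv by auto
    next
      assume "\<exists>w\<in>W. E u w"
      then obtain w where "w \<in> W" "E u w" by blast
      then show ?thesis using two[of u w v] u v Euv Suc(4) by auto
    qed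
  next
    case False
    then obtain u' where u': "u' \<in> V - S" "E u u'" "\<rho> u' < \<rho> u" using Suc(5)[of u] u by blast
    moreover have "\<rho> u \<le> \<rho> v" using vmax False u by blast
    ultimately have "u' \<noteq> v" by auto
    then show ?thesis using two[of u u' v] u' u v E_sym by blast
  qed
  obtain x where x: "extendable (insert v S) (f(v := x))"
    using extend_one[OF Suc(3) _ few later] v by blast
  have "\<exists>f'. extendable (V - W) f' \<and> (\<forall>a\<in>insert v S. f' a = (f(v := x)) a)"
  proof (rule Suc(1)[OF _ x])
    have "V - insert v S - W = (V - S - W) - {v}" by auto
    then show "n = card (V - insert v S - W)" using Suc(2) v fin by simp
    show "W \<subseteq> V - insert v S" using Suc(4) v by auto
    fix b assume b: "b \<in> V - insert v S - W"
    then obtain u where u: "u \<in> V - S" "E b u" "\<rho> u < \<rho> b" using Suc(5)[of b] by blast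
    have "\<rho> b \<le> \<rho> v" using vmax b by blast
    then have "u \<noteq> v" using u by auto
    then show "\<exists>u\<in>V - insert v S. E b u \<and> \<rho> u < \<rho> b" using u by blast
  qed
  then show ?case using v by (metis DiffD1 DiffD2 fun_upd_other insertCI)
qed

lemma extendable_empty: "extendable {} f"
  by (simp add: extendable_def typed_hom_def nbs_def)

lemma extendable_singleton:
  assumes "w \<in> V"
  shows "extendable {w} (\<lambda>_. (M, 0))"
proof -
  have "\<not> E w w" using E_V by blast
  moreover have "nbs {w} u \<subseteq> {w}" for u by (auto simp: nbs_def)
  then have "inj_on fst (lit (\<lambda>_. (M, 0)) u ` nbs {w} u)" for u by (auto simp: inj_on_def)
  ultimately show ?thesis using assms g by (auto simp: extendable_def typed_hom_def)
qed

text \<open>\<open>z\<close> is coloured last; its small degree replaces the uncoloured neighbour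
  that all other vertices have at their turn.\<close>

lemma typed_hom_low_degree:
  assumes conn: "\<And>a b. a \<in> V \<Longrightarrow> b \<in> V \<Longrightarrow> (a, b) \<in> {(x, y). E x y}\<^sup>*"
    and root: "z \<in> V" "card {w. E z w} \<le> k"
  shows "\<exists>f. typed_hom V f"
proof -
  have "\<exists>\<rho> :: 'a \<Rightarrow> nat. (\<forall>w\<in>{z}. \<rho> w = 0) \<and> (\<forall>v\<in>V - {z}. \<exists>u. (v, u) \<in> {(x, y). E x y} \<and> \<rho> u < \<rho> v)"
    by (rule exists_rank) (use conn root in auto)
  then obtain \<rho> :: "'a \<Rightarrow> nat" where \<rho>: "\<forall>v\<in>V - {z}. \<exists>u. E v u \<and> \<rho> u < \<rho> v" by auto
  have "\<exists>f'. extendable (V - {z}) f' \<and> (\<forall>a\<in>{}. f' a = (\<lambda>_. (0, 0)) a)"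
  proof (rule extend_by_rank[where \<rho> = \<rho>])
    show "\<exists>u\<in>V - {}. E v u \<and> \<rho> u < \<rho> v" if "v \<in> V - {} - {z}" for v
      using \<rho> that E_V by (metis Diff_empty)
  qed (use root extendable_empty in auto)
  then obtain f where f: "extendable (V - {z}) f" by blast
  have "card (nbs (V - {z}) z) \<le> card {w. E z w}"
    using card_nbs_add[of z "V - {z}" "{}"] root by simp
  then have "\<exists>x. extendable (insert z (V - {z})) (f(z := x))"
    using root by (intro extend_one[OF f]) auto
  then show ?thesis using root by (metis extendable_def insert_Diff)
qed

lemma typed_hom_regular:
  assumes conn: "\<And>a b. a \<in> V \<Longrightarrow> b \<in> V \<Longrightarrow> (a, b) \<in> {(x, y). E x y}\<^sup>*"
    and ne: "V \<noteq> {}" and reg: "\<And>v. v \<in> V \<Longrightarrow> card {w. E v w} = Suc k"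
  shows "\<exists>f. typed_hom V f"
proof -
  obtain a where a: "a \<in> V" using ne by blast
  have "\<exists>\<rho> :: 'a \<Rightarrow> nat. (\<forall>w\<in>{a}. \<rho> w = 0) \<and> (\<forall>v\<in>V - {a}. \<exists>u. (v, u) \<in> {(x, y). E x y} \<and> \<rho> u < \<rho> v)"
    by (rule exists_rank) (use conn a in auto)
  then obtain d :: "'a \<Rightarrow> nat" where d: "d a = 0" "\<And>v. v \<in> V - {a} \<Longrightarrow> \<exists>u. E v u \<and> d u < d v" by auto
  have nb: "\<exists>u. E v u \<and> u \<noteq> x" if "v \<in> V" for v x
  proof (rule ccontr)
    assume "\<not> ?thesis"
    then have "{w. E v w} \<subseteq> {x}" by auto
    then have "card {w. E v w} \<le> 1" using card_mono[of "{x}" "{w. E v w}"] by simp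
    then show False using reg[OF that] k by simp
  qed
  obtain w where w: "w \<in> V" and wmax: "\<And>v. v \<in> V \<Longrightarrow> d v \<le> d w"
  proof -
    have "Max (d ` V) \<in> d ` V" using finite_V ne by (intro Max_in) auto
    then obtain w where "w \<in> V" "d w = Max (d ` V)" by auto
    then show thesis using that[of w] finite_V by simp
  qed
  have wa: "w \<noteq> a"
  proof
    assume "w = a"
    then have z: "d v = 0" if "v \<in> V" for v using wmax[OF that] d(1) by simp
    obtain v where "E a v" "v \<noteq> a" using nb[OF a] by blast
    then have "v \<in> V - {a}" using E_V by blast
    then show False using d(2)[of v] z[of v] by auto
  qed
  text \<open>A vertex at maximal distance from \<open>a\<close> is not a cut vertex.\<close>
  define R where "R = {(x, y). E x y \<and> x \<noteq> w \<and> y \<noteq> w}"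
  have toa: "(v, a) \<in> R\<^sup>*" if "v \<in> V - {w}" for v
    using that
  proof (induction "d v" arbitrary: v rule: less_induct)
    case less
    show ?case
    proof (cases "v = a")
      case False
      then obtain u where u: "E v u" "d u < d v" using d(2)[of v] less(2) by blast
      moreover have "d v \<le> d w" using wmax less(2) by blast
      ultimately have "u \<noteq> w" by auto
      then have "(v, u) \<in> R" "u \<in> V - {w}" using u less(2) E_V by (auto simp: R_def)
      then show ?thesis using less(1)[OF u(2)] by (meson converse_rtrancl_into_rtrancl)
    qed simp
  qed
  have "sym R" by (auto simp: R_def sym_def E_sym)
  then have symR: "sym (R\<^sup>*)" by (rule sym_rtrancl)
  \<comment> \<open>The last edge joins \<open>v0\<close>, a neighbour of \<open>w\<close>, to a
    further neighbour \<open>u\<close> of \<open>v0\<close>. The other vertices are ranked by the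
    distance to this edge in the graph without \<open>w\<close>.\<close>
  obtain v0 where v0: "E w v0" using nb[OF w] by blast
  then have v0V: "v0 \<in> V" "v0 \<noteq> w" using E_V by blast+
  obtain u where u: "E v0 u" "u \<noteq> w" using nb[OF v0V(1)] by blast
  then have uV: "u \<in> V" "u \<noteq> v0" using E_V by blast+
  have "\<exists>\<rho> :: 'a \<Rightarrow> nat. (\<forall>x\<in>{u, v0}. \<rho> x = 0) \<and> (\<forall>v\<in>(V - {w}) - {u, v0}. \<exists>x. (v, x) \<in> R \<and> \<rho> x < \<rho> v)"
  proof (rule exists_rank)
    fix v assume v: "v \<in> V - {w}"
    have "(a, u) \<in> R\<^sup>*" using toa[of u] uV u symR by (auto dest: symD)
    then show "\<exists>x\<in>{u, v0}. (v, x) \<in> R\<^sup>*" using toa[OF v] by (auto intro: rtrancl_trans)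
  qed
  then obtain \<rho> :: "'a \<Rightarrow> nat" where \<rho>: "\<And>v. v \<in> V - {w} - {u, v0} \<Longrightarrow> \<exists>x. (v, x) \<in> R \<and> \<rho> x < \<rho> v" by auto
  let ?S = "V - {u, v0}"
  have "\<exists>f. extendable ?S f \<and> (\<forall>x\<in>{w}. f x = (\<lambda>_. (M, 0)) x)"
  proof (rule extend_by_rank[where \<rho> = \<rho>])
    show "extendable {w} (\<lambda>_. (M, 0))" by (rule extendable_singleton[OF w])
    show "{u, v0} \<subseteq> V - {w}" using uV v0V u by auto
    show "\<exists>x\<in>V - {w}. E v x \<and> \<rho> x < \<rho> v" if v: "v \<in> V - {w} - {u, v0}" for v
    proof -
      obtain x where "(v, x) \<in> R" "\<rho> x < \<rho> v" using \<rho>[OF v] by blast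
      then have "x \<in> V - {w}" "E v x" using E_V by (auto simp: R_def)
      then show ?thesis using \<open>\<rho> x < \<rho> v\<close> by blast
    qed
    \<comment> \<open>\<open>u\<close> and \<open>v0\<close> are adjacent, so each keeps an
      uncoloured neighbour to the end.\<close>
    show "card {w. E x w} \<le> k \<or> (\<exists>y\<in>{u, v0}. E x y)" if "x \<in> {u, v0}" for x
      using that u E_sym by blast
  qed
  then obtain f where f: "extendable ?S f" "f w = (M, 0)" by auto
  have lu: "lits M p (lit f u ` nbs ?S u)" and lv: "lits M p (lit f v0 ` nbs ?S v0)"
    using lits_lit[OF f(1)] uV v0V by auto
  have card: "card (lit f x ` nbs ?S x) \<le> k" if "x \<in> V" "E x y" "y \<in> {u, v0}" for x y
  proof -
    have "y \<in> nbs {u, v0} x" using that by (simp add: nbs_def)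
    then have "0 < card (nbs {u, v0} x)"
      by (auto simp: card_gt_0_iff nbs_def)
    moreover have "card (nbs ?S x) + card (nbs {u, v0} x) \<le> card {w. E x w}"
      using card_nbs_add[OF that(1), of ?S "{u, v0}"] uV v0V by auto
    moreover have "card (lit f x ` nbs ?S x) \<le> card (nbs ?S x)"
      by (rule card_image_le[OF finite_nbs]) auto
    ultimately show ?thesis using reg[OF that(1)] by simp
  qed
  \<comment> \<open>The vertex \<open>w\<close>, coloured by the apex, supplies the apex literal
    that \<open>joined\<close> demands.\<close>
  have "w \<in> nbs ?S v0" using v0 E_sym w v0V u by (auto simp: nbs_def)
  then have "lit f v0 w \<in> lit f v0 ` nbs ?S v0" by blast
  moreover have "fst (lit f v0 w) = M" using f(2) by (simp add: lit_def)
  ultimately have "M \<in> fst ` lit f v0 ` nbs ?S v0" by (metis image_eqI)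
  from joined_le[OF lu lv card card this r_less[OF u(1)]]
  obtain x y where x: "x \<in> matching M g \<tau> (lit f u ` nbs ?S u)"
    and y: "y \<in> matching M g \<tau> (lit f v0 ` nbs ?S v0)"
    and xy: "fst x \<noteq> fst y" "conn \<tau> y x = r v0 u"
    using uV v0V u E_sym by blast
  \<comment> \<open>\<open>x\<close> suits \<open>u\<close> and \<open>y\<close> suits
    \<open>v0\<close> with respect to the rest of the graph. Only the edge between \<open>u\<close>
    and \<open>v0\<close> is open, and the choice of the pair settles it.\<close>
  define f1 where "f1 = f(u := x)"
  have h1: "typed_hom (insert u ?S) f1"
    unfolding f1_def by (rule typed_hom_insert) (use f(1) x in \<open>auto simp: extendable_def\<close>)
  have h2: "typed_hom (insert v0 ?S) (f(v0 := y))"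
    by (rule typed_hom_insert) (use f(1) y in \<open>auto simp: extendable_def\<close>)
  have xy': "conn \<tau> x y = r u v0"
  proof -
    have b: "fst x \<le> M" "snd x < g" "fst y \<le> M" "snd y < g" using x y by (auto simp: matching_def)
    have t: "\<tau> (fst y) (fst x) < p" using \<tau>_less b xy(1) by simp
    have "conn \<tau> x y = act (snd x) (act (snd y) (rv (\<tau> (fst y) (fst x))))"
      using \<tau>_rev[of "fst y" "fst x"] b xy(1) by (simp add: conn_def)
    also have "\<dots> = rv (act (snd x) (act (snd y) (\<tau> (fst y) (fst x))))"
      using act_rv b t act_less' by simp
    also have "act (snd x) (act (snd y) (\<tau> (fst y) (fst x))) = conn \<tau> y x"
      unfolding conn_def by (rule act_commute[OF b(2,4) t])
    also have "rv (conn \<tau> y x) = r u v0" using xy(2) r_rev[OF u(1)] by simp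
    finally show ?thesis .
  qed
  have "typed_hom V (f1(v0 := y))"
    unfolding typed_hom_def
  proof (intro conjI ballI impI)
    have img: "z \<in> V \<Longrightarrow> (f1(v0 := y)) z \<in> {..M} \<times> {..<g}" for z
    proof (cases "z = v0")
      case True
      have "(f(v0 := y)) v0 \<in> {..M} \<times> {..<g}" using h2 unfolding typed_hom_def by blast
      then show ?thesis using True by simp
    next
      case False
      assume "z \<in> V"
      then have "z \<in> insert u ?S" using False by blast
      then have "f1 z \<in> {..M} \<times> {..<g}" using h1 unfolding typed_hom_def by blast
      then show ?thesis using False by simp
    qed
    then show "(f1(v0 := y)) ` V \<subseteq> {..M} \<times> {..<g}" by (rule image_subsetI)
    fix b c assume bc: "b \<in> V" "c \<in> V" "E b c"
    have bcne: "b \<noteq> c" using E_V bc by blast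
    consider "b \<noteq> v0" "c \<noteq> v0" | "b = v0" "c = u" | "b = u" "c = v0"
      | "b = v0" "c \<noteq> u" "c \<noteq> v0" | "c = v0" "b \<noteq> u" "b \<noteq> v0" using bcne by blast
    then have "fst ((f1(v0 := y)) b) \<noteq> fst ((f1(v0 := y)) c) \<and>
        conn \<tau> ((f1(v0 := y)) b) ((f1(v0 := y)) c) = r b c"
    proof cases
      case 1
      then have "b \<in> insert u ?S" "c \<in> insert u ?S" using bc by auto
      then have "fst (f1 b) \<noteq> fst (f1 c) \<and> conn \<tau> (f1 b) (f1 c) = r b c"
        using h1 bc unfolding typed_hom_def by blast
      then show ?thesis using 1 by simp
    next
      case 2
      then show ?thesis using xy uV by (simp add: f1_def)
    next
      case 3
      then show ?thesis using xy xy' uV by (auto simp: f1_def)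
    next
      case 4
      then have "b \<in> insert v0 ?S" "c \<in> insert v0 ?S" using bc by auto
      then have "fst ((f(v0 := y)) b) \<noteq> fst ((f(v0 := y)) c) \<and>
        conn \<tau> ((f(v0 := y)) b) ((f(v0 := y)) c) = r b c" using h2 bc unfolding typed_hom_def by blast
      then show ?thesis using 4 uV by (simp add: f1_def)
    next
      case 5
      then have "b \<in> insert v0 ?S" "c \<in> insert v0 ?S" using bc by auto
      then have "fst ((f(v0 := y)) b) \<noteq> fst ((f(v0 := y)) c) \<and>
        conn \<tau> ((f(v0 := y)) b) ((f(v0 := y)) c) = r b c" using h2 bc unfolding typed_hom_def by blast
      then show ?thesis using 5 uV by (simp add: f1_def)
    qed
    then show "fst ((f1(v0 := y)) b) \<noteq> fst ((f1(v0 := y)) c)"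
      "conn \<tau> ((f1(v0 := y)) b) ((f1(v0 := y)) c) = r b c" by blast+
  qed
  then show ?thesis by blast
qed

lemma typed_hom_connected:
  assumes "\<And>a b. a \<in> V \<Longrightarrow> b \<in> V \<Longrightarrow> (a, b) \<in> {(x, y). E x y}\<^sup>*" and "V \<noteq> {}"
  shows "\<exists>f. typed_hom V f"
proof (cases "\<exists>z\<in>V. card {w. E z w} \<le> k")
  case True
  then show ?thesis using typed_hom_low_degree[OF assms(1)] by blast
next
  case False
  then have reg: "card {w. E v w} = Suc k" if "v \<in> V" for v
    using degree_le[OF that] that by (meson le_SucE)
  show ?thesis
  proof (rule typed_hom_regular)
    show "(a, b) \<in> {(x, y). E x y}\<^sup>*" if "a \<in> V" "b \<in> V" for a b using that by (rule assms(1))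
  qed (rule assms(2), rule reg)
qed

end

subsection \<open>Lower bound\<close>

definition connection_of :: "nat \<Rightarrow> 'a \<Rightarrow> 'a \<Rightarrow> nat \<Rightarrow> 'a connection" where
  "connection_of m u v c =
     (if c < 2 * m then (if even c then Arc u v (c div 2) else Arc v u (c div 2)) else Edge {u, v} (c - 2 * m))"

lemma ends_connection_of: "ends (connection_of m u v c) = {u, v}"
  by (auto simp: connection_of_def)

lemma admissible_connection_of: "c < 2 * m + n \<Longrightarrow> admissible_colour m n (connection_of m u v c)"
  by (auto simp: connection_of_def)

lemma connection_of_inj:
  assumes "connection_of m u v c = connection_of m u v d" "u \<noteq> v"
  shows "c = d"
proof -
  have "c = d" if "c div 2 = d div 2" "even c = even d"
    using that by (metis even_two_times_div_two odd_two_times_div_two_succ)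
  moreover have "c = d" if "\<not> c < 2 * m" "\<not> d < 2 * m" "c - 2 * m = d - 2 * m"
    using that by simp
  ultimately show ?thesis using assms by (auto simp: connection_of_def split: if_splits)
qed

text \<open>The order of the vertices provides a reference direction, so that a colouring is just a
  function from the edges to the types.\<close>

definition orient :: "nat \<Rightarrow> nat sgraph \<Rightarrow> (nat set \<Rightarrow> nat) \<Rightarrow> nat mixed_graph" where
  "orient m G t = (fst G, (\<lambda>e. connection_of m (Min e) (Max e) (t e)) ` snd G)"

lemma card_2_Min_Max:
  fixes e :: "nat set"
  assumes "card e = 2"
  shows "e = {Min e, Max e}" "Min e \<noteq> Max e"
proof -
  obtain a b where e: "e = {a, b}" "a \<noteq> b" using assms by (auto simp: card_2_iff)
  then show "e = {Min e, Max e}" "Min e \<noteq> Max e" by (auto simp: min_def max_def)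
qed

lemma orient_mixed_graph:
  assumes "simple_graph G" "\<And>e. e \<in> snd G \<Longrightarrow> t e < 2 * m + n"
  shows "mixed_graph m n (orient m G t)" "underlying (orient m G t) = G"
proof -
  have ends: "ends (connection_of m (Min e) (Max e) (t e)) = e" if "e \<in> snd G" for e
    using card_2_Min_Max(1)[of e] assms(1) that by (simp add: simple_graph_def ends_connection_of)
  then have "ends ` snd (orient m G t) = snd G" by (force simp: orient_def)
  then show u: "underlying (orient m G t) = G"
    by (simp add: underlying_def orient_def prod_eq_iff)
  have "inj_on ends (snd (orient m G t))"
    using ends by (auto simp: inj_on_def orient_def)
  then show "mixed_graph m n (orient m G t)"
    using assms u by (auto simp: mixed_graph_def orient_def admissible_connection_of)
qed

lemma colored_hom_connection_of:
  assumes "colored_hom f G H" "connection_of m u v c \<in> snd G"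
  shows "connection_of m (f u) (f v) c \<in> snd H"
proof -
  have "Edge (f ` {u, v}) j \<in> snd H" if "Edge {u, v} j \<in> snd G" for j
    using assms(1) that unfolding colored_hom_def by blast
  moreover have "Arc (f a) (f b) i \<in> snd H" if "Arc a b i \<in> snd G" for a b i
    using assms(1) that unfolding colored_hom_def by blast
  ultimately show ?thesis using assms(2) unfolding connection_of_def by (auto split: if_splits)
qed

lemma mixed_graph_finite: "mixed_graph m n H \<Longrightarrow> finite (fst H)"
  by (simp add: mixed_graph_def simple_graph_def underlying_def)

lemma mixed_graph_card_ends: "mixed_graph m n H \<Longrightarrow> c \<in> snd H \<Longrightarrow> card (ends c) = 2"
  by (simp add: mixed_graph_def simple_graph_def underlying_def)

lemma chi_mixed_witness:
  fixes H :: "nat mixed_graph"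
  assumes "mixed_graph m n H" "colored_hom f G H"
  shows "chi_mixed m n G \<le> card (fst H)"
    and "\<exists>(H :: nat mixed_graph) f. mixed_graph m n H \<and> card (fst H) = chi_mixed m n G \<and> colored_hom f G H"
proof -
  let ?P = "\<lambda>k. \<exists>H :: nat mixed_graph. mixed_graph m n H \<and> card (fst H) = k \<and> (\<exists>f. colored_hom f G H)"
  have P: "?P (card (fst H))" using assms by blast
  show "chi_mixed m n G \<le> card (fst H)" unfolding chi_mixed_def by (rule Least_le[of ?P, OF P])
  have "?P (chi_mixed m n G)" unfolding chi_mixed_def by (rule LeastI[of ?P, OF P])
  then show "\<exists>(H :: nat mixed_graph) f. mixed_graph m n H \<and> card (fst H) = chi_mixed m n G \<and> colored_hom f G H"
    by blast
qed

text \<open>A colouring of the connections of \<open>G\<close> is determined by the homomorphism and the table of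
  the colours between the vertices of its target.\<close>

lemma card_colourings_le:
  fixes G :: "nat sgraph"
  assumes G: "simple_graph G" and p: "p = 2 * m + n" "0 < p"
    and K: "\<And>t. t \<in> PiE (snd G) (\<lambda>_. {..<p}) \<Longrightarrow>
      \<exists>(H :: nat mixed_graph) f. mixed_graph m n H \<and> card (fst H) \<le> K \<and> colored_hom f (orient m G t) H"
  shows "p ^ card (snd G) \<le> K ^ card (fst G) * p ^ (K * K)"
proof -
  have finV: "finite (fst G)" using G by (simp add: simple_graph_def)
  have finE: "finite (snd G)"
    by (rule finite_subset[of _ "Pow (fst G)"]) (use G finV in \<open>auto simp: simple_graph_def\<close>)
  let ?D = "PiE (fst G) (\<lambda>_. {..<K}) \<times> PiE ({..<K} \<times> {..<K}) (\<lambda>_. {..<p})"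
  let ?F = "\<lambda>(f, A). restrict (\<lambda>e. A (f (Min e), f (Max e)) :: nat) (snd G)"
  have "PiE (snd G) (\<lambda>_. {..<p}) \<subseteq> ?F ` ?D"
  proof
    fix t assume t: "t \<in> PiE (snd G) (\<lambda>_. {..<p})"
    obtain H :: "nat mixed_graph" and f where H: "mixed_graph m n H" "card (fst H) \<le> K"
      and f: "colored_hom f (orient m G t) H"
      using K[OF t] by blast
    have "card (fst H) \<le> card {..<K}" using H by simp
    then obtain \<iota> where \<iota>: "\<iota> ` fst H \<subseteq> {..<K}" "inj_on \<iota> (fst H)"
      using card_le_inj[OF mixed_graph_finite[OF H(1)], of "{..<K}"] by auto
    define f' where "f' = restrict (\<iota> \<circ> f) (fst G)"
    \<comment> \<open>By \<open>eq\<close> below, the type does not depend on the selected edge. The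
      value 0 at pairs without an edge is a legal type since \<open>0 < p\<close>.\<close>
    define A where "A = restrict (\<lambda>(x, y). if \<exists>e\<in>snd G. f' (Min e) = x \<and> f' (Max e) = y
        then t (SOME e. e \<in> snd G \<and> f' (Min e) = x \<and> f' (Max e) = y) else 0) ({..<K} \<times> {..<K})"
    have fV: "f v \<in> fst H" if "v \<in> fst G" for v
      using f that by (auto simp: colored_hom_def orient_def)
    have MM: "Min e \<in> fst G" "Max e \<in> fst G" "Min e \<noteq> Max e" if "e \<in> snd G" for e
      using card_2_Min_Max[of e] G that by (auto simp: simple_graph_def)
    \<comment> \<open>The target has at most one connection between two vertices, so edges with
      equal images have equal types.\<close>
    have eq: "t e = t e'" if e: "e \<in> snd G" "e' \<in> snd G"
      and ff: "f' (Min e) = f' (Min e')" "f' (Max e) = f' (Max e')" for e e'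
    proof -
      have ff': "f (Min e) = f (Min e')" "f (Max e) = f (Max e')"
        using ff MM[OF e(1)] MM[OF e(2)] fV \<iota>(2) by (auto simp: f'_def dest: inj_onD)
      have c: "connection_of m (f (Min e)) (f (Max e)) (t e) \<in> snd H" if "e \<in> snd G" for e
        by (rule colored_hom_connection_of[OF f]) (use that in \<open>simp add: orient_def\<close>)
      have "connection_of m (f (Min e)) (f (Max e)) (t e) = connection_of m (f (Min e)) (f (Max e)) (t e')"
      proof (rule inj_onD)
        show "inj_on ends (snd H)" using H(1) by (simp add: mixed_graph_def)
        show "connection_of m (f (Min e)) (f (Max e)) (t e') \<in> snd H" using c[OF e(2)] ff' by simp
      qed (simp_all add: ends_connection_of c[OF e(1)])
      moreover have "f (Min e) \<noteq> f (Max e)"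
        using mixed_graph_card_ends[OF H(1) c[OF e(1)]] by (auto simp: ends_connection_of)
      ultimately show ?thesis by (rule connection_of_inj)
    qed
    have f'D: "f' \<in> PiE (fst G) (\<lambda>_. {..<K})" using fV \<iota>(1) unfolding image_subset_iff by (auto simp: f'_def)
    have tp: "t e < p" if "e \<in> snd G" for e using t that by auto
    have some: "(SOME e. e \<in> snd G \<and> f' (Min e) = x \<and> f' (Max e) = y) \<in> snd G \<and>
        f' (Min (SOME e. e \<in> snd G \<and> f' (Min e) = x \<and> f' (Max e) = y)) = x \<and>
        f' (Max (SOME e. e \<in> snd G \<and> f' (Min e) = x \<and> f' (Max e) = y)) = y"
      if "\<exists>e\<in>snd G. f' (Min e) = x \<and> f' (Max e) = y" for x y
      by (rule someI_ex) (use that in blast)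
    have "A xy < p" if "xy \<in> {..<K} \<times> {..<K}" for xy
      using that p(2) some tp by (cases xy) (auto simp: A_def)
    then have AD: "A \<in> PiE ({..<K} \<times> {..<K}) (\<lambda>_. {..<p})" by (auto simp: A_def)
    have "t = ?F (f', A)"
    proof
      fix e
      show "t e = ?F (f', A) e"
      proof (cases "e \<in> snd G")
        case True
        have ex: "\<exists>e'\<in>snd G. f' (Min e') = f' (Min e) \<and> f' (Max e') = f' (Max e)" using True by blast
        have "(f' (Min e), f' (Max e)) \<in> {..<K} \<times> {..<K}" using f'D MM[OF True] by auto
        then have "A (f' (Min e), f' (Max e))
            = t (SOME e'. e' \<in> snd G \<and> f' (Min e') = f' (Min e) \<and> f' (Max e') = f' (Max e))"
          using ex by (simp add: A_def)
        also have "\<dots> = t e" by (rule eq) (use some[OF ex] True in auto)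
        finally show ?thesis using True by simp
      next
        case False
        then show ?thesis using t by (auto simp: PiE_iff extensional_def)
      qed
    qed
    then show "t \<in> ?F ` ?D" using f'D AD by blast
  qed
  then have "card (PiE (snd G) (\<lambda>_. {..<p})) \<le> card (?F ` ?D)"
    by (rule card_mono[rotated]) (intro finite_imageI finite_cartesian_product finite_PiE finV; simp)
  also have "\<dots> \<le> card ?D"
    by (rule card_image_le) (intro finite_cartesian_product finite_PiE finV; simp)
  finally show ?thesis
    using finV finE by (simp add: card_cartesian_product card_PiE)
qed

lemma colored_hom_id: "colored_hom id G G"
  by (simp add: colored_hom_def)

lemma finite_chi_set:
  fixes G :: "nat sgraph"
  shows "finite {chi_mixed m n G' | G'. mixed_graph m n G' \<and> underlying G' = G}"
proof (rule finite_subset)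
  show "{chi_mixed m n G' | G'. mixed_graph m n G' \<and> underlying G' = G} \<subseteq> {..card (fst G)}"
    using chi_mixed_witness(1)[OF _ colored_hom_id] by (auto simp: underlying_def)
qed simp

lemma chi_mixed_le_chi_graph:
  fixes G :: "nat sgraph"
  assumes "mixed_graph m n G'" "underlying G' = G"
  shows "chi_mixed m n G' \<le> chi_graph m n G"
  unfolding chi_graph_def by (intro Max_ge finite_chi_set) (use assms in blast)

lemma chi_graph_le:
  fixes G :: "nat sgraph"
  assumes "simple_graph G" "0 < 2 * m + n"
    and "\<And>G'. mixed_graph m n G' \<Longrightarrow> underlying G' = G \<Longrightarrow> chi_mixed m n G' \<le> B"
  shows "chi_graph m n G \<le> B"
proof -
  have "mixed_graph m n (orient m G (\<lambda>_. 0))" "underlying (orient m G (\<lambda>_. 0)) = G"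
    using orient_mixed_graph[OF assms(1), of "\<lambda>_. 0" m n] assms(2) by auto
  then have "{chi_mixed m n G' | G'. mixed_graph m n G' \<and> underlying G' = G} \<noteq> {}" by blast
  then show ?thesis
    unfolding chi_graph_def Max_le_iff[OF finite_chi_set \<open>_ \<noteq> {}\<close>] using assms(3) by blast
qed

text \<open>The two sides of the copies consist of the even and of the odd numbers; the quotient by \<open>d\<close> of
  half the vertex is the number of its copy.\<close>

definition bipartite_copies :: "nat \<Rightarrow> nat \<Rightarrow> nat sgraph" where
  "bipartite_copies d L =
     ({..<2 * (L * d)}, (\<lambda>(x, y). {2 * x, 2 * y + 1}) ` {(x, y). x < L * d \<and> y < L * d \<and> x div d = y div d})"

lemma card_block:
  assumes "0 < d" "x < L * d"
  shows "card {y. y < L * d \<and> x div d = y div d} = d"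
proof -
  have q: "x div d < L" using assms by (simp add: div_less_iff_less_mult)
  have "{y. y < L * d \<and> x div d = y div d} = {x div d * d ..< x div d * d + d}"
  proof (intro set_eqI iffI)
    fix y assume "y \<in> {y. y < L * d \<and> x div d = y div d}"
    then show "y \<in> {x div d * d ..< x div d * d + d}"
      using dividend_less_div_times[OF assms(1), of y] div_times_less_eq_dividend[of y d] by (simp add: add.commute)
  next
    fix y assume y: "y \<in> {x div d * d ..< x div d * d + d}"
    then have "y div d = x div d"
      using assms(1) by (intro div_nat_eqI) (auto simp: mult.commute)
    moreover have "x div d * d + d \<le> L * d" using q by (metis Suc_leI add.commute mult_Suc mult_le_mono1)
    ultimately show "y \<in> {y. y < L * d \<and> x div d = y div d}" using y by auto
  qed
  then show ?thesis by simp
qed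

lemma inj_bipartite: "inj_on (\<lambda>(x, y). {2 * x, 2 * y + 1 :: nat}) A"
proof (rule inj_onI, clarify)
  fix x y x' y' :: nat assume "{2 * x, 2 * y + 1} = {2 * x', 2 * y' + 1}"
  moreover have "2 * x \<noteq> 2 * y' + 1" "2 * y + 1 \<noteq> 2 * x'" by presburger+
  ultimately show "x = x' \<and> y = y'" unfolding doubleton_eq_iff by auto
qed

lemma bipartite_copies:
  assumes "0 < d" "0 < L"
  shows "bipartite_copies d L \<in> graphs_max_degree d"
    and "card (fst (bipartite_copies d L)) = 2 * (L * d)"
    and "card (snd (bipartite_copies d L)) = L * d * d"
proof -
  let ?P = "{(x, y). x < L * d \<and> y < L * d \<and> x div d = y div d}"
  let ?e = "\<lambda>(x, y). {2 * x, 2 * y + 1 :: nat}"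
  let ?G = "bipartite_copies d L"
  have snd: "snd ?G = ?e ` ?P" and fst: "fst ?G = {..<2 * (L * d)}" by (simp_all add: bipartite_copies_def)
  have "2 * x \<noteq> 2 * y + 1" for x y :: nat by presburger
  then have "simple_graph ?G" unfolding simple_graph_def snd fst by (auto simp: card_2_iff)
  have "?P = (SIGMA x:{..<L * d}. {y. y < L * d \<and> x div d = y div d})" by auto
  then have "card ?P = (\<Sum>x<L * d. card {y. y < L * d \<and> x div d = y div d})" by simp
  also have "\<dots> = (\<Sum>x<L * d. d)" by (rule sum.cong) (use card_block assms in auto)
  finally have cP: "card ?P = L * d * d" by simp
  then show "card (snd ?G) = L * d * d" unfolding snd card_image[OF inj_bipartite] .
  show "card (fst ?G) = 2 * (L * d)" by (simp add: fst)
  have deg: "degree ?G v = d" if v: "v \<in> fst ?G" for v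
  proof (cases "even v")
    case True
    then obtain x where x: "v = 2 * x" by (elim evenE)
    then have xL: "x < L * d" using v fst by simp
    have "{e \<in> snd ?G. v \<in> e} = (\<lambda>y. {2 * x, 2 * y + 1}) ` {y. y < L * d \<and> x div d = y div d}"
    proof (intro set_eqI iffI)
      fix e assume "e \<in> {e \<in> snd ?G. v \<in> e}"
      then obtain a b where ab: "(a, b) \<in> ?P" "e = {2 * a, 2 * b + 1}" "v \<in> e" unfolding snd by auto
      moreover have "2 * x \<noteq> 2 * b + 1" by presburger
      ultimately have "a = x" using x by auto
      then show "e \<in> (\<lambda>y. {2 * x, 2 * y + 1}) ` {y. y < L * d \<and> x div d = y div d}" using ab by auto
    next
      fix e assume "e \<in> (\<lambda>y. {2 * x, 2 * y + 1}) ` {y. y < L * d \<and> x div d = y div d}"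
      then show "e \<in> {e \<in> snd ?G. v \<in> e}" unfolding snd using x xL by auto
    qed
    moreover have "inj_on (\<lambda>y. {2 * x, 2 * y + 1}) {y. y < L * d \<and> x div d = y div d}"
      by (auto simp: inj_on_def doubleton_eq_iff)
    ultimately show ?thesis using card_block[OF assms(1) xL] by (simp add: degree_def card_image)
  next
    case False
    then obtain x where x: "v = 2 * x + 1" by (elim oddE)
    then have xL: "x < L * d" using v fst by simp
    have "{e \<in> snd ?G. v \<in> e} = (\<lambda>y. {2 * y, 2 * x + 1}) ` {y. y < L * d \<and> x div d = y div d}"
    proof (intro set_eqI iffI)
      fix e assume "e \<in> {e \<in> snd ?G. v \<in> e}"
      then obtain a b where ab: "(a, b) \<in> ?P" "e = {2 * a, 2 * b + 1}" "v \<in> e" unfolding snd by auto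
      moreover have "2 * x + 1 \<noteq> 2 * a" by presburger
      ultimately have "b = x" using x by auto
      then show "e \<in> (\<lambda>y. {2 * y, 2 * x + 1}) ` {y. y < L * d \<and> x div d = y div d}" using ab by auto
    next
      fix e assume "e \<in> (\<lambda>y. {2 * y, 2 * x + 1}) ` {y. y < L * d \<and> x div d = y div d}"
      then show "e \<in> {e \<in> snd ?G. v \<in> e}" unfolding snd using x xL by auto
    qed
    moreover have "inj_on (\<lambda>y. {2 * y, 2 * x + 1}) {y. y < L * d \<and> x div d = y div d}"
      by (auto simp: inj_on_def doubleton_eq_iff)
    ultimately show ?thesis using card_block[OF assms(1) xL] by (simp add: degree_def card_image)
  qed
  have "fst ?G \<noteq> {}" using assms by (auto simp: fst lessThan_empty_iff)
  then have "degree ?G ` fst ?G = {d}" using deg by (auto simp: image_iff)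
  then have "max_degree ?G = d" by (simp add: max_degree_def)
  then show "?G \<in> graphs_max_degree d" using \<open>simple_graph ?G\<close> by (simp add: graphs_max_degree_def)
qed

lemma power_le_square:
  fixes K :: nat
  assumes p: "p = 2 * m + n" "0 < p" and d: "0 < d"
    and K: "\<And>G. G \<in> graphs_max_degree d \<Longrightarrow> chi_graph m n G \<le> K"
  shows "p ^ d \<le> K * K"
proof (rule ccontr)
  assume "\<not> p ^ d \<le> K * K"
  then have less: "K * K < p ^ d" by simp
  have count: "(p ^ d) ^ (L * d) \<le> (K * K) ^ (L * d) * p ^ (K * K)" if L: "0 < L" for L
  proof -
    note G = bipartite_copies[OF d L]
    have simple: "simple_graph (bipartite_copies d L)" using G(1) by (simp add: graphs_max_degree_def)
    have "p ^ card (snd (bipartite_copies d L)) \<le> K ^ card (fst (bipartite_copies d L)) * p ^ (K * K)"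
    proof (rule card_colourings_le[OF simple p])
      fix t assume t: "t \<in> PiE (snd (bipartite_copies d L)) (\<lambda>_. {..<p})"
      have or: "mixed_graph m n (orient m (bipartite_copies d L) t)"
        "underlying (orient m (bipartite_copies d L) t) = bipartite_copies d L"
        by (rule orient_mixed_graph[OF simple]; use t p in auto)+
      have "chi_mixed m n (orient m (bipartite_copies d L) t) \<le> K"
        using chi_mixed_le_chi_graph[OF or] K[OF G(1)] by simp
      then show "\<exists>(H :: nat mixed_graph) f. mixed_graph m n H \<and> card (fst H) \<le> K
          \<and> colored_hom f (orient m (bipartite_copies d L) t) H"
        using chi_mixed_witness(2)[OF or(1) colored_hom_id] by metis
    qed
    then show ?thesis
      unfolding G(2,3) by (simp only: mult.commute[of _ d] mult.assoc power_mult flip: power2_eq_square)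
  qed
  have "K * K \<noteq> 0"
  proof
    assume "K * K = 0"
    then have "(p ^ d) ^ (1 * d) \<le> 0" using count[of 1] d by simp
    then show False using p by simp
  qed
  then have Kpos: "0 < real (K * K)" by simp
  \<comment> \<open>The table of types contributes a factor independent of \<open>L\<close>, which
    the powers of a ratio above 1 outgrow.\<close>
  define \<beta> where "\<beta> = real (p ^ d) / real (K * K)"
  have "real (K * K) < real (p ^ d)" using less by (simp only: of_nat_less_iff)
  then have \<beta>: "1 < \<beta>" using Kpos by (simp add: \<beta>_def)
  obtain L0 where L0: "real (p ^ (K * K)) < \<beta> ^ L0" using real_arch_pow[OF \<beta>] by blast
  define L where "L = Suc L0"
  have "L0 \<le> L * d" using d by (cases d) (auto simp: L_def)
  then have "\<beta> ^ L0 \<le> \<beta> ^ (L * d)" using \<beta> by (intro power_increasing) auto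
  then have "real (p ^ (K * K)) < \<beta> ^ (L * d)" using L0 by simp
  also have "\<dots> = real ((p ^ d) ^ (L * d)) / real ((K * K) ^ (L * d))"
    by (simp add: \<beta>_def power_divide)
  also have "\<dots> \<le> real (p ^ (K * K))"
  proof -
    have "real ((p ^ d) ^ (L * d)) \<le> real ((K * K) ^ (L * d) * p ^ (K * K))"
      using count[of L] by (simp only: of_nat_le_iff L_def zero_less_Suc)
    moreover have "0 < real ((K * K) ^ (L * d))" using Kpos by simp
    ultimately show ?thesis by (simp add: divide_le_eq mult.commute)
  qed
  finally show False by simp
qed

lemma chi_family_ge:
  assumes p: "p = 2 * m + n" "0 < p" and d: "0 < d"
  shows "ereal (real p powr (real d / 2)) \<le> ereal_of_enat (chi_family m n (graphs_max_degree d))"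
proof (cases "chi_family m n (graphs_max_degree d)")
  case (enat K)
  have "chi_graph m n G \<le> K" if "G \<in> graphs_max_degree d" for G
  proof -
    have "enat (chi_graph m n G) \<le> chi_family m n (graphs_max_degree d)"
      unfolding chi_family_def using that by (rule SUP_upper)
    then show ?thesis by (simp add: enat)
  qed
  then have "p ^ d \<le> K * K" by (rule power_le_square[OF p d])
  then have "real (p ^ d) \<le> real (K * K)" by (simp only: of_nat_le_iff)
  then have le: "real p ^ d \<le> real K ^ 2" by (simp add: power2_eq_square)
  have "(real p powr (real d / 2)) ^ 2 = real p ^ d"
    using p(2) by (simp add: power2_eq_square powr_add[symmetric] powr_realpow)
  then have "(real p powr (real d / 2)) ^ 2 \<le> real K ^ 2" by (rule ord_eq_le_trans[OF _ le])
  then have "real p powr (real d / 2) \<le> real K" by (rule power2_le_imp_le) simp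
  then show ?thesis by (simp add: enat)
qed simp

subsection \<open>Mixed graphs as typed graphs\<close>

definition reverse_type :: "nat \<Rightarrow> nat \<Rightarrow> nat" where
  "reverse_type m c = (if c < 2 * m then (if even c then c + 1 else c - 1) else c)"

lemma reverse_type_less:
  assumes "c < 2 * m + n"
  shows "reverse_type m c < 2 * m + n"
proof -
  have "c + 1 < 2 * m" if "c < 2 * m" "even c" using that by presburger
  then show ?thesis using assms by (auto simp: reverse_type_def)
qed

lemma reverse_type_reverse_type: "reverse_type m (reverse_type m c) = c"
proof -
  have "c + 1 < 2 * m" if "c < 2 * m" "even c" using that by presburger
  then show ?thesis by (auto simp: reverse_type_def elim!: oddE)
qed

lemma connection_of_reverse: "connection_of m v u (reverse_type m c) = connection_of m u v c"
proof -
  have "c + 1 < 2 * m" if "c < 2 * m" "even c" using that by presburger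
  then show ?thesis
    by (auto simp: connection_of_def reverse_type_def insert_commute elim!: oddE evenE)
qed

section \<open>From typed to coloured homomorphisms\<close>

context target
begin

text \<open>The greedy colouring needs a root, hence connectedness. The components share the target;
  the homomorphism is chosen for a component and not for a vertex, so both ends of an edge are
  treated by the same one.\<close>

lemma typed_hom_components:
  fixes V :: "'a set"
  assumes "colouring k p g M rv \<tau> V E r"
  shows "\<exists>f. f ` V \<subseteq> {..M} \<times> {..<g} \<and>
    (\<forall>u v. E u v \<longrightarrow> fst (f u) \<noteq> fst (f v) \<and> conn \<tau> (f u) (f v) = r u v)"
proof -
  interpret colouring k p g M rv \<tau> V E r by (rule assms)
  define R where "R = {(x, y). E x y}"
  define comp where "comp v = {u \<in> V. (v, u) \<in> R\<^sup>*}" for v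
  define E' where "E' C a b \<longleftrightarrow> E a b \<and> a \<in> C \<and> b \<in> C" for C a b
  have symR: "sym (R\<^sup>*)" by (rule sym_rtrancl) (auto simp: R_def sym_def E_sym)
  have comp_eq: "comp u = comp v" if "(u, v) \<in> R\<^sup>*" for u v
    using that symR unfolding comp_def by (auto dest: symD intro: rtrancl_trans)
  have closed: "(a, b) \<in> {(x, y). E' (comp v) x y}\<^sup>*" if "(a, b) \<in> R\<^sup>*" "a \<in> comp v" for a b v
    using that
  proof (induction rule: rtrancl_induct)
    case (step y z)
    then have E: "E y z" by (simp add: R_def)
    have "(v, y) \<in> R\<^sup>*" using step by (auto simp: comp_def intro: rtrancl_trans)
    moreover have "(v, z) \<in> R\<^sup>*" using \<open>(v, y) \<in> R\<^sup>*\<close> step(2) by (rule rtrancl_into_rtrancl)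
    ultimately have "E' (comp v) y z" using E E_V[OF E] by (auto simp: E'_def comp_def)
    then show ?case using step by (auto intro: rtrancl_into_rtrancl)
  qed simp
  have sub: "comp v \<subseteq> V" for v by (auto simp: comp_def)
  have col: "colouring k p g M rv \<tau> (comp v) (E' (comp v)) r" for v
  proof
    show "finite (comp v)" using sub finite_V by (rule finite_subset)
    fix u w assume "E' (comp v) u w"
    then have E: "E u w" "u \<in> comp v" "w \<in> comp v" unfolding E'_def by blast+
    show "u \<in> comp v \<and> w \<in> comp v \<and> u \<noteq> w" using E E_V by blast
    show "E' (comp v) w u" using E E_sym unfolding E'_def by blast
    show "r u w < p" by (rule r_less[OF E(1)])
    show "r w u = rv (r u w)" by (rule r_rev[OF E(1)])
  next
    fix u assume u: "u \<in> comp v"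
    have "finite {w. E u w}" by (rule finite_subset[OF _ finite_V]) (use E_V in blast)
    then have "card {w. E' (comp v) u w} \<le> card {w. E u w}"
      by (rule card_mono) (use E'_def in blast)
    then show "card {w. E' (comp v) u w} \<le> Suc k" using degree_le[of u] u sub by (meson le_trans subsetD)
  qed
  have "\<exists>f. colouring.typed_hom g M \<tau> (E' (comp v)) r (comp v) f" if v: "v \<in> V" for v
  proof (rule colouring.typed_hom_connected[OF col])
    show "(a, b) \<in> {(x, y). E' (comp v) x y}\<^sup>*" if ab: "a \<in> comp v" "b \<in> comp v" for a b
    proof (rule closed[OF _ ab(1)])
      have "(v, a) \<in> R\<^sup>*" "(v, b) \<in> R\<^sup>*" using ab unfolding comp_def by blast+
      then show "(a, b) \<in> R\<^sup>*" using symD[OF symR] rtrancl_trans by metis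
    qed
    show "comp v \<noteq> {}" using v by (auto simp: comp_def)
  qed
  then have "\<forall>C\<in>comp ` V. \<exists>f. colouring.typed_hom g M \<tau> (E' C) r C f" by blast
  then obtain F where F: "\<And>v. v \<in> V \<Longrightarrow> colouring.typed_hom g M \<tau> (E' (comp v)) r (comp v) (F (comp v))"
    by (metis imageI)
  have hom: "F (comp v) ` comp v \<subseteq> {..M} \<times> {..<g}"
    "\<And>a b. a \<in> comp v \<Longrightarrow> b \<in> comp v \<Longrightarrow> E a b \<Longrightarrow>
      fst (F (comp v) a) \<noteq> fst (F (comp v) b) \<and> conn \<tau> (F (comp v) a) (F (comp v) b) = r a b"
    if v: "v \<in> V" for v
  proof -
    note d = colouring.typed_hom_def[OF col]
    show "F (comp v) ` comp v \<subseteq> {..M} \<times> {..<g}" using F[OF v] unfolding d by blast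
    show "fst (F (comp v) a) \<noteq> fst (F (comp v) b) \<and> conn \<tau> (F (comp v) a) (F (comp v) b) = r a b"
      if "a \<in> comp v" "b \<in> comp v" "E a b" for a b
      using F[OF v] that unfolding d E'_def by blast
  qed
  have self: "v \<in> comp v" if "v \<in> V" for v using that by (simp add: comp_def)
  define f where "f v = F (comp v) v" for v
  have "f ` V \<subseteq> {..M} \<times> {..<g}" using hom(1) self unfolding f_def by blast
  moreover have "fst (f u) \<noteq> fst (f v) \<and> conn \<tau> (f u) (f v) = r u v" if "E u v" for u v
  proof -
    have V: "u \<in> V" "v \<in> V" using E_V[OF that] by auto
    have "comp u = comp v" using that by (intro comp_eq) (auto simp: R_def)
    then show ?thesis using hom(2)[OF V(1) self[OF V(1)] _ that] self[OF V(2)] by (simp add: f_def)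
  qed
  ultimately show ?thesis by blast
qed

text \<open>Targets have natural numbers as vertices; signs are below 2, so base and sign can be
  recovered from the code.\<close>

definition target_code :: "nat \<times> nat \<Rightarrow> nat" where
  "target_code a = 2 * fst a + snd a"

text \<open>Each pair of vertices occurs in both orders. If \<open>rv\<close> is
  \<open>reverse_type m\<close>, both orders describe the same connection, so no parallel
  connections arise.\<close>

definition target_graph :: "nat \<Rightarrow> nat mixed_graph" where
  "target_graph m = (target_code ` ({..M} \<times> {..<g}),
     {connection_of m (target_code a) (target_code b) (conn \<tau> a b) | a b.
       a \<in> {..M} \<times> {..<g} \<and> b \<in> {..M} \<times> {..<g} \<and> fst a \<noteq> fst b})"

lemma inj_target_code: "inj_on target_code ({..M} \<times> {..<g})"
proof (rule inj_onI)
  fix a b assume ab: "a \<in> {..M} \<times> {..<g}" "b \<in> {..M} \<times> {..<g}" "target_code a = target_code b"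
  obtain x s y t where e: "a = (x, s)" "b = (y, t)" by (cases a, cases b)
  then have "s < 2" "t < 2" "2 * x + s = 2 * y + t" using ab g by (auto simp: target_code_def)
  then have "x = y \<and> s = t" by presburger
  then show "a = b" using e by simp
qed

lemma conn_less:
  assumes "a \<in> {..M} \<times> {..<g}" "b \<in> {..M} \<times> {..<g}" "fst a \<noteq> fst b"
  shows "conn \<tau> a b < p"
  unfolding conn_def using assms by (intro act_less' \<tau>_less) auto

lemma conn_rev:
  assumes "a \<in> {..M} \<times> {..<g}" "b \<in> {..M} \<times> {..<g}" "fst a \<noteq> fst b"
  shows "conn \<tau> b a = rv (conn \<tau> a b)"
proof -
  have s: "snd a < g" "snd b < g" and t: "\<tau> (fst a) (fst b) < p"
    using assms by (auto intro!: \<tau>_less)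
  have "\<tau> (fst b) (fst a) = rv (\<tau> (fst a) (fst b))" using assms by (intro \<tau>_rev) auto
  then have "conn \<tau> b a = rv (act (snd b) (act (snd a) (\<tau> (fst a) (fst b))))"
    using s t act_rv act_less' by (simp add: conn_def)
  then show ?thesis using act_commute[OF s t] by (simp add: conn_def)
qed

lemma card_target_graph: "card (fst (target_graph m)) = Suc M * g"
  by (simp add: target_graph_def card_image[OF inj_target_code] card_cartesian_product)

lemma mixed_target_graph:
  assumes "p = 2 * m + n" "rv = reverse_type m"
  shows "mixed_graph m n (target_graph m)"
  unfolding mixed_graph_def
proof (intro conjI ballI)
  let ?T = "{..M} \<times> {..<g}"
  have T: "finite ?T" by simp
  have E: "\<exists>a b. c = connection_of m (target_code a) (target_code b) (conn \<tau> a b) \<and> a \<in> ?T \<and> b \<in> ?T \<and>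
      fst a \<noteq> fst b" if "c \<in> snd (target_graph m)" for c
    using that by (auto simp: target_graph_def)
  show "admissible_colour m n c" if "c \<in> snd (target_graph m)" for c
    using E[OF that] conn_less assms(1) admissible_connection_of by metis
  show "inj_on ends (snd (target_graph m))"
  proof (rule inj_onI)
    fix c d assume cd: "c \<in> snd (target_graph m)" "d \<in> snd (target_graph m)" "ends c = ends d"
    obtain a b where c: "c = connection_of m (target_code a) (target_code b) (conn \<tau> a b)"
      and ab: "a \<in> ?T" "b \<in> ?T" "fst a \<noteq> fst b" using E[OF cd(1)] by blast
    obtain a' b' where d: "d = connection_of m (target_code a') (target_code b') (conn \<tau> a' b')"
      and ab': "a' \<in> ?T" "b' \<in> ?T" "fst a' \<noteq> fst b'" using E[OF cd(2)] by blast
    have "{target_code a, target_code b} = {target_code a', target_code b'}"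
      using cd(3) by (simp add: c d ends_connection_of)
    then have "a = a' \<and> b = b' \<or> a = b' \<and> b = a'"
      unfolding doubleton_eq_iff using inj_onD[OF inj_target_code] ab ab' by blast
    then show "c = d"
    proof
      assume sw: "a = b' \<and> b = a'"
      then have "conn \<tau> a' b' = reverse_type m (conn \<tau> a b)" using conn_rev[OF ab] assms(2) by simp
      then show ?thesis using sw by (simp add: c d connection_of_reverse)
    qed (simp add: c d)
  qed
  show "simple_graph (underlying (target_graph m))"
    unfolding simple_graph_def
  proof (intro conjI ballI)
    show "finite (fst (underlying (target_graph m)))"
      using T by (simp add: underlying_def target_graph_def)
    fix e assume "e \<in> snd (underlying (target_graph m))"
    then obtain c where "c \<in> snd (target_graph m)" "e = ends c" by (auto simp: underlying_def)
    then obtain a b where ab: "e = {target_code a, target_code b}" "a \<in> ?T" "b \<in> ?T" "fst a \<noteq> fst b"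
      using E ends_connection_of by metis
    then have "target_code a \<noteq> target_code b" using inj_onD[OF inj_target_code] by blast
    then show "e \<subseteq> fst (underlying (target_graph m))" "card e = 2"
      using ab by (auto simp: underlying_def target_graph_def)
  qed
qed

lemma colored_hom_target_graph:
  fixes G :: "'a mixed_graph"
  assumes p: "p = 2 * m + n" and rv: "rv = reverse_type m" and G: "mixed_graph m n G"
    and deg: "max_degree (underlying G) \<le> Suc k"
  shows "\<exists>f. colored_hom f G (target_graph m)"
proof -
  have simple: "simple_graph (underlying G)" and inj: "inj_on ends (snd G)" using G by (auto simp: mixed_graph_def)
  have fin: "finite (fst G)" by (rule mixed_graph_finite[OF G])
  define E where "E u v \<longleftrightarrow> (\<exists>c<p. connection_of m u v c \<in> snd G)" for u v
  define r where "r u v = (THE c. c < p \<and> connection_of m u v c \<in> snd G)" for u v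
  have edge: "{u, v} \<in> snd (underlying G)" if "connection_of m u v c \<in> snd G" for u v c
  proof -
    have "ends (connection_of m u v c) \<in> ends ` snd G" using that by blast
    then show ?thesis by (simp add: ends_connection_of underlying_def)
  qed
  have ne: "u \<noteq> v" "u \<in> fst G" "v \<in> fst G" if "connection_of m u v c \<in> snd G" for u v c
  proof -
    have "{u, v} \<in> snd (underlying G)" by (rule edge[OF that])
    then have "card {u, v} = 2" "{u, v} \<subseteq> fst G"
      using simple by (auto simp: simple_graph_def underlying_def)
    then show "u \<noteq> v" "u \<in> fst G" "v \<in> fst G" by auto
  qed
  have uq: "c = d" if "connection_of m u v c \<in> snd G" "connection_of m u v d \<in> snd G" for u v c d
    using inj_onD[OF inj _ that] connection_of_inj[OF _ ne(1)[OF that(1)]] by (simp add: ends_connection_of)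
  have r: "r u v = c" if "connection_of m u v c \<in> snd G" "c < p" for u v c
    unfolding r_def by (rule the_equality) (use that uq in blast)+
  have "colouring k p g M rv \<tau> (fst G) E r"
  proof
    show "finite (fst G)" by (rule fin)
    fix u v assume "E u v"
    then obtain c where c: "c < p" "connection_of m u v c \<in> snd G" by (auto simp: E_def)
    have c': "reverse_type m c < p" "connection_of m v u (reverse_type m c) \<in> snd G"
      using c reverse_type_less p connection_of_reverse by metis+
    show "u \<in> fst G \<and> v \<in> fst G \<and> u \<noteq> v" using ne[OF c(2)] by blast
    show "E v u" using c' by (auto simp: E_def)
    show "r u v < p" using r[OF c(2,1)] c(1) by simp
    show "r v u = rv (r u v)" using r[OF c(2,1)] r[OF c'(2,1)] rv by simp
  next
    fix v assume v: "v \<in> fst G"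
    let ?N = "{e \<in> snd (underlying G). v \<in> e}"
    have finN: "finite ?N"
      by (rule finite_subset[of _ "Pow (fst G)"])
        (use simple fin in \<open>auto simp: simple_graph_def underlying_def\<close>)
    have "(\<lambda>w. {v, w}) ` {w. E v w} \<subseteq> ?N"
    proof (rule image_subsetI)
      fix w assume "w \<in> {w. E v w}"
      then obtain c where "connection_of m v w c \<in> snd G" unfolding E_def by blast
      then show "{v, w} \<in> ?N" using edge by simp
    qed
    then have "card ((\<lambda>w. {v, w}) ` {w. E v w}) \<le> card ?N" by (rule card_mono[OF finN])
    moreover have "inj_on (\<lambda>w. {v, w}) {w. E v w}" by (auto simp: inj_on_def doubleton_eq_iff)
    ultimately have "card {w. E v w} \<le> degree (underlying G) v" by (simp add: card_image degree_def)
    also have "\<dots> \<le> max_degree (underlying G)"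
      unfolding max_degree_def using fin v by (intro Max_ge) (auto simp: underlying_def)
    finally show "card {w. E v w} \<le> Suc k" using deg by simp
  qed
  from typed_hom_components[OF this] obtain f where f: "f ` fst G \<subseteq> {..M} \<times> {..<g}"
    "\<And>u v. E u v \<Longrightarrow> fst (f u) \<noteq> fst (f v) \<and> conn \<tau> (f u) (f v) = r u v" by blast
  have key: "connection_of m (target_code (f u)) (target_code (f v)) c \<in> snd (target_graph m)"
    if "connection_of m u v c \<in> snd G" "c < p" for u v c
  proof -
    have "E u v" using that by (auto simp: E_def)
    moreover have "f u \<in> {..M} \<times> {..<g}" "f v \<in> {..M} \<times> {..<g}" using ne[OF that(1)] f(1) by blast+
    ultimately show ?thesis using f(2)[of u v] r[OF that] by (force simp: target_graph_def)
  qed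
  have "colored_hom (target_code \<circ> f) G (target_graph m)"
    unfolding colored_hom_def
  proof (intro conjI allI impI)
    show "(target_code \<circ> f) ` fst G \<subseteq> fst (target_graph m)" using f(1) by (auto simp: target_graph_def)
    show "Arc ((target_code \<circ> f) u) ((target_code \<circ> f) v) i \<in> snd (target_graph m)"
      if "Arc u v i \<in> snd G" for u v i
    proof -
      have "i < m" using G that by (auto simp: mixed_graph_def)
      then show ?thesis using key[of u v "2 * i"] that p by (simp add: connection_of_def)
    qed
    show "Edge ((target_code \<circ> f) ` e) j \<in> snd (target_graph m)" if "Edge e j \<in> snd G" for e j
    proof -
      have "j < n" using G that by (auto simp: mixed_graph_def)
      moreover have "card e = 2" using mixed_graph_card_ends[OF G that] by simp
      then obtain u v where "e = {u, v}" by (auto simp: card_2_iff)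
      ultimately show ?thesis using key[of u v "2 * m + j"] that p by (simp add: connection_of_def)
    qed
  qed
  then show ?thesis by blast
qed

lemma chi_family_le:
  assumes "p = 2 * m + n" "rv = reverse_type m"
  shows "chi_family m n (graphs_max_degree (Suc k)) \<le> enat (Suc M * g)"
  unfolding chi_family_def
proof (rule SUP_least)
  fix G assume G: "G \<in> graphs_max_degree (Suc k)"
  have "chi_graph m n G \<le> Suc M * g"
  proof (rule chi_graph_le)
    show "simple_graph G" "0 < 2 * m + n" using G p2 assms by (auto simp: graphs_max_degree_def)
    fix G' assume G': "mixed_graph m n G'" "underlying G' = G"
    then obtain f where "colored_hom f G' (target_graph m)"
      using colored_hom_target_graph[OF assms G'(1)] G by (auto simp: graphs_max_degree_def)
    then show "chi_mixed m n G' \<le> Suc M * g"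
      using chi_mixed_witness(1)[OF mixed_target_graph[OF assms]] card_target_graph by metis
  qed
  then show "enat (chi_graph m n G) \<le> enat (Suc M * g)" by simp
qed

end

subsection \<open>Numerical estimates\<close>

lemma binomial_le_pow_fact: "real (n choose j) \<le> real n ^ j / fact j"
proof -
  have "real ((n choose j) * fact j) \<le> real (n ^ j)" by (intro of_nat_mono binomial_fact_pow)
  then show ?thesis by (simp add: field_simps)
qed

lemma one_minus_power_le_exp:
  assumes "x \<le> 1"
  shows "(1 - x) ^ N \<le> exp (- x * real N)"
proof -
  have "1 - x \<le> exp (- x)" using exp_ge_add_one_self[of "- x"] by simp
  then have "(1 - x) ^ N \<le> exp (- x) ^ N" using assms by (intro power_mono) auto
  then show ?thesis by (simp add: exp_of_nat_mult[symmetric] mult.commute)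
qed

text \<open>Needed for \<open>k = 4\<close>, where the moment bound, even with the best
  \<open>t\<close>, would push the first term of \<open>antitwin_bound\<close> above 1.\<close>

lemma binomial_tail_le_pow:
  assumes "0 \<le> q" "q < 1" "r \<le> N"
  shows "binomial_tail N q r \<le> (1 - q) ^ N * (\<Sum>j\<le>r. (real N * q / (1 - q)) ^ j / fact j)"
  unfolding binomial_tail_def sum_distrib_left
proof (rule sum_mono)
  fix j assume "j \<in> {..r}"
  then have "(1 - q) ^ N = (1 - q) ^ j * (1 - q) ^ (N - j)"
    using assms(3) by (simp flip: power_add)
  then have e: "(1 - q) ^ N * ((real N * q / (1 - q)) ^ j / fact j) = real N ^ j / fact j * (q ^ j * (1 - q) ^ (N - j))"
    using assms(2) by (simp add: power_divide power_mult_distrib)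
  have "real (N choose j) * (q ^ j * (1 - q) ^ (N - j)) \<le> real N ^ j / fact j * (q ^ j * (1 - q) ^ (N - j))"
    using assms by (intro mult_right_mono binomial_le_pow_fact) auto
  then show "real (N choose j) * q ^ j * (1 - q) ^ (N - j) \<le> (1 - q) ^ N * ((real N * q / (1 - q)) ^ j / fact j)"
    unfolding e by (simp only: mult.assoc)
qed

lemma binomial_tail_nonneg: "0 \<le> q \<Longrightarrow> q \<le> 1 \<Longrightarrow> 0 \<le> binomial_tail N q r"
  unfolding binomial_tail_def by (intro sum_nonneg mult_nonneg_nonneg) auto

lemma power_fact_decay:
  assumes "0 \<le> (x :: real)" "x \<le> 6" "6 \<le> k"
  shows "x ^ k / fact k \<le> x ^ 6 / 720"
  using assms(3)
proof (induction k rule: dec_induct)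
  case base
  then show ?case by (simp add: fact_numeral)
next
  case (step k)
  have "x ^ Suc k / fact (Suc k) = (x / real (Suc k)) * (x ^ k / fact k)" by (simp add: field_simps)
  also have "\<dots> \<le> 1 * (x ^ k / fact k)"
    using assms step by (intro mult_right_mono) (auto simp: divide_le_eq)
  finally have "x ^ Suc k / fact (Suc k) \<le> x ^ k / fact k" by simp
  then show ?case using step(3) by linarith
qed

text \<open>From \<open>k = 6\<close> on, passing to \<open>Suc k\<close> multiplies
  \<open>real k ^ a\<close> by at most \<open>(7 / 6) ^ a\<close>, so the product does not
  increase.\<close>

lemma power_geometric_decay:
  assumes "6 \<le> k" "0 \<le> c" "(7 / 6) ^ a * c \<le> 1"
  shows "real k ^ a * c ^ k \<le> 6 ^ a * c ^ 6"
  using assms(1)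
proof (induction k rule: dec_induct)
  case (step k)
  have "real (Suc k) \<le> 7 / 6 * real k" using step by simp
  then have "real (Suc k) ^ a \<le> (7 / 6 * real k) ^ a" by (intro power_mono) auto
  then have "real (Suc k) ^ a * c ^ Suc k \<le> (7 / 6 * real k) ^ a * c ^ Suc k"
    using assms by (intro mult_right_mono) auto
  also have "\<dots> = ((7 / 6) ^ a * c) * (real k ^ a * c ^ k)"
    unfolding power_mult_distrib power_Suc by (simp only: ac_simps)
  also have "\<dots> \<le> 1 * (real k ^ a * c ^ k)" using assms by (intro mult_right_mono) auto
  finally show ?case using step by simp
qed simp

lemma exp_neg_le:
  assumes "0 \<le> (x :: real)"
  shows "exp (- (real n * x)) \<le> (1 / (1 + x + x ^ 2 / 2)) ^ n"
proof -
  have pos: "0 < 1 + x + x ^ 2 / 2" using assms by (intro add_pos_nonneg) auto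
  have "1 / exp x \<le> 1 / (1 + x + x ^ 2 / 2)"
    using exp_lower_Taylor_quadratic[OF assms] pos by (intro divide_left_mono) auto
  then have "exp (- x) \<le> 1 / (1 + x + x ^ 2 / 2)" by (simp add: exp_minus field_simps)
  then have "exp (- x) ^ n \<le> (1 / (1 + x + x ^ 2 / 2)) ^ n" by (intro power_mono) auto
  then show ?thesis by (simp add: exp_of_nat_mult[symmetric] mult_ac)
qed

section \<open>The antitwin bound for \<open>k = 4\<close> and \<open>k = 5\<close>\<close>

context random_types
begin

lemma antitwin_bound_4:
  assumes "M = 256"
  shows "antitwin_bound 4 < 1"
proof -
  \<comment> \<open>High powers are taken in blocks with a rounded base, here
    \<open>252 = 6 * 42\<close>, to keep the numerals short.\<close>
  have a: "(7 / 8 :: real) ^ 252 \<le> 25 / 10 ^ 16"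
  proof -
    have "(7 / 8 :: real) ^ 6 \<le> 449 / 1000" by (simp add: power_divide)
    then have "((7 / 8 :: real) ^ 6) ^ 42 \<le> (449 / 1000) ^ 42" by (intro power_mono) auto
    also have "\<dots> \<le> 25 / 10 ^ 16" by (simp add: power_divide)
    finally show ?thesis by (simp flip: power_mult)
  qed
  \<comment> \<open>The base is \<open>107 / 128 = 1 - 21 / 16 * (1 / 8)\<close>, and the exponent
    \<open>249 = 3 * 83\<close> is 256 less \<open>2 * 4 - 1\<close>.\<close>
  have w4: "weight 4 (21 / 16) \<le> 48 / 10 ^ 21"
  proof -
    have "(107 / 128 :: real) ^ 3 \<le> 585 / 1000" by (simp add: power_divide)
    then have "((107 / 128 :: real) ^ 3) ^ 83 \<le> (585 / 1000) ^ 83" by (intro power_mono) auto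
    also have "\<dots> \<le> 48 / 10 ^ 21" by (simp add: power_divide)
    finally have "(107 / 128 :: real) ^ 249 \<le> 48 / 10 ^ 21" by (simp flip: power_mult)
    then show ?thesis unfolding weight_def unfolding assms by (simp add: power3_eq_cube)
  qed
  have w2: "weight 4 (9 / 8) \<le> 43 / 10 ^ 18"
  proof -
    have "(55 / 64 :: real) ^ 3 \<le> 635 / 1000" by (simp add: power_divide)
    then have "((55 / 64 :: real) ^ 3) ^ 83 \<le> (635 / 1000) ^ 83" by (intro power_mono) auto
    also have "\<dots> \<le> 43 / 10 ^ 18" by (simp add: power_divide)
    finally have "(55 / 64 :: real) ^ 249 \<le> 43 / 10 ^ 18" by (simp flip: power_mult)
    then show ?thesis unfolding weight_def unfolding assms by (simp add: power3_eq_cube)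
  qed
  have w1: "weight 4 (3 / 4) \<le> 25 / 10 ^ 12"
  proof -
    have "(29 / 32 :: real) ^ 3 \<le> 745 / 1000" by (simp add: power_divide)
    then have "((29 / 32 :: real) ^ 3) ^ 83 \<le> (745 / 1000) ^ 83" by (intro power_mono) auto
    also have "\<dots> \<le> 25 / 10 ^ 12" by (simp add: power_divide)
    finally have "(29 / 32 :: real) ^ 249 \<le> 25 / 10 ^ 12" by (simp flip: power_mult)
    then show ?thesis unfolding weight_def unfolding assms by (simp add: power3_eq_cube)
  qed
  have t1: "binomial_tail 252 (1 / 8) 4 \<le> 25 / 10 ^ 16 * 78445"
  proof -
    have "binomial_tail 252 (1 / 8) 4 \<le> (7 / 8) ^ 252 * (\<Sum>j\<le>4. 36 ^ j / fact j)"
      using binomial_tail_le_pow[of "1 / 8" 4 252] by simp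
    also have "(\<Sum>j\<le>4. 36 ^ j / fact j) = (78445 :: real)"
      by (simp add: numeral_eq_Suc fact_numeral)
    also have "(7 / 8) ^ 252 * 78445 \<le> 25 / 10 ^ 16 * (78445 :: real)" using a by (rule mult_right_mono) simp
    finally show ?thesis .
  qed
  have t2: "binomial_tail 253 (1 / 8) 5 \<le> 22 / 10 ^ 16 * 600000"
  proof -
    have "binomial_tail 253 (1 / 8) 5 \<le> (7 / 8) ^ 253 * (\<Sum>j\<le>5. (253 / 7) ^ j / fact j)"
      using binomial_tail_le_pow[of "1 / 8" 5 253] by simp
    also have "(7 / 8 :: real) ^ 253 = 7 / 8 * (7 / 8) ^ 252" by (simp flip: power_Suc)
    also have "7 / 8 * (7 / 8) ^ 252 * (\<Sum>j\<le>5. (253 / 7) ^ j / fact j) \<le> 22 / 10 ^ 16 * (600000 :: real)"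
    proof (rule mult_mono)
      show "(\<Sum>j\<le>5. (253 / 7) ^ j / fact j) \<le> (600000 :: real)"
        by (simp add: numeral_eq_Suc fact_numeral)
    qed (use a in \<open>auto intro!: sum_nonneg\<close>)
    finally show ?thesis .
  qed
  have c4: "real (M choose 4) \<le> 178956971" and c3: "real (M choose 3) \<le> 2796203"
    using binomial_le_pow_fact[of M 4] binomial_le_pow_fact[of M 3] assms by (simp_all add: fact_numeral)
  have wn: "0 \<le> weight 4 (21 / 16)" "0 \<le> weight 4 (9 / 8)" "0 \<le> weight 4 (3 / 4)"
    by (simp_all add: weight_def power3_eq_cube)
  \<comment> \<open>The right-hand side is about 0.83, most of it from the first summand.\<close>
  have "antitwin_bound 4 \<le>
      178956971 * 2 ^ 4 * (25 / 10 ^ 16 * 78445)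
    + 2796203 * 2 ^ 3 * (22 / 10 ^ 16 * 600000)
    + 32 * (178956971 * 2 ^ 4 * 2 ^ 3 * (2796203 * (48 / 10 ^ 21) + 4 * (43 / 10 ^ 18)))
    + 32 * (2796203 * 2 ^ 3 * 2 ^ 3 * (2796203 * (48 / 10 ^ 21) + 768 * (43 / 10 ^ 18) + 25 / 10 ^ 12))"
  proof -
    have e: "(1 / 2 :: real) ^ (4 - 1) = 1 / 8" "(1 / 2 :: real) ^ 3 = 1 / 8" "4 - 1 = (3 :: nat)" "4 + 1 = (5 :: nat)"
      "M - 4 = 252" "M - (4 - 1) = 253" "M - 3 = 253" "real ((4 - 1) * M) = 768" "real (3 * M) = 768" "real 4 = 4"
      using assms by (simp_all add: power3_eq_cube)
    show ?thesis
      unfolding antitwin_bound_def e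
      by (intro add_mono mult_mono c4 c3 t1 t2 w4 w2 w1 order.refl mult_nonneg_nonneg add_nonneg_nonneg wn
          binomial_tail_nonneg) simp_all
  qed
  also have "\<dots> < 1" by simp
  finally show ?thesis .
qed

lemma antitwin_bound_5:
  assumes "M = 800"
  shows "antitwin_bound 5 < 1"
proof -
  \<comment> \<open>\<open>151 / 160 = 1 - (1 - t) / 16\<close> for the choice
    \<open>t = 1 / 10\<close> in the moment bound.\<close>
  have a: "(151 / 160 :: real) ^ 795 \<le> 11 / 10 ^ 21"
  proof -
    have "(151 / 160 :: real) ^ 15 \<le> 420 / 1000" by (simp add: power_divide)
    then have "((151 / 160 :: real) ^ 15) ^ 53 \<le> (420 / 1000) ^ 53" by (intro power_mono) auto
    also have "\<dots> \<le> 11 / 10 ^ 21" by (simp add: power_divide)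
    finally show ?thesis by (simp flip: power_mult)
  qed
  have dec: "x ^ 791 \<le> x ^ 790" if "0 \<le> x" "x \<le> 1" for x :: real
    using that by (intro power_decreasing) auto
  have w4: "weight 5 (21 / 16) \<le> 1 / 10 ^ 29"
  proof -
    have "(235 / 256 :: real) ^ 10 \<le> 425 / 1000" by (simp add: power_divide)
    then have "((235 / 256 :: real) ^ 10) ^ 79 \<le> (425 / 1000) ^ 79" by (intro power_mono) auto
    also have "\<dots> \<le> 1 / 10 ^ 29" by (simp add: power_divide)
    finally have "(235 / 256 :: real) ^ 790 \<le> 1 / 10 ^ 29" by (simp flip: power_mult)
    then have "(235 / 256 :: real) ^ 791 \<le> 1 / 10 ^ 29" by (rule order.trans[OF dec, rotated 2]) auto
    then show ?thesis unfolding weight_def unfolding assms by (simp add: power4_eq_xxxx)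
  qed
  have w2: "weight 5 (9 / 8) \<le> 1 / 10 ^ 24"
  proof -
    have "(119 / 128 :: real) ^ 10 \<le> 483 / 1000" by (simp add: power_divide)
    then have "((119 / 128 :: real) ^ 10) ^ 79 \<le> (483 / 1000) ^ 79" by (intro power_mono) auto
    also have "\<dots> \<le> 1 / 10 ^ 24" by (simp add: power_divide)
    finally have "(119 / 128 :: real) ^ 790 \<le> 1 / 10 ^ 24" by (simp flip: power_mult)
    then have "(119 / 128 :: real) ^ 791 \<le> 1 / 10 ^ 24" by (rule order.trans[OF dec, rotated 2]) auto
    then show ?thesis unfolding weight_def unfolding assms by (simp add: power4_eq_xxxx)
  qed
  have w1: "weight 5 (3 / 4) \<le> 1 / 10 ^ 16"
  proof -
    have "(61 / 64 :: real) ^ 10 \<le> 619 / 1000" by (simp add: power_divide)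
    then have "((61 / 64 :: real) ^ 10) ^ 79 \<le> (619 / 1000) ^ 79" by (intro power_mono) auto
    also have "\<dots> \<le> 1 / 10 ^ 16" by (simp add: power_divide)
    finally have "(61 / 64 :: real) ^ 790 \<le> 1 / 10 ^ 16" by (simp flip: power_mult)
    then have "(61 / 64 :: real) ^ 791 \<le> 1 / 10 ^ 16" by (rule order.trans[OF dec, rotated 2]) auto
    then show ?thesis unfolding weight_def unfolding assms by (simp add: power4_eq_xxxx)
  qed
  have t1: "binomial_tail 795 (1 / 16) 5 \<le> 10 ^ 5 * (11 / 10 ^ 21)"
    using binomial_tail_le[of "1 / 10" "1 / 16" 795 5] a by simp
  have t2: "binomial_tail 796 (1 / 16) 6 \<le> 10 ^ 6 * (11 / 10 ^ 21)"
  proof -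
    have "(151 / 160 :: real) ^ 796 \<le> (151 / 160) ^ 795" by (intro power_decreasing) auto
    then have "(151 / 160 :: real) ^ 796 \<le> 11 / 10 ^ 21" using a by (rule order.trans)
    then have "10 ^ 6 * (151 / 160 :: real) ^ 796 \<le> 10 ^ 6 * (11 / 10 ^ 21)" by (rule mult_left_mono) simp
    moreover have "binomial_tail 796 (1 / 16) 6 \<le> 10 ^ 6 * (151 / 160) ^ 796"
      using binomial_tail_le[of "1 / 10" "1 / 16" 796 6] by simp
    ultimately show ?thesis by (rule order.trans[rotated])
  qed
  have c5: "real (M choose 5) \<le> 2730666666667" and c4: "real (M choose 4) \<le> 17066666667"
    using binomial_le_pow_fact[of M 5] binomial_le_pow_fact[of M 4] assms by (simp_all add: fact_numeral)
  have wn: "0 \<le> weight 5 (21 / 16)" "0 \<le> weight 5 (9 / 8)" "0 \<le> weight 5 (3 / 4)"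
    by (simp_all add: weight_def power4_eq_xxxx)
  have "antitwin_bound 5 \<le>
      2730666666667 * 2 ^ 5 * (10 ^ 5 * (11 / 10 ^ 21))
    + 17066666667 * 2 ^ 4 * (10 ^ 6 * (11 / 10 ^ 21))
    + 32 * (2730666666667 * 2 ^ 5 * 2 ^ 4 * (17066666667 * (1 / 10 ^ 29) + 5 * (1 / 10 ^ 24)))
    + 32 * (17066666667 * 2 ^ 4 * 2 ^ 4 * (17066666667 * (1 / 10 ^ 29) + 3200 * (1 / 10 ^ 24) + 1 / 10 ^ 16))"
  proof -
    have e: "(1 / 2 :: real) ^ (5 - 1) = 1 / 16" "(1 / 2 :: real) ^ 4 = 1 / 16" "5 - 1 = (4 :: nat)" "5 + 1 = (6 :: nat)"
      "M - 5 = 795" "M - (5 - 1) = 796" "M - 4 = 796" "real ((5 - 1) * M) = 3200" "real (4 * M) = 3200" "real 5 = 5"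
      using assms by (simp_all add: power4_eq_xxxx)
    show ?thesis
      unfolding antitwin_bound_def e
      by (intro add_mono mult_mono c5 c4 t1 t2 w4 w2 w1 order.refl mult_nonneg_nonneg add_nonneg_nonneg wn
          binomial_tail_nonneg) simp_all
  qed
  also have "\<dots> < 1" by simp
  finally show ?thesis .
qed

end

lemma mono_geometric_decay:
  assumes "6 \<le> k" "0 \<le> c" "c \<le> C" "(7 / 6) ^ a * C \<le> 1"
  shows "real k ^ a * c ^ k \<le> 6 ^ a * C ^ 6"
proof -
  have "(7 / 6) ^ a * c \<le> (7 / 6) ^ a * C" using assms by (intro mult_left_mono) auto
  then have "(7 / 6) ^ a * c \<le> 1" using assms(4) by linarith
  with assms(1,2) have "real k ^ a * c ^ k \<le> 6 ^ a * c ^ 6" by (rule power_geometric_decay)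
  also have "\<dots> \<le> 6 ^ a * C ^ 6" using assms by (intro mult_left_mono power_mono) auto
  finally show ?thesis .
qed

lemma exp_neg_bounds:
  "2 * exp (- 2 :: real) \<le> 2711 / 10000" "4 * exp (- (21 / 8) :: real) \<le> 2911 / 10000"
  "2 * exp (- (9 / 4) :: real) \<le> 2128 / 10000" "2 * exp (- (3 / 2) :: real) \<le> 4475 / 10000"
proof -
  \<comment> \<open>\<open>545 / 512\<close> is the quadratic Taylor sum of the exponential function
    at \<open>1 / 16\<close>.\<close>
  have e: "exp (- (real n / 16)) \<le> (512 / 545) ^ n" for n
    using exp_neg_le[of "1 / 16" n] by (simp add: power2_eq_square)
  have "(512 / 545 :: real) ^ 32 \<le> 13555 / 100000" "(512 / 545 :: real) ^ 42 \<le> 72775 / 1000000"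
    "(512 / 545 :: real) ^ 36 \<le> 1064 / 10000" "(512 / 545 :: real) ^ 24 \<le> 22375 / 100000"
    by (simp_all add: power_divide)
  then show "2 * exp (- 2 :: real) \<le> 2711 / 10000" "4 * exp (- (21 / 8) :: real) \<le> 2911 / 10000"
    "2 * exp (- (9 / 4) :: real) \<le> 2128 / 10000" "2 * exp (- (3 / 2) :: real) \<le> 4475 / 10000"
    using e[of 32] e[of 42] e[of 36] e[of 24] by simp_all
qed

lemma exp_times_power: "exp (- (c * real k)) = exp (- c) ^ k"
  by (simp add: exp_of_nat_mult[symmetric] mult.commute)

lemma linear_le_exponential: "6 \<le> k \<Longrightarrow> 32 * real k \<le> 3 * 2 ^ k"
  by (induction k rule: dec_induct) auto

section \<open>The antitwin bound for \<open>k \<ge> 6\<close>\<close>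

context random_types
begin

text \<open>Since \<open>q * real M = 2 * \<kappa> ^ 2\<close>, every exponential factor is a
  \<open>k\<close>-th power up to a constant. Each term is therefore at most a controlled multiple
  of some \<open>P ^ k / fact k\<close>, and the bases \<open>P\<close> are bounded by estimates at
  \<open>k = 6\<close>.\<close>

lemma antitwin_bound_ge_6:
  assumes k: "6 \<le> k" and M: "M = k\<^sup>2 * 2 ^ k"
  shows "antitwin_bound k < 1"
proof -
  define \<kappa> where "\<kappa> = real k"
  define A where "A = 2 * \<kappa>\<^sup>2 * 2 ^ k"
  define q where "q = (1 / 2 :: real) ^ (k - 1)"
  define F where "F = (fact k :: real)"
  \<comment> \<open>The ratio of the bounds for the numbers of configurations on
    \<open>k - 1\<close> and on \<open>k\<close> bases.\<close>
  define \<epsilon> where "\<epsilon> = \<kappa> / A"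
  have \<kappa>: "6 \<le> \<kappa>" using k by (simp add: \<kappa>_def)
  have MA: "2 * real M = A" by (simp add: M A_def \<kappa>_def)
  have Apos: "0 < A" using \<kappa> by (simp add: A_def)
  have two_k: "2 ^ k * q = (2 :: real)"
  proof -
    have "(2 :: real) ^ k = 2 * 2 ^ (k - 1)" using k by (cases k) auto
    then show ?thesis by (simp add: q_def power_divide)
  qed
  have powr: "32 * \<kappa> \<le> 3 * 2 ^ k" unfolding \<kappa>_def by (rule linear_le_exponential[OF k])
  have pow64: "(64 :: real) \<le> 2 ^ k" using power_increasing[OF k, of "2 :: real"] by simp
  have q: "0 < q" "q \<le> 1 / 32"
  proof -
    show "0 < q" by (simp add: q_def)
    then have "64 * q \<le> 2 ^ k * q" using pow64 by (intro mult_right_mono) auto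
    then show "q \<le> 1 / 32" using two_k by simp
  qed
  \<comment> \<open>Limits the loss in the exponents caused by the bases left out; the inequality
    used has equality at \<open>k = 6\<close>.\<close>
  have q\<kappa>: "q * \<kappa> \<le> 3 / 16"
  proof -
    have "32 * \<kappa> * q \<le> 3 * 2 ^ k * q" using powr q by (intro mult_right_mono) auto
    also have "\<dots> = 6" using two_k by (simp only: mult.assoc)
    finally show ?thesis by (simp add: mult.commute)
  qed
  have qM: "q * real M = 2 * \<kappa>\<^sup>2"
  proof -
    have "q * real M = \<kappa>\<^sup>2 * (2 ^ k * q)" by (simp add: M \<kappa>_def)
    then show ?thesis using two_k by simp
  qed
  \<comment> \<open>\<open>63 / 128 = 3 / 8 * (21 / 16)\<close> is the largest loss that occurs, for
    the greatest rate.\<close>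
  have small: "exp x \<le> 2" if "0 \<le> x" "x \<le> 63 / 128" for x :: real
  proof -
    have "x\<^sup>2 \<le> (63 / 128)\<^sup>2" using that by (intro power_mono) auto
    then show ?thesis using exp_bound[of x] that by (simp add: power2_eq_square)
  qed
  have w: "weight k t \<le> 2 * exp (- (2 * t * \<kappa>)) ^ k" if t: "0 \<le> t" "t \<le> 21 / 16" for t
  proof -
    have "t * q \<le> 21 / 16 * (1 / 32)" using t q by (intro mult_mono) auto
    then have "weight k t \<le> exp (- (t * q) * real (M - (2 * k - 1)))"
      unfolding weight_def q_def[symmetric] by (intro one_minus_power_le_exp) auto
    also have "\<dots> \<le> exp (- (2 * t * \<kappa>) * \<kappa> + 3 / 8 * t)"
    proof -
      have "real M - 2 * \<kappa> \<le> real (M - (2 * k - 1))" unfolding \<kappa>_def using k by linarith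
      then have "(t * q) * (real M - 2 * \<kappa>) \<le> (t * q) * real (M - (2 * k - 1))"
        using t q by (intro mult_left_mono) auto
      moreover have "(t * q) * (real M - 2 * \<kappa>) = t * (q * real M) - 2 * t * (q * \<kappa>)"
        by (simp add: algebra_simps)
      moreover have "t * (q * real M) = 2 * t * \<kappa> * \<kappa>" unfolding qM by (simp add: power2_eq_square)
      moreover have "2 * t * (q * \<kappa>) \<le> 2 * t * (3 / 16)" using t q\<kappa> by (intro mult_left_mono) auto
      ultimately have "2 * t * \<kappa> * \<kappa> - 3 / 8 * t \<le> (t * q) * real (M - (2 * k - 1))" by linarith
      then show ?thesis by simp
    qed
    also have "\<dots> = exp (3 / 8 * t) * exp (- (2 * t * \<kappa>) * \<kappa>)" by (simp add: exp_add[symmetric])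
    also have "\<dots> \<le> 2 * exp (- (2 * t * \<kappa>) * \<kappa>)"
      using t by (intro mult_right_mono small) auto
    also have "exp (- (2 * t * \<kappa>) * \<kappa>) = exp (- (2 * t * \<kappa>)) ^ k"
      by (simp add: exp_of_nat_mult[symmetric] \<kappa>_def mult.commute)
    finally show ?thesis .
  qed
  have tail: "binomial_tail N q r \<le> (2 * \<kappa>) ^ r * (2 * exp (1 - 2 * \<kappa>) ^ k)"
    if N: "M - k \<le> N" for N r
  proof -
    \<comment> \<open>This parameter is the threshold, about \<open>\<kappa>\<close>, divided by the
      expected number \<open>2 * \<kappa> ^ 2\<close>, which nearly minimises the moment
      bound.\<close>
    have t: "0 < 1 / (2 * \<kappa>)" "1 / (2 * \<kappa>) \<le> 1" using \<kappa> by auto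
    have "binomial_tail N q r \<le> (1 / (1 / (2 * \<kappa>))) ^ r * (1 - (1 - 1 / (2 * \<kappa>)) * q) ^ N"
      using t q by (intro binomial_tail_le) auto
    also have "(1 - (1 - 1 / (2 * \<kappa>)) * q) ^ N \<le> exp (- ((1 - 1 / (2 * \<kappa>)) * q) * real N)"
      using t q by (intro one_minus_power_le_exp mult_le_one) auto
    also have "\<dots> \<le> exp ((1 - 2 * \<kappa>) * \<kappa> + 3 / 16)"
    proof -
      have "real M - \<kappa> \<le> real N" unfolding \<kappa>_def using N by linarith
      then have "((1 - 1 / (2 * \<kappa>)) * q) * (real M - \<kappa>) \<le> ((1 - 1 / (2 * \<kappa>)) * q) * real N"
        using t q by (intro mult_left_mono) auto
      moreover have "((1 - 1 / (2 * \<kappa>)) * q) * (real M - \<kappa>) = (1 - 1 / (2 * \<kappa>)) * (q * real M - q * \<kappa>)"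
        by (simp only: mult.assoc right_diff_distrib)
      moreover have "(1 - 1 / (2 * \<kappa>)) * (q * real M - q * \<kappa>) = (2 * \<kappa> - 1) * \<kappa> - q * \<kappa> + q / 2"
        unfolding qM using \<kappa> by (simp add: field_simps power2_eq_square)
      ultimately have "(2 * \<kappa> - 1) * \<kappa> - 3 / 16 \<le> ((1 - 1 / (2 * \<kappa>)) * q) * real N" using q q\<kappa> by linarith
      then have "- ((1 - 1 / (2 * \<kappa>)) * q) * real N \<le> - ((2 * \<kappa> - 1) * \<kappa>) + 3 / 16" by simp
      also have "- ((2 * \<kappa> - 1) * \<kappa>) = (1 - 2 * \<kappa>) * \<kappa>" by (simp add: algebra_simps)
      finally show ?thesis by simp
    qed
    also have "\<dots> = exp (3 / 16) * exp ((1 - 2 * \<kappa>) * \<kappa>)" by (simp add: exp_add[symmetric])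
    also have "\<dots> \<le> 2 * exp ((1 - 2 * \<kappa>) * \<kappa>)" by (intro mult_right_mono small) auto
    also have "exp ((1 - 2 * \<kappa>) * \<kappa>) = exp (1 - 2 * \<kappa>) ^ k"
      by (simp add: exp_of_nat_mult[symmetric] \<kappa>_def mult.commute)
    finally show ?thesis using \<kappa> by (simp add: mult_left_mono)
  qed
  \<comment> \<open>Each of these collects the factors with exponent \<open>k\<close>. The 2 in
    \<open>P2\<close> and \<open>P3\<close> absorbs the \<open>2 ^ (k - 1)\<close> choices of types
    on the second set and the constant 2 of the weight.\<close>
  define P1 where "P1 = A * (2 * \<kappa>) * exp (1 - 2 * \<kappa>)"
  define P2 where "P2 = 2 * A * exp (- (9 / 4 * \<kappa>))"
  define P3 where "P3 = 2 * A * exp (- (3 / 2 * \<kappa>))"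
  define P4 where "P4 = A\<^sup>2 * exp (- (21 / 8 * \<kappa>))"
  have Ppos: "0 \<le> P1" "0 \<le> P2" "0 \<le> P3" "0 \<le> P4" using Apos \<kappa> by (auto simp: P1_def P2_def P3_def P4_def)
  have P1: "P1 \<le> 11 / 10"
  proof -
    have "P1 = 4 * exp 1 * (\<kappa> ^ 3 * (2 * exp (- 2)) ^ k)"
      unfolding P1_def A_def power_mult_distrib exp_times_power[symmetric] \<kappa>_def
      by (simp add: exp_diff exp_minus power2_eq_square power3_eq_cube field_simps)
    also have "\<dots> \<le> 4 * 3 * (6 ^ 3 * (2711 / 10000) ^ 6)"
    proof (rule mult_mono)
      show "\<kappa> ^ 3 * (2 * exp (- 2)) ^ k \<le> 6 ^ 3 * (2711 / 10000) ^ 6"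
        unfolding \<kappa>_def by (rule mono_geometric_decay[OF k _ exp_neg_bounds(1)]) (simp_all add: power_divide)
    qed (use exp_le \<kappa> in auto)
    also have "\<dots> \<le> 11 / 10" by (simp add: power_divide)
    finally show ?thesis .
  qed
  have P2: "P2 \<le> 1 / 10"
  proof -
    have "P2 = 4 * (\<kappa> ^ 2 * (2 * exp (- (9 / 4))) ^ k)"
      unfolding P2_def A_def power_mult_distrib exp_times_power[symmetric] \<kappa>_def by simp
    also have "\<dots> \<le> 4 * (6 ^ 2 * (2128 / 10000) ^ 6)"
      unfolding \<kappa>_def
      by (rule mult_left_mono[OF mono_geometric_decay[OF k _ exp_neg_bounds(3)]]) (simp_all add: power_divide)
    also have "\<dots> \<le> 1 / 10" by (simp add: power_divide)
    finally show ?thesis .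
  qed
  have P3: "P3 \<le> 12 / 10"
  proof -
    have "P3 = 4 * (\<kappa> ^ 2 * (2 * exp (- (3 / 2))) ^ k)"
      unfolding P3_def A_def power_mult_distrib exp_times_power[symmetric] \<kappa>_def by simp
    also have "\<dots> \<le> 4 * (6 ^ 2 * (4475 / 10000) ^ 6)"
      unfolding \<kappa>_def
      by (rule mult_left_mono[OF mono_geometric_decay[OF k _ exp_neg_bounds(4)]]) (simp_all add: power_divide)
    also have "\<dots> \<le> 12 / 10" by (simp add: power_divide)
    finally show ?thesis .
  qed
  have P4: "P4 \<le> 32 / 10"
  proof -
    have "(4 :: real) ^ k = (2 ^ k)\<^sup>2" by (simp add: power2_eq_square flip: power_mult_distrib)
    then have "P4 = 4 * (\<kappa> ^ 4 * (4 * exp (- (21 / 8))) ^ k)"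
      unfolding P4_def A_def power_mult_distrib exp_times_power[symmetric] \<kappa>_def by simp
    also have "\<dots> \<le> 4 * (6 ^ 4 * (2911 / 10000) ^ 6)"
      unfolding \<kappa>_def
      by (rule mult_left_mono[OF mono_geometric_decay[OF k _ exp_neg_bounds(2)]]) (simp_all add: power_divide)
    also have "\<dots> \<le> 32 / 10" by (simp add: power_divide)
    finally show ?thesis .
  qed
  have F: "1 \<le> F" by (simp add: F_def)
  define Q where "Q = A ^ k / F"
  have Qpos: "0 \<le> Q" using Apos F by (simp add: Q_def)
  have \<epsilon>: "0 < \<epsilon>" "\<epsilon> \<le> 1 / 768" "\<epsilon> * (2 * \<kappa>) \<le> 1" "\<epsilon> * real M = \<kappa> / 2"
  proof -
    have A: "A = (2 * \<kappa> * 2 ^ k) * \<kappa>" by (simp add: A_def power2_eq_square)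
    have e: "\<epsilon> = 1 / (2 * \<kappa> * 2 ^ k)" using \<kappa> unfolding \<epsilon>_def A by simp
    have "2 * 6 * 64 \<le> 2 * \<kappa> * 2 ^ k" using \<kappa> pow64 by (intro mult_mono) auto
    then show "\<epsilon> \<le> 1 / 768" unfolding e by (simp add: divide_le_eq)
    show "\<epsilon> * (2 * \<kappa>) \<le> 1" unfolding e using \<kappa> pow64 by (simp add: divide_le_eq)
    show "0 < \<epsilon>" using \<kappa> Apos by (simp add: \<epsilon>_def)
    show "\<epsilon> * real M = \<kappa> / 2" using MA Apos by (simp add: \<epsilon>_def field_simps)
  qed
  have c1: "real (M choose k) * 2 ^ k \<le> Q"
  proof -
    have "real (M choose k) * 2 ^ k \<le> real M ^ k / F * 2 ^ k"
      unfolding F_def by (intro mult_right_mono binomial_le_pow_fact) auto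
    then show ?thesis by (simp add: Q_def MA[symmetric] power_mult_distrib mult.commute)
  qed
  have c2: "real (M choose (k - 1)) * 2 ^ (k - 1) \<le> \<epsilon> * Q"
  proof -
    have "real (M choose (k - 1)) * 2 ^ (k - 1) \<le> real M ^ (k - 1) / fact (k - 1) * 2 ^ (k - 1)"
      by (intro mult_right_mono binomial_le_pow_fact) auto
    also have "\<dots> = A ^ (k - 1) / fact (k - 1)" by (simp add: MA[symmetric] power_mult_distrib mult.commute)
    also have "\<dots> = \<epsilon> * Q"
    proof -
      have "A ^ k = A * A ^ (k - 1)" "F = \<kappa> * fact (k - 1)"
        using k by (cases k; simp add: F_def \<kappa>_def)+
      then show ?thesis using Apos \<kappa> by (simp add: \<epsilon>_def Q_def)
    qed
    finally show ?thesis .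
  qed
  have wn: "0 \<le> weight k t" if "0 \<le> t" "t \<le> 21 / 16" for t
  proof -
    have "t * q \<le> 21 / 16 * (1 / 32)" using that q by (intro mult_mono) auto
    then show ?thesis by (simp add: weight_def q_def)
  qed
  let ?c = "real (M choose (k - 1))" and ?C = "real (M choose k)"
  have w4: "weight k (21 / 16) \<le> 2 * exp (- (21 / 8 * \<kappa>)) ^ k" using w[of "21 / 16"] by simp
  have w2: "weight k (9 / 8) \<le> 2 * exp (- (9 / 4 * \<kappa>)) ^ k" using w[of "9 / 8"] by simp
  have w1: "weight k (3 / 4) \<le> 2 * exp (- (3 / 2 * \<kappa>)) ^ k" using w[of "3 / 4"] by simp
  have two: "(2 :: real) ^ k = 2 * 2 ^ (k - 1)" using k by (cases k) auto
  have Qe: "Q * x ^ k = (A * x) ^ k / F" for x by (simp add: Q_def power_mult_distrib)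
  have a1: "?C * 2 ^ k * binomial_tail (M - k) q k \<le> 2 * (P1 ^ k / F)"
  proof -
    have "?C * 2 ^ k * binomial_tail (M - k) q k \<le> Q * ((2 * \<kappa>) ^ k * (2 * exp (1 - 2 * \<kappa>) ^ k))"
      using q by (intro mult_mono c1 tail Qpos binomial_tail_nonneg) auto
    also have "\<dots> = 2 * (P1 ^ k / F)" by (simp add: Q_def P1_def power_mult_distrib)
    finally show ?thesis .
  qed
  have a2: "?c * 2 ^ (k - 1) * binomial_tail (M - (k - 1)) q (k + 1) \<le> 2 * (P1 ^ k / F)"
  proof -
    have "?c * 2 ^ (k - 1) * binomial_tail (M - (k - 1)) q (k + 1)
        \<le> \<epsilon> * Q * ((2 * \<kappa>) ^ (k + 1) * (2 * exp (1 - 2 * \<kappa>) ^ k))"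
      using q \<epsilon> Qpos by (intro mult_mono c2 tail binomial_tail_nonneg) auto
    also have "\<dots> = \<epsilon> * (2 * \<kappa>) * (2 * (P1 ^ k / F))" by (simp add: Q_def P1_def power_mult_distrib)
    also have "\<dots> \<le> 1 * (2 * (P1 ^ k / F))"
      using \<epsilon> Ppos F by (intro mult_right_mono) auto
    finally show ?thesis by simp
  qed
  have a4: "?C * 2 ^ k * (?c * 2 ^ (k - 1)) * weight k (21 / 16) \<le> 2 * \<epsilon> * (P4 ^ k / F)"
  proof -
    have "?C * 2 ^ k * (?c * 2 ^ (k - 1)) * weight k (21 / 16) \<le> Q * (\<epsilon> * Q) * (2 * exp (- (21 / 8 * \<kappa>)) ^ k)"
      using \<epsilon> Qpos by (intro mult_mono c1 c2 w4 wn mult_nonneg_nonneg) auto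
    also have "\<dots> = 2 * \<epsilon> * (P4 ^ k / F) / F"
      by (simp add: Q_def P4_def power_mult_distrib power2_eq_square)
    also have "\<dots> \<le> 2 * \<epsilon> * (P4 ^ k / F) / 1" using \<epsilon> Ppos F by (intro divide_left_mono) auto
    finally show ?thesis by simp
  qed
  have b4: "?c * 2 ^ (k - 1) * (?c * 2 ^ (k - 1)) * weight k (21 / 16) \<le> 2 * \<epsilon> * (P4 ^ k / F)"
  proof -
    have "\<epsilon> * Q \<le> 1 * Q" using \<epsilon> Qpos by (intro mult_right_mono) auto
    then have c2': "?c * 2 ^ (k - 1) \<le> Q" using c2 by simp
    have "?c * 2 ^ (k - 1) * (?c * 2 ^ (k - 1)) * weight k (21 / 16) \<le> Q * (\<epsilon> * Q) * (2 * exp (- (21 / 8 * \<kappa>)) ^ k)"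
      using \<epsilon> Qpos by (intro mult_mono c2' c2 w4 wn mult_nonneg_nonneg) auto
    also have "\<dots> = 2 * \<epsilon> * (P4 ^ k / F) / F"
      by (simp add: Q_def P4_def power_mult_distrib power2_eq_square)
    also have "\<dots> \<le> 2 * \<epsilon> * (P4 ^ k / F) / 1" using \<epsilon> Ppos F by (intro divide_left_mono) auto
    finally show ?thesis by simp
  qed
  have a3: "?C * 2 ^ k * (2 ^ (k - 1) * (\<kappa> * weight k (9 / 8))) \<le> \<kappa> * (P2 ^ k / F)"
  proof -
    have "?C * 2 ^ k * (2 ^ (k - 1) * (\<kappa> * weight k (9 / 8)))
        \<le> Q * (2 ^ (k - 1) * (\<kappa> * (2 * exp (- (9 / 4 * \<kappa>)) ^ k)))"
      using \<kappa> Qpos by (intro mult_mono c1 w2 wn mult_nonneg_nonneg order.refl) auto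
    also have "\<dots> = \<kappa> * (P2 ^ k / F)" by (simp add: Q_def P2_def power_mult_distrib two)
    finally show ?thesis .
  qed
  have b3: "?c * 2 ^ (k - 1) * (2 ^ (k - 1) * (real ((k - 1) * M) * weight k (9 / 8))) \<le> \<kappa>\<^sup>2 * (P2 ^ k / F)"
  proof -
    have "real (k - 1) * real M \<le> \<kappa> * real M" unfolding \<kappa>_def by (intro mult_right_mono) auto
    then have km: "real ((k - 1) * M) \<le> \<kappa> * real M" by simp
    have "?c * 2 ^ (k - 1) * (2 ^ (k - 1) * (real ((k - 1) * M) * weight k (9 / 8)))
        \<le> \<epsilon> * Q * (2 ^ (k - 1) * ((\<kappa> * real M) * (2 * exp (- (9 / 4 * \<kappa>)) ^ k)))"
      using \<kappa> Qpos \<epsilon> by (intro mult_mono c2 w2 wn km mult_nonneg_nonneg order.refl) auto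
    also have "\<dots> = (\<epsilon> * real M) * (\<kappa> * (P2 ^ k / F))"
      by (simp add: Q_def P2_def power_mult_distrib two)
    also have "\<dots> = \<kappa>\<^sup>2 / 2 * (P2 ^ k / F)" unfolding \<epsilon>(4) by (simp add: power2_eq_square)
    also have "\<dots> \<le> \<kappa>\<^sup>2 * (P2 ^ k / F)" using Ppos F by (intro mult_right_mono) auto
    finally show ?thesis .
  qed
  have b2: "?c * 2 ^ (k - 1) * (2 ^ (k - 1) * weight k (3 / 4)) \<le> \<epsilon> * (P3 ^ k / F)"
  proof -
    have "?c * 2 ^ (k - 1) * (2 ^ (k - 1) * weight k (3 / 4)) \<le> \<epsilon> * Q * (2 ^ (k - 1) * (2 * exp (- (3 / 2 * \<kappa>)) ^ k))"
      using Qpos \<epsilon> by (intro mult_mono c2 w1 wn mult_nonneg_nonneg order.refl) auto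
    also have "\<dots> = \<epsilon> * (P3 ^ k / F)" by (simp add: Q_def P3_def power_mult_distrib two)
    finally show ?thesis .
  qed
  have d1: "P1 ^ k / F \<le> 3 / 1000"
  proof -
    have "P1 ^ k / F \<le> (11 / 10) ^ k / F" using Ppos P1 F by (intro divide_right_mono power_mono) auto
    also have "\<dots> \<le> (11 / 10) ^ 6 / 720" unfolding F_def by (rule power_fact_decay[OF _ _ k]) auto
    also have "\<dots> \<le> 3 / 1000" by (simp add: power_divide)
    finally show ?thesis .
  qed
  have d3: "\<epsilon> * (P3 ^ k / F) \<le> 1 / 768 * (1 / 100)"
  proof (rule mult_mono)
    have "P3 ^ k / F \<le> (12 / 10) ^ k / F" using Ppos P3 F by (intro divide_right_mono power_mono) auto
    also have "\<dots> \<le> (12 / 10) ^ 6 / 720" unfolding F_def by (rule power_fact_decay[OF _ _ k]) auto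
    also have "\<dots> \<le> 1 / 100" by (simp add: power_divide)
    finally show "P3 ^ k / F \<le> 1 / 100" .
  qed (use \<epsilon> Ppos F in auto)
  have d4: "\<epsilon> * (P4 ^ k / F) \<le> 1 / 768 * (3 / 2)"
  proof (rule mult_mono)
    have "P4 ^ k / F \<le> (32 / 10) ^ k / F" using Ppos P4 F by (intro divide_right_mono power_mono) auto
    also have "\<dots> \<le> (32 / 10) ^ 6 / 720" unfolding F_def by (rule power_fact_decay[OF _ _ k]) auto
    also have "\<dots> \<le> 3 / 2" by (simp add: power_divide)
    finally show "P4 ^ k / F \<le> 3 / 2" .
  qed (use \<epsilon> Ppos F in auto)
  have d2: "\<kappa>\<^sup>2 * (P2 ^ k / F) \<le> 1 / 10000" "\<kappa> * (P2 ^ k / F) \<le> 1 / 10000"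
  proof -
    have "P2 ^ k / F \<le> P2 ^ k / 1" using F Ppos by (intro divide_left_mono) auto
    also have "\<dots> \<le> (1 / 10) ^ k" using P2 Ppos by (simp add: power_mono)
    finally have "\<kappa>\<^sup>2 * (P2 ^ k / F) \<le> \<kappa>\<^sup>2 * (1 / 10) ^ k" by (intro mult_left_mono) auto
    also have "\<dots> \<le> 6\<^sup>2 * (1 / 10) ^ 6"
      unfolding \<kappa>_def by (rule power_geometric_decay[OF k]) (auto simp: power2_eq_square)
    also have "\<dots> \<le> 1 / 10000" by (simp add: power_divide)
    finally show 1: "\<kappa>\<^sup>2 * (P2 ^ k / F) \<le> 1 / 10000" .
    have "\<kappa> * (P2 ^ k / F) \<le> \<kappa>\<^sup>2 * (P2 ^ k / F)"
      using \<kappa> Ppos F by (intro mult_right_mono) (auto simp: power2_eq_square)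
    then show "\<kappa> * (P2 ^ k / F) \<le> 1 / 10000" using 1 by linarith
  qed
  have "antitwin_bound k =
      ?C * 2 ^ k * binomial_tail (M - k) q k
    + ?c * 2 ^ (k - 1) * binomial_tail (M - (k - 1)) q (k + 1)
    + 32 * (?C * 2 ^ k * (?c * 2 ^ (k - 1)) * weight k (21 / 16)
        + ?C * 2 ^ k * (2 ^ (k - 1) * (\<kappa> * weight k (9 / 8))))
    + 32 * (?c * 2 ^ (k - 1) * (?c * 2 ^ (k - 1)) * weight k (21 / 16)
        + ?c * 2 ^ (k - 1) * (2 ^ (k - 1) * (real ((k - 1) * M) * weight k (9 / 8)))
        + ?c * 2 ^ (k - 1) * (2 ^ (k - 1) * weight k (3 / 4)))"
    unfolding antitwin_bound_def q_def \<kappa>_def by (simp only: distrib_left ac_simps)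
  also have "\<dots> \<le> 6 / 1000 + 6 / 1000 + 32 * (1 / 256 + 1 / 10000) + 32 * (1 / 256 + 1 / 10000 + 1 / 76800)"
  proof (intro add_mono mult_left_mono)
    have two: "2 * \<epsilon> * (P4 ^ k / F) \<le> 1 / 256" using d4 unfolding mult.assoc by linarith
    have one: "2 * (P1 ^ k / F) \<le> 6 / 1000" using d1 by linarith
    show "?C * 2 ^ k * binomial_tail (M - k) q k \<le> 6 / 1000" using a1 one by (rule order.trans)
    show "?c * 2 ^ (k - 1) * binomial_tail (M - (k - 1)) q (k + 1) \<le> 6 / 1000" using a2 one by (rule order.trans)
    show "?C * 2 ^ k * (?c * 2 ^ (k - 1)) * weight k (21 / 16) \<le> 1 / 256" using a4 two by (rule order.trans)
    show "?c * 2 ^ (k - 1) * (?c * 2 ^ (k - 1)) * weight k (21 / 16) \<le> 1 / 256" using b4 two by (rule order.trans)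
    show "?C * 2 ^ k * (2 ^ (k - 1) * (\<kappa> * weight k (9 / 8))) \<le> 1 / 10000" using a3 d2(2) by (rule order.trans)
    show "?c * 2 ^ (k - 1) * (2 ^ (k - 1) * (real ((k - 1) * M) * weight k (9 / 8))) \<le> 1 / 10000"
      using b3 d2(1) by (rule order.trans)
    have "1 / 768 * (1 / 100) = (1 / 76800 :: real)" by simp
    then show "?c * 2 ^ (k - 1) * (2 ^ (k - 1) * weight k (3 / 4)) \<le> 1 / 76800"
      using order.trans[OF b2 d3] by simp
  qed simp_all
  also have "\<dots> < 1" by simp
  finally show ?thesis .
qed

lemma antitwin_bound_less_one:
  assumes "4 \<le> k" and M: "M = k\<^sup>2 * 2 ^ k"
  shows "antitwin_bound k < 1"
proof -
  consider "k = 4" | "k = 5" | "6 \<le> k" using assms by linarith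
  then show ?thesis
  proof cases
    case 1
    then have "M = 256" using M by simp
    then show ?thesis using antitwin_bound_4 1 by blast
  next
    case 2
    then have "M = 800" using M by simp
    then show ?thesis using antitwin_bound_5 2 by blast
  qed (rule antitwin_bound_ge_6[OF _ M])
qed

end

section \<open>The bound for \<open>p \<ge> 3\<close>\<close>

lemma self_le_exp_half: "0 \<le> x \<Longrightarrow> x \<le> exp (x / 2 :: real)"
proof -
  assume "0 \<le> x"
  have "0 \<le> (x / 2 - 1)\<^sup>2" by simp
  then have "x \<le> 1 + x / 2 + (x / 2)\<^sup>2 / 2" by (simp add: power2_eq_square algebra_simps)
  also have "\<dots> \<le> exp (x / 2)" using \<open>0 \<le> x\<close> by (intro exp_lower_Taylor_quadratic) simp
  finally show ?thesis .
qed

text \<open>Reduces the comparison to exponents: \<open>1 / 2\<close>, \<open>3 / 4\<close>,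
  \<open>real k / 2\<close> and \<open>l\<close> bound the logarithms of \<open>3 / 2\<close>, 2,
  \<open>k\<close> and \<open>p\<close>. The factorial is dropped.\<close>

lemma colourings_le_exp:
  fixes k p :: nat and l :: real
  assumes l: "real p \<le> exp l"
  shows "3 / 2 * (2 * real k ^ p * real p ^ k) ^ k * real p ^ (k + 1) / fact k
    \<le> exp (1 / 2 + real k * (3 / 4 + real p * (real k / 2) + real k * l) + (real k + 1) * l)"
proof -
  have two: "2 \<le> exp (3 / 4 :: real)" using exp_lower_Taylor_quadratic[of "3 / 4"] by (simp add: power2_eq_square)
  have ep: "exp x ^ n = exp (real n * x)" for x n by (simp add: exp_of_nat_mult)
  have "2 * real k ^ p * real p ^ k \<le> exp (3 / 4) * exp (real k / 2) ^ p * exp l ^ k"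
    using l self_le_exp_half[of "real k"] by (intro mult_mono power_mono two) auto
  also have "\<dots> = exp (3 / 4 + real p * (real k / 2) + real k * l)" by (simp add: ep exp_add)
  finally have "(2 * real k ^ p * real p ^ k) ^ k \<le> exp (3 / 4 + real p * (real k / 2) + real k * l) ^ k"
    by (intro power_mono) auto
  also have "\<dots> = exp (real k * (3 / 4 + real p * (real k / 2) + real k * l))" by (rule ep)
  finally have a: "(2 * real k ^ p * real p ^ k) ^ k \<le> exp (real k * (3 / 4 + real p * (real k / 2) + real k * l))" .
  have "real p ^ (k + 1) \<le> exp l ^ (k + 1)" using l by (intro power_mono) auto
  also have "\<dots> = exp ((real k + 1) * l)" by (simp only: ep of_nat_add of_nat_1)
  finally have b: "real p ^ (k + 1) \<le> exp ((real k + 1) * l)" .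
  have c: "3 / 2 \<le> exp (1 / 2 :: real)" using exp_ge_add_one_self[of "1 / 2"] by simp
  have "3 / 2 * (2 * real k ^ p * real p ^ k) ^ k * real p ^ (k + 1) / fact k
      \<le> 3 / 2 * (2 * real k ^ p * real p ^ k) ^ k * real p ^ (k + 1) / 1"
    by (intro divide_left_mono) auto
  also have "\<dots> = 3 / 2 * (2 * real k ^ p * real p ^ k) ^ k * real p ^ (k + 1)" by simp
  also have "\<dots> \<le> exp (1 / 2) * exp (real k * (3 / 4 + real p * (real k / 2) + real k * l)) * exp ((real k + 1) * l)"
    by (intro mult_mono a b c) auto
  finally show ?thesis by (simp add: exp_add)
qed

lemma square_le_four_power: "4 \<le> p \<Longrightarrow> real p ^ 2 \<le> 4 ^ (p - 2)"
proof (induction p rule: dec_induct)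
  case (step p)
  have "real (Suc p) \<le> 2 * real p" using step by simp
  then have "real (Suc p) ^ 2 \<le> (2 * real p) ^ 2" by (intro power_mono) auto
  also have "\<dots> = 4 * real p ^ 2" by (simp add: power2_eq_square)
  also have "\<dots> \<le> 4 * 4 ^ (p - 2)" using step by simp
  also have "Suc p - 2 = Suc (p - 2)" using step by linarith
  then have "4 * 4 ^ (p - 2) = (4 :: real) ^ (Suc p - 2)" by simp
  finally show ?case .
qed (simp add: power2_eq_square)

text \<open>The number of configurations, with the constants collected from all terms, against the
  reciprocal of the failure probability in the third term of \<open>plain_bound\<close>.\<close>

lemma colourings_less_exp:
  assumes p: "3 \<le> p" and k: "4 \<le> k"
  shows "3 / 2 * (2 * real k ^ p * real p ^ k) ^ k * real p ^ (k + 1) / fact k < exp (2 * real k ^ p / real p)"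
proof -
  consider "p = 3" "k = 4" | "p = 3" "5 \<le> k" | "4 \<le> p" using p k by linarith
  then show ?thesis
  proof cases
    case 1
    \<comment> \<open>In this case even exact logarithms would fail without the factorial 24, so the
      inequality is computed, with \<open>271 / 100 \<le> exp 1\<close> and
      \<open>42 \<le> 128 / 3\<close>.\<close>
    have "(545 / 512 :: real) \<le> exp (1 / 16)"
      using exp_lower_Taylor_quadratic[of "1 / 16"] by (simp add: power2_eq_square)
    then have "(545 / 512 :: real) ^ 16 \<le> exp (1 / 16) ^ 16" by (intro power_mono) auto
    also have "exp (1 / 16) ^ 16 = exp (1 :: real)" by (simp flip: exp_of_nat_mult)
    finally have "271 / 100 \<le> exp (1 :: real)" by (simp add: power_divide)
    then have "(271 / 100) ^ 42 \<le> exp (1 :: real) ^ 42" by (intro power_mono) auto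
    also have "\<dots> = exp (42 :: real)" by (simp flip: exp_of_nat_mult)
    also have "\<dots> \<le> exp (128 / 3)" by simp
    finally have e: "(271 / 100) ^ 42 \<le> exp (128 / 3 :: real)" .
    have "3 / 2 * (2 * 4 ^ 3 * 3 ^ 4) ^ 4 * 3 ^ 5 / 24 < (271 / 100 :: real) ^ 42"
      by (simp add: power_divide)
    with e have "3 / 2 * (2 * 4 ^ 3 * 3 ^ 4) ^ 4 * 3 ^ 5 / 24 < exp (128 / 3 :: real)" by (rule less_le_trans[rotated])
    then show ?thesis by (simp add: 1 fact_numeral)
  next
    case 2
    define \<kappa> where "\<kappa> = real k"
    have \<kappa>: "5 \<le> \<kappa>" using 2 by (simp add: \<kappa>_def)
    have l: "real p \<le> exp (5 / 4)"
      using exp_lower_Taylor_quadratic[of "5 / 4"] 2 by (simp add: power2_eq_square)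
    have "5 * \<kappa> \<le> \<kappa> * \<kappa>" using \<kappa> by (intro mult_right_mono) auto
    moreover have "5 * (\<kappa> * \<kappa>) \<le> \<kappa> * (\<kappa> * \<kappa>)" using \<kappa> by (intro mult_right_mono) auto
    ultimately have "7 / 4 + 2 * \<kappa> + 11 / 4 * (\<kappa> * \<kappa>) < 2 * (\<kappa> * (\<kappa> * \<kappa>)) / 3"
      using \<kappa> by linarith
    also have "7 / 4 + 2 * \<kappa> + 11 / 4 * (\<kappa> * \<kappa>)
        = 1 / 2 + \<kappa> * (3 / 4 + 3 * (\<kappa> / 2) + \<kappa> * (5 / 4)) + (\<kappa> + 1) * (5 / 4)"
      by (simp add: field_simps)
    finally have lt: "1 / 2 + \<kappa> * (3 / 4 + 3 * (\<kappa> / 2) + \<kappa> * (5 / 4)) + (\<kappa> + 1) * (5 / 4)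
        < 2 * (\<kappa> * (\<kappa> * \<kappa>)) / 3" .
    have "3 / 2 * (2 * \<kappa> ^ p * real p ^ k) ^ k * real p ^ (k + 1) / fact k
        \<le> exp (1 / 2 + \<kappa> * (3 / 4 + real p * (\<kappa> / 2) + \<kappa> * (5 / 4)) + (\<kappa> + 1) * (5 / 4))"
      using colourings_le_exp[OF l, of k] by (simp only: \<kappa>_def)
    also have "\<dots> < exp (2 * \<kappa> ^ p / real p)"
      using lt unfolding 2(1) by (simp only: exp_less_cancel_iff of_nat_numeral power3_eq_cube mult.assoc)
    finally show ?thesis by (simp only: \<kappa>_def)
  next
    case 3
    define \<kappa> where "\<kappa> = real k"
    define \<pi> where "\<pi> = real p"
    have \<kappa>: "4 \<le> \<kappa>" and \<pi>: "4 \<le> \<pi>" using 3 k by (simp_all add: \<kappa>_def \<pi>_def)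
    \<comment> \<open>This crude bound for the logarithm of \<open>p\<close> suffices: the left
      exponent stays below twice \<open>\<pi> * \<kappa> ^ 2\<close>, and the right one is at least
      that.\<close>
    have l: "real p \<le> exp (\<pi> / 2)" unfolding \<pi>_def by (rule self_le_exp_half) simp
    have a1: "4 * \<kappa> \<le> \<kappa> * \<kappa>" using \<kappa> by (intro mult_right_mono) auto
    have a2: "4 * (\<kappa> * \<kappa>) \<le> \<pi> * (\<kappa> * \<kappa>)" using \<pi> by (intro mult_right_mono) auto
    have a3: "\<pi> * (4 * \<kappa>) \<le> \<pi> * (\<kappa> * \<kappa>)" using a1 \<pi> by (intro mult_left_mono) auto
    have a4: "\<pi> * 4 \<le> \<pi> * \<kappa>" using \<kappa> \<pi> by (intro mult_left_mono) auto
    have "1 / 2 + \<kappa> * (3 / 4 + \<pi> * (\<kappa> / 2) + \<kappa> * (\<pi> / 2)) + (\<kappa> + 1) * (\<pi> / 2)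
        = 1 / 2 + 3 / 4 * \<kappa> + \<pi> * (\<kappa> * \<kappa>) + 1 / 2 * (\<pi> * \<kappa>) + 1 / 2 * \<pi>"
      by (simp add: field_simps)
    also have "\<dots> < 2 * (\<pi> * (\<kappa> * \<kappa>))" using a1 a2 a3 a4 \<kappa> \<pi> by linarith
    also have "\<dots> \<le> 2 * \<kappa> ^ p / \<pi>"
    proof -
      have "\<pi> ^ 2 \<le> 4 ^ (p - 2)" unfolding \<pi>_def by (rule square_le_four_power[OF 3])
      also have "\<dots> \<le> \<kappa> ^ (p - 2)" using \<kappa> by (intro power_mono) auto
      finally have "\<kappa> ^ 2 * \<pi> ^ 2 \<le> \<kappa> ^ 2 * \<kappa> ^ (p - 2)" by (intro mult_left_mono) auto
      also have "\<dots> = \<kappa> ^ (2 + (p - 2))" by (simp only: power_add)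
      also have "2 + (p - 2) = p" using 3 by simp
      finally show ?thesis using \<pi> by (simp add: power2_eq_square field_simps)
    qed
    finally have "exp (1 / 2 + \<kappa> * (3 / 4 + \<pi> * (\<kappa> / 2) + \<kappa> * (\<pi> / 2)) + (\<kappa> + 1) * (\<pi> / 2)) < exp (2 * \<kappa> ^ p / \<pi>)"
      by simp
    with colourings_le_exp[OF l, of k] show ?thesis
      unfolding \<kappa>_def[symmetric] \<pi>_def[symmetric] by (rule order.strict_trans1)
  qed
qed

lemma linear_times_geometric_le:
  assumes "3 \<le> p" "4 \<le> k"
  shows "real k * (1 / real p) ^ (k - 1) \<le> 3 / 20"
proof -
  have "real k * (1 / 3) ^ (k - 1) \<le> 3 / 20"
    using assms(2)
  proof (induction k rule: dec_induct)
    case base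
    then show ?case by (simp add: power3_eq_cube)
  next
    case (step k)
    have "(1 / 3 :: real) ^ k = (1 / 3) * (1 / 3) ^ (k - 1)" using step by (cases k) auto
    then have "real (Suc k) * (1 / 3) ^ (Suc k - 1) = (real (Suc k) / 3) * (1 / 3) ^ (k - 1)" by simp
    also have "\<dots> \<le> real k * (1 / 3) ^ (k - 1)" using step by (intro mult_right_mono) auto
    finally show ?case using step by linarith
  qed
  moreover have "(1 / real p) ^ (k - 1) \<le> (1 / 3) ^ (k - 1)"
    using assms by (intro power_mono divide_left_mono) auto
  then have "real k * (1 / real p) ^ (k - 1) \<le> real k * (1 / 3) ^ (k - 1)" by (intro mult_left_mono) auto
  ultimately show ?thesis by linarith
qed

context random_types
begin

text \<open>The third term dominates: the failure probabilities of the first two together contribute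
  \<open>2 ^ k * exp (- z)\<close>, which is at most \<open>T\<close>. The bases left out cost at
  most the factor \<open>11 / 10\<close>, and \<open>11 / 10 * (4 / 3) \<le> 3 / 2\<close> leads to
  the constant in \<open>colourings_less_exp\<close>.\<close>

lemma plain_bound_less_one:
  assumes p3: "3 \<le> p" and k: "4 \<le> k" and M: "M = 2 * k ^ p * p ^ k" and L: "L = 2 * k ^ p * p ^ (k - 1)"
  shows "plain_bound k L < 1"
proof -
  define \<kappa> where "\<kappa> = real k"
  define \<pi> where "\<pi> = real p"
  define x where "x = (1 / \<pi>) ^ k"
  define y where "y = (1 / \<pi>) ^ (k - 1)"
  define z where "z = \<kappa> ^ p"
  define Q where "Q = real M ^ k / fact k * \<pi> ^ k"
  define T where "T = exp (- (2 * z / \<pi>))"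
  have \<kappa>: "4 \<le> \<kappa>" and \<pi>: "3 \<le> \<pi>" using k p3 by (simp_all add: \<kappa>_def \<pi>_def)
  have y: "0 < y" "y \<le> 1" and x: "0 < x" "x \<le> 1" using \<pi> by (auto simp: x_def y_def power_le_one)
  have xy: "x = y / \<pi>"
  proof -
    have "x = (1 / \<pi>) ^ Suc (k - 1)" using k by (simp add: x_def)
    then show ?thesis by (simp add: y_def)
  qed
  have ky: "\<kappa> * y \<le> 3 / 20" unfolding \<kappa>_def y_def \<pi>_def by (rule linear_times_geometric_le[OF p3 k])
  have kx: "\<kappa> * x \<le> 1 / 20"
  proof -
    have "\<kappa> * x = (\<kappa> * y) / \<pi>" by (simp add: xy)
    also have "\<dots> \<le> (3 / 20) / 3" using ky \<kappa> y \<pi> by (intro frac_le) auto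
    finally show ?thesis by simp
  qed
  have yL: "y * real L = 2 * z"
    using \<pi> by (simp add: y_def L z_def \<kappa>_def \<pi>_def power_one_over)
  have xM: "x * real M = 2 * z"
    using \<pi> by (simp add: x_def M z_def \<kappa>_def \<pi>_def power_one_over)
  have xL: "x * real L = 2 * z / \<pi>" using yL by (simp add: xy)
  have small: "exp t \<le> 11 / 10" if "0 \<le> t" "t \<le> 3 / 40" for t :: real
  proof -
    have "t\<^sup>2 \<le> (3 / 40)\<^sup>2" using that by (intro power_mono) auto
    then show ?thesis using exp_bound[of t] that by (simp add: power2_eq_square)
  qed
  have decay: "(1 - s) ^ (N - k) \<le> 11 / 10 * exp (- (s * real N))" if s: "0 \<le> s" "s \<le> 1" "s * \<kappa> \<le> 3 / 40" for s N
  proof -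
    have "(1 - s) ^ (N - k) \<le> exp (- s * real (N - k))" using s by (intro one_minus_power_le_exp) auto
    also have "\<dots> \<le> exp (s * \<kappa> + - (s * real N))"
    proof -
      have "real N - \<kappa> \<le> real (N - k)" unfolding \<kappa>_def by linarith
      then have "s * (real N - \<kappa>) \<le> s * real (N - k)" using s by (intro mult_left_mono) auto
      then show ?thesis by (simp add: algebra_simps)
    qed
    also have "\<dots> = exp (s * \<kappa>) * exp (- (s * real N))" by (rule exp_add)
    also have "\<dots> \<le> 11 / 10 * exp (- (s * real N))" using s \<kappa> by (intro mult_right_mono small) auto
    finally show ?thesis .
  qed
  have d1: "(1 - x / 2) ^ (M - k) \<le> 11 / 10 * exp (- z)" using decay[of "x / 2" M] x kx xM by (simp add: mult.commute)
  have d2: "(1 - y / 2) ^ (L - k) \<le> 11 / 10 * exp (- z)" using decay[of "y / 2" L] y ky yL by (simp add: mult.commute)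
  have d3: "(1 - x) ^ (L - k) \<le> 11 / 10 * T" using decay[of x L] x kx xL by (simp add: mult.commute T_def)
  have kM: "k \<le> M"
  proof -
    have "k ^ 1 \<le> k ^ p" using k p3 by (intro power_increasing) auto
    also have "\<dots> \<le> k ^ p * (2 * p ^ k)" using p3 by simp
    finally show ?thesis by (simp add: M mult_ac)
  qed
  have c1: "real (M choose k) * \<pi> ^ k \<le> Q"
    unfolding Q_def using \<pi> by (intro mult_right_mono binomial_le_pow_fact) auto
  have c2: "real (M choose (k - 1)) * \<pi> ^ (k - 1) \<le> Q / \<pi>"
  proof -
    have e: "real M ^ k = real M * real M ^ (k - 1)" "fact k = \<kappa> * fact (k - 1)" "\<pi> ^ k = \<pi> * \<pi> ^ (k - 1)"
      using k by (cases k; simp add: \<kappa>_def)+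
    have "real M ^ (k - 1) / fact (k - 1) = 1 * (real M ^ (k - 1) / fact (k - 1))" by simp
    also have "\<dots> \<le> (real M / \<kappa>) * (real M ^ (k - 1) / fact (k - 1))"
      using kM k by (intro mult_right_mono) (auto simp: \<kappa>_def le_divide_eq)
    also have "\<dots> = real M ^ k / fact k" by (simp add: e)
    finally have "real (M choose (k - 1)) \<le> real M ^ k / fact k"
      using binomial_le_pow_fact[of M "k - 1"] by linarith
    then have "real (M choose (k - 1)) * \<pi> ^ (k - 1) \<le> real M ^ k / fact k * \<pi> ^ (k - 1)"
      using \<pi> by (intro mult_right_mono) auto
    also have "\<dots> = Q / \<pi>" using \<pi> by (simp add: Q_def e)
    finally show ?thesis .
  qed
  have Q0: "0 \<le> Q" using \<pi> by (simp add: Q_def)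
  have h: "0 \<le> 1 - x / 2" "0 \<le> 1 - y / 2" "0 \<le> 1 - x" using x y by auto
  have "plain_bound k L = real (M choose k) * \<pi> ^ k * (2 ^ (k - 1) * (1 - x / 2) ^ (M - k))
      + real (M choose (k - 1)) * \<pi> ^ (k - 1) * (\<pi> * (2 ^ (k - 1) * (1 - y / 2) ^ (L - k)))
      + real (M choose k) * \<pi> ^ k * (\<pi> * (1 - x) ^ (L - k))"
    by (simp only: plain_bound_def x_def y_def \<pi>_def)
  also have "\<dots> \<le> Q * (2 ^ (k - 1) * (11 / 10 * exp (- z)))
      + Q / \<pi> * (\<pi> * (2 ^ (k - 1) * (11 / 10 * exp (- z)))) + Q * (\<pi> * (11 / 10 * T))"
    using Q0 \<pi> h by (intro add_mono mult_mono c1 c2 d1 d2 d3 order.refl mult_nonneg_nonneg) auto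
  also have "\<dots> = 11 / 10 * Q * (2 * 2 ^ (k - 1) * exp (- z) + \<pi> * T)" using \<pi> by (simp add: field_simps)
  also have "2 * 2 ^ (k - 1) = (2 :: real) ^ k" using k by (cases k) auto
  also have "11 / 10 * Q * (2 ^ k * exp (- z) + \<pi> * T) \<le> 11 / 10 * Q * (4 / 3 * \<pi> * T)"
  proof -
    have z: "6 * \<kappa> \<le> z"
    proof -
      have "6 * \<kappa> \<le> 16 * \<kappa>" using \<kappa> by simp
      also have "16 * \<kappa> \<le> \<kappa>\<^sup>2 * \<kappa>" using \<kappa> power_mono[of 4 \<kappa> 2] by (intro mult_right_mono) auto
      also have "\<dots> = \<kappa> ^ 3" by (simp add: power3_eq_cube power2_eq_square)
      also have "\<dots> \<le> z" unfolding z_def using \<kappa> p3 by (intro power_increasing) auto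
      finally show ?thesis .
    qed
    have "2 * z / \<pi> \<le> 2 * z / 3" using z \<kappa> \<pi> by (intro divide_left_mono) auto
    then have "\<kappa> \<le> z - 2 * z / \<pi>" using z \<kappa> by linarith
    moreover have "(2 :: real) ^ k \<le> exp 1 ^ k" using exp_ge_add_one_self[of 1] by (intro power_mono) auto
    then have "2 ^ k \<le> exp \<kappa>" by (simp add: \<kappa>_def flip: exp_of_nat_mult)
    ultimately have "2 ^ k \<le> exp (z - 2 * z / \<pi>)" by (meson exp_le_cancel_iff order.trans)
    then have "2 ^ k * exp (- z) \<le> exp (z - 2 * z / \<pi>) * exp (- z)" by (rule mult_right_mono) simp
    also have "\<dots> = T" by (simp add: T_def flip: exp_add)
    finally have "2 ^ k * exp (- z) + \<pi> * T \<le> (1 + \<pi>) * T" by (simp add: algebra_simps)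
    also have "\<dots> \<le> 4 / 3 * \<pi> * T" using \<pi> by (intro mult_right_mono) (auto simp: T_def)
    finally show ?thesis using Q0 by (intro mult_left_mono) auto
  qed
  also have "\<dots> \<le> (3 / 2 * (Q * \<pi>)) * T"
    using Q0 \<pi> by (simp add: T_def)
  also have "\<dots> < exp (2 * z / \<pi>) * T"
  proof (rule mult_strict_right_mono)
    have "3 / 2 * (Q * \<pi>) = 3 / 2 * (2 * real k ^ p * real p ^ k) ^ k * real p ^ (k + 1) / fact k"
      by (simp add: Q_def M \<pi>_def)
    also have "\<dots> < exp (2 * z / \<pi>)"
      unfolding z_def \<kappa>_def \<pi>_def by (rule colourings_less_exp[OF p3 k])
    finally show "3 / 2 * (Q * \<pi>) < exp (2 * z / \<pi>)" .
  qed (simp add: T_def)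
  also have "\<dots> = 1" by (simp add: T_def flip: exp_add)
  finally show ?thesis .
qed

end

theorem theorem5:
  fixes m n p \<Delta> :: nat
  assumes "p = 2 * m + n" and "p \<ge> 2" and "\<Delta> \<ge> 5"
  shows "ereal (real p powr (real \<Delta> / 2)) \<le> ereal_of_enat (chi_family m n (graphs_max_degree \<Delta>)) \<and>
    chi_family m n (graphs_max_degree \<Delta>) \<le> enat (2 * (\<Delta> - 1) ^ p * p ^ (\<Delta> - 1) + 2)"
proof
  have p0: "0 < p" using assms(2) by simp
  show "ereal (real p powr (real \<Delta> / 2)) \<le> ereal_of_enat (chi_family m n (graphs_max_degree \<Delta>))"
    using assms(3) by (intro chi_family_ge[OF assms(1) p0]) simp
  define k where "k = \<Delta> - 1"
  have k: "4 \<le> k" and \<Delta>: "\<Delta> = Suc k" using assms(3) by (auto simp: k_def)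
  have rt: "random_types p (reverse_type m)"
    using assms(1,2) reverse_type_less reverse_type_reverse_type by unfold_locales auto
  show "chi_family m n (graphs_max_degree \<Delta>) \<le> enat (2 * (\<Delta> - 1) ^ p * p ^ (\<Delta> - 1) + 2)"
  proof (cases "p = 2")
    case True
    \<comment> \<open>Two antitwins over each of the \<open>M + 1\<close> bases, the apex included,
      give exactly \<open>2 * k ^ 2 * 2 ^ k + 2\<close> vertices.\<close>
    define M where "M = k\<^sup>2 * 2 ^ k"
    have "k * 1 \<le> k * (k * 2 ^ k)" using k by (intro mult_left_mono) auto
    then have kM: "k \<le> M" by (simp add: M_def power2_eq_square mult.assoc)
    have "random_types.antitwin_bound M k < 1"
      by (rule random_types.antitwin_bound_less_one[OF rt k M_def])
    then obtain \<tau> where "target k p 2 M (reverse_type m) \<tau>"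
      using random_types.ex_antitwin_target[OF rt True k kM] by blast
    then have "chi_family m n (graphs_max_degree \<Delta>) \<le> enat (Suc M * 2)"
      unfolding \<Delta> by (rule target.chi_family_le[OF _ assms(1) refl])
    also have "Suc M * 2 = 2 * (\<Delta> - 1) ^ p * p ^ (\<Delta> - 1) + 2"
      unfolding True by (simp add: M_def k_def)
    finally show ?thesis .
  next
    case False
    then have p3: "3 \<le> p" using assms(2) by simp
    \<comment> \<open>Without signs the target has \<open>M + 1\<close> vertices. \<open>M\<close>
      is a multiple of \<open>p\<close>, as the residue classes require.\<close>
    define M where "M = 2 * k ^ p * p ^ k"
    define L where "L = 2 * k ^ p * p ^ (k - 1)"
    have "p ^ k = p * p ^ (k - 1)" using k by (cases k) auto
    then have M_eq: "M = p * L" by (simp add: M_def L_def)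
    have "k ^ 1 \<le> k ^ p" using k p3 by (intro power_increasing) auto
    then have "k * 1 \<le> k ^ p * (2 * p ^ k)" using p0 by (intro mult_le_mono) auto
    then have kM: "k \<le> M" by (simp add: M_def mult_ac)
    have "random_types.plain_bound p M k L < 1"
      by (rule random_types.plain_bound_less_one[OF rt p3 k M_def L_def])
    then obtain \<tau> where "target k p 1 M (reverse_type m) \<tau>"
      using random_types.ex_plain_target[OF rt k kM M_eq] by blast
    then have "chi_family m n (graphs_max_degree \<Delta>) \<le> enat (Suc M * 1)"
      unfolding \<Delta> by (rule target.chi_family_le[OF _ assms(1) refl])
    also have "\<dots> \<le> enat (2 * (\<Delta> - 1) ^ p * p ^ (\<Delta> - 1) + 2)"
      by (simp add: M_def k_def)
    finally show ?thesis .
  qed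
qed

end
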